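(* Let $\ell\in\mathbb{Z}_{>0}$, let $\lambda\in(\mathfrak{a}_{\mathbb{Z}}^* )^+$ be a dominant integral weight and write $$\lambda=\ell\lambda_1+\lambda_0,\qquad\text{with } \lambda_0\in\Pi_\ell \text{ and } \lambda_1\in(\mathfrak{a}_{\mathbb{Z}}^* )^+ .$$ Then, in the abstract Fock space $\mathcal{F}_\ell$, $$C_\lambda = s_{\lambda_1^*}\cdot C_{\lambda_0},$$ where $\lambda_1^*=-w_0\lambda_1$, $s_{\lambda_1^*}\in\mathbb{K}[X]^{W_0}$ is the Weyl character, and $\cdot$ denotes the action of $\mathbb{K}[X]^{W_0}$ on $\mathcal{F}_\ell$.
   Context: Setting. $G$ is a (complex, connected) reductive algebraic group with maximal torus $T$ and Borel subgroup $B\supseteq T$; $\mathfrak{a}_{\mathbb{Z}}^*=\mathrm{Hom}(T,\mathbb{C}^\times)$ is the weight lattice; $W_0=N(T)/T$ is the finite Weyl group, generated by simple reflections $s_1,\dots,s_n$; $R^+$ is the set of positive roots; $\alpha_1,\dots,\alpha_n$ are the simple roots, $\alpha_1^\vee,\dots,\alpha_n^\vee$ the simple coroots, $\alpha^\vee$ the coroot of $\alpha$; $\mathring{\mathfrak{g}}$ is the Lie algebra of $G$. The element $\rho=\frac12\sum_{\alpha\in R^+}\alpha$ and the fundamental weights $\omega_1,\dots,\omega_n$ are assumed to lie in $\mathfrak{a}_{\mathbb{Z}}^*$. The dot action of $W_0$ on $\mathfrak{a}_{\mathbb{Z}}^*$ is $w\circ\lambda=w(\lambda+\rho)-\rho$.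 Let $w_0$ be the longest element of $W_0$, $\ell(w_0)=\mathrm{Card}(R^+)$ its length, and $\mu^*=-w_0\mu$ for $\mu\in\mathfrak{a}_{\mathbb{Z}}^*$. Put $$(\mathfrak{a}_{\mathbb{Z}}^* )^+=\{\lambda\in\mathfrak{a}_{\mathbb{Z}}^*\mid \langle\lambda+\rho,\alpha_i^\vee\rangle>0\text{ for }i=1,\dots,n\},$$ $$\Pi_\ell=\{a_1\omega_1+\cdots+a_n\omega_n\mid a_1,\dots,a_n\in\{0,1,\dots,\ell-1\}\}.$$ Abstract Fock space. Let $\mathbb{K}=\mathbb{Z}[t^{\frac12},t^{-\frac12}]$ and fix $\ell\in\mathbb{Z}_{>0}$. $\mathcal{F}_\ell$ is the $\mathbb{K}$-module generated by symbols $|\lambda\rangle$, $\lambda\in\mathfrak{a}_{\mathbb{Z}}^*$, with relations, for $i=1,\dots,n$, $$|s_i\circ\lambda\rangle=\begin{cases}-|\lambda\rangle,&\text{if }\langle\lambda+\rho,\alpha_i^\vee\rangle\in\ell\mathbb{Z}_{\ge0},\\ -t^{\frac12}|\lambda\rangle,&\text{if }0<\langle\lambda+\rho,\alpha_i^\vee\rangle<\ell,\\ -t^{\frac12}|s_i\circ\lambda^{(1)}\rangle-|\lambda^{(1)}\rangle-t^{\frac12}|\lambda\rangle,&\text{if }\langle\lambda+\rho,\alpha_i^\vee\rangle>\ell\text{ and }\langle\lambda+\rho,\alpha_i^\vee\rangle\notin\ell\mathbb{Z},\end{cases}$$ where $\lambda^{(1)}=\lambda-j\alpha_i$ if $\langle\lambda+\rho,\alpha_i^\vee\rangle=k\ell+j$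 with $k\in\mathbb{Z}_{>0}$, $j\in\{1,\dots,\ell-1\}$. When $\langle\lambda+\rho,\alpha_i^\vee\rangle=0$ (so $s_i\circ\lambda=\lambda$) the first relation is read as $|\lambda\rangle=0$. Bar involution. The $\mathbb{Z}$-linear involution $\overline{\phantom{x}}:\mathcal{F}_\ell\to\mathcal{F}_\ell$ is given by $\overline{t^{\frac12}}=t^{-\frac12}$ (that is, it is semilinear for $t^{\frac12}\mapsto t^{-\frac12}$) and $$\overline{|\lambda\rangle}=(-1)^{\ell(w_0)}(t^{-\frac12})^{\ell(w_0)-N_\lambda}\,|w_0\circ\lambda\rangle,\qquad N_\lambda=\mathrm{Card}\{\alpha\in R^+\mid\langle\lambda+\rho,\alpha^\vee\rangle\in\ell\mathbb{Z}\}.$$ Bases. It is known that $\mathcal{F}_\ell$ has $\mathbb{K}$-bases $\{|\lambda\rangle\mid\lambda\in(\mathfrak{a}_{\mathbb{Z}}^* )^+\}$ and $\{C_\lambda\mid\lambda\in(\mathfrak{a}_{\mathbb{Z}}^* )^+\}$, where $C_\lambda$ is determined by $$\overline{C_\lambda}=C_\lambda\quad\text{and}\quad C_\lambda=|\lambda\rangle+\sum_{\mu\in(\mathfrak{a}_{\mathbb{Z}}^* )^+,\ \mu\neq\lambda}p_{\mu\lambda}|\mu\rangle\ \text{ with }p_{\mu\lambda}\in t^{\frac12}\mathbb{Z}[t^{\frac12}].$$ Symmetric functions and their action. $\mathbb{K}[X]$ is the group algebra of $\mathfrak{a}_{\mathbb{Z}}^*$ with basis $X^\mu$, $X^\mu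 X^\nu=X^{\mu+\nu}$, and $W_0$-action $wX^\mu=X^{w\mu}$; $\mathbb{K}[X]^{W_0}$ is its ring of invariants. $\mathbb{K}[X]^{W_0}$ acts $\mathbb{K}$-linearly on $\mathcal{F}_\ell$ as follows: for $f=\sum_\mu f_\mu X^\mu\in\mathbb{K}[X]^{W_0}$ and $\gamma\in\mathfrak{a}_{\mathbb{Z}}^*$, $f\cdot|\gamma\rangle=\sum_\mu f_\mu|\ell\mu^*+\gamma\rangle=\sum_\mu f_\mu|-\ell w_0\mu+\gamma\rangle$ (this is well defined on $\mathcal{F}_\ell$). For $\lambda\in(\mathfrak{a}_{\mathbb{Z}}^* )^+$ the Weyl character is $$s_\lambda=\mathrm{char}(L_{\mathring{\mathfrak{g}}}(\lambda))=\frac{\sum_{w\in W_0}\det(w)X^{w\circ\lambda}}{\sum_{w\in W_0}\det(w)X^{w\circ0}}\in\mathbb{K}[X]^{W_0},$$ where $L_{\mathring{\mathfrak{g}}}(\lambda)$ is the irreducible $\mathring{\mathfrak{g}}$-module of highest weight $\lambda$. *)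

theory Defs
  imports Complex_Main "HOL-Library.Poly_Mapping" "HOL-Combinatorics.Permutations"
begin

section \<open>The weight lattice as a module over the integers\<close>

definition zmul :: "int \<Rightarrow> 'a::ab_group_add \<Rightarrow> 'a" where
  "zmul k x = (\<Sum>i<nat k. x) - (\<Sum>i<nat (- k). x)"

lemma zmul_Suc_left: "zmul (k + 1) x = zmul k x + x"
proof (cases "k \<ge> 0")
  case True
  then obtain n where "k = int n" by (metis zero_le_imp_eq_int)
  then show ?thesis by (simp add: zmul_def nat_add_distrib)
next
  case False
  then obtain n where n: "k = - int (Suc n)" using negD[of k] by auto
  then have "nat (- (k + 1)) = n" "nat (- k) = Suc n" "nat k = 0" "nat (k + 1) = 0" by auto
  then show ?thesis unfolding zmul_def by simp
qed

lemma zmul_0_left: "zmul 0 x = 0"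
  by (simp add: zmul_def)

lemma zmul_diff_1_left: "zmul (k - 1) x = zmul k x - x"
  using zmul_Suc_left[of "k - 1" x] by simp

lemma zmul_add_left: "zmul (a + b) x = zmul a x + zmul b x"
proof (induction b rule: int_induct[where k = 0])
  case base
  then show ?case by (simp add: zmul_0_left)
next
  case (step1 i)
  have "zmul (a + (i + 1)) x = zmul (a + i) x + x"
    using zmul_Suc_left[of "a + i" x] by (simp add: add.assoc)
  with step1 show ?case by (simp add: zmul_Suc_left add.assoc)
next
  case (step2 i)
  have "zmul (a + (i - 1)) x = zmul (a + i) x - x"
    using zmul_diff_1_left[of "a + i" x] by (simp add: algebra_simps)
  with step2 show ?case by (simp add: zmul_diff_1_left)
qed

lemma zmul_add_right: "zmul a (x + y) = zmul a x + zmul a y"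
  by (simp add: zmul_def sum.distrib)

lemma zmul_1_left: "zmul 1 x = x"
  by (simp add: zmul_def)

lemma zmul_mult: "zmul a (zmul b x) = zmul (a * b) x"
proof (induction a rule: int_induct[where k = 0])
  case base
  then show ?case by (simp add: zmul_0_left)
next
  case (step1 i)
  then show ?case by (simp add: zmul_Suc_left zmul_add_left distrib_right zmul_1_left)
next
  case (step2 i)
  have "zmul ((i - 1) * b) x = zmul (i * b) x - zmul b x"
    using zmul_add_left[of "(i - 1) * b" b x] by (simp add: algebra_simps)
  with step2 show ?case by (simp add: zmul_diff_1_left)
qed

global_interpretation Z: module zmul
  by standard (simp_all add: zmul_add_right zmul_add_left zmul_mult zmul_1_left)

text \<open>
  The determinant of an endomorphism of a free abelian group of finite rank, by the Leibniz
  formula in a basis; it does not depend on the basis chosen.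
\<close>

definition lattice_basis :: "'a::ab_group_add set \<Rightarrow> bool" where
  "lattice_basis B \<longleftrightarrow> finite B \<and> Z.independent B \<and> Z.span B = UNIV"

definition lattice_det :: "('a::ab_group_add \<Rightarrow> 'a) \<Rightarrow> int" where
  "lattice_det w = (let B = (SOME B. lattice_basis B) in
     \<Sum>p | p permutes B. sign p * (\<Prod>b\<in>B. Z.representation B (w b) (p b)))"


section \<open>Based root data\<close>

text \<open>
  The group $G \supseteq B \supseteq T$ enters through its based root datum, with the type
  \<^typ>\<open>'a\<close> as character lattice of $T$. The cocharacter lattice is identified with the additive
  maps from \<^typ>\<open>'a\<close> to \<^typ>\<open>int\<close> by the perfect pairing, so that \<open>coroot D \<alpha> lam\<close> is
  $\langle \lambda, \alpha^\vee \rangle$. The simple roots are \<open>simple D i\<close> for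
  $1 \le i \le$ \<open>nsimple D\<close>; values of the fields outside their index ranges are irrelevant.
\<close>

record 'a root_datum =
  roots :: "'a set"
  coroot :: "'a \<Rightarrow> 'a \<Rightarrow> int"
  nsimple :: nat
  simple :: "nat \<Rightarrow> 'a"
  fund_weight :: "nat \<Rightarrow> 'a"
  rho :: 'a

abbreviation idx :: "'a root_datum \<Rightarrow> nat set" where
  "idx D \<equiv> {1..nsimple D}"

definition reflect :: "'a::ab_group_add root_datum \<Rightarrow> 'a \<Rightarrow> 'a \<Rightarrow> 'a" where
  "reflect D \<alpha> lam = lam - zmul (coroot D \<alpha> lam) \<alpha>"

definition pos_roots :: "'a::ab_group_add root_datum \<Rightarrow> 'a set" where
  "pos_roots D =
     {\<beta> \<in> roots D. \<exists>c :: nat \<Rightarrow> nat. \<beta> = (\<Sum>i\<in>idx D. zmul (int (c i)) (simple D i))}"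

definition reduced_root_datum :: "'a::ab_group_add root_datum \<Rightarrow> bool" where
  "reduced_root_datum D \<longleftrightarrow>
     (\<exists>B :: 'a set. lattice_basis B) \<and>
     finite (roots D) \<and>
     inj_on (coroot D) (roots D) \<and>
     (\<forall>\<alpha>\<in>roots D. \<forall>x y. coroot D \<alpha> (x + y) = coroot D \<alpha> x + coroot D \<alpha> y) \<and>
     (\<forall>\<alpha>\<in>roots D. coroot D \<alpha> \<alpha> = 2) \<and>
     (\<forall>\<alpha>\<in>roots D. \<forall>\<beta>\<in>roots D. reflect D \<alpha> \<beta> \<in> roots D) \<and>
     (\<forall>\<alpha>\<in>roots D. \<forall>\<beta>\<in>roots D.
        (\<lambda>x. coroot D \<beta> x - coroot D \<beta> \<alpha> * coroot D \<alpha> x) \<in> coroot D ` roots D) \<and>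
     (\<forall>\<alpha>\<in>roots D. \<forall>k. zmul k \<alpha> \<in> roots D \<longrightarrow> k = 1 \<or> k = - 1)"

definition root_base :: "'a::ab_group_add root_datum \<Rightarrow> bool" where
  "root_base D \<longleftrightarrow>
     inj_on (simple D) (idx D) \<and> simple D ` idx D \<subseteq> roots D \<and>
     Z.independent (simple D ` idx D) \<and>
     (\<forall>\<beta>\<in>roots D. \<beta> \<in> pos_roots D \<or> - \<beta> \<in> pos_roots D)"

text \<open>
  If the roots do not span, the fundamental weights are determined only up to characters
  orthogonal to all coroots; any choice is allowed.
\<close>

definition based_root_datum :: "'a::ab_group_add root_datum \<Rightarrow> bool" where
  "based_root_datum D \<longleftrightarrow>
     reduced_root_datum D \<and> root_base D \<and>
     (\<forall>i\<in>idx D. \<forall>j\<in>idx D. coroot D (simple D j) (fund_weight D i) = (if i = j then 1 else 0)) \<and>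
     zmul 2 (rho D) = (\<Sum>\<alpha>\<in>pos_roots D. \<alpha>)"


section \<open>The Weyl group\<close>

definition word_prod :: "'a::ab_group_add root_datum \<Rightarrow> nat list \<Rightarrow> 'a \<Rightarrow> 'a" where
  "word_prod D is = foldr (\<circ>) (map (\<lambda>i. reflect D (simple D i)) is) id"

definition weyl_group :: "'a::ab_group_add root_datum \<Rightarrow> ('a \<Rightarrow> 'a) set" where
  "weyl_group D = {word_prod D is | is. set is \<subseteq> idx D}"

definition weyl_length :: "'a::ab_group_add root_datum \<Rightarrow> ('a \<Rightarrow> 'a) \<Rightarrow> nat" where
  "weyl_length D w = (LEAST k. \<exists>is. length is = k \<and> set is \<subseteq> idx D \<and> w = word_prod D is)"

definition w0 :: "'a::ab_group_add root_datum \<Rightarrow> 'a \<Rightarrow> 'a" where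
  "w0 D = (THE w. w \<in> weyl_group D \<and> (\<forall>v\<in>weyl_group D. weyl_length D v \<le> weyl_length D w))"

definition dot :: "'a::ab_group_add root_datum \<Rightarrow> ('a \<Rightarrow> 'a) \<Rightarrow> 'a \<Rightarrow> 'a" where
  "dot D w lam = w (lam + rho D) - rho D"

definition dual_weight :: "'a::ab_group_add root_datum \<Rightarrow> 'a \<Rightarrow> 'a" where
  "dual_weight D \<mu> = - w0 D \<mu>"

definition dominant :: "'a::ab_group_add root_datum \<Rightarrow> 'a set" where
  "dominant D = {lam. \<forall>i\<in>idx D. coroot D (simple D i) (lam + rho D) > 0}"

definition restricted :: "'a::ab_group_add root_datum \<Rightarrow> nat \<Rightarrow> 'a set" where
  "restricted D l =
     {\<Sum>i\<in>idx D. zmul (int (a i)) (fund_weight D i) | a :: nat \<Rightarrow> nat. \<forall>i\<in>idx D. a i < l}"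


section \<open>Coefficients and the group algebra of the weight lattice\<close>

text \<open>
  Laurent polynomials in $t^{1/2}$ are finitely supported functions on the exponents of
  $t^{1/2}$. The type \<open>'a \<Rightarrow>\<^sub>0 laurent\<close> serves both as the group algebra
  $\mathbb{K}[X]$, whose multiplication is the convolution product of the library, and as the
  free module on the symbols $|\lambda\rangle$.
\<close>

type_synonym laurent = "int \<Rightarrow>\<^sub>0 int"

definition th :: "int \<Rightarrow> laurent" where \<comment> \<open>$(t^{1/2})^k$\<close>
  "th k = Poly_Mapping.single k 1"

definition laurent_bar :: "laurent \<Rightarrow> laurent" where \<comment> \<open>$t^{1/2} \mapsto t^{-1/2}$\<close>
  "laurent_bar c = Poly_Mapping.map_key uminus c"

definition th_positive :: "laurent set" where \<comment> \<open>$t^{1/2}\mathbb{Z}[t^{1/2}]$\<close>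
  "th_positive = {c. \<forall>k\<in>Poly_Mapping.keys c. k > 0}"

definition smul :: "laurent \<Rightarrow> ('a \<Rightarrow>\<^sub>0 laurent) \<Rightarrow> ('a \<Rightarrow>\<^sub>0 laurent)" where
  "smul c x = Poly_Mapping.map ((*) c) x"

lemma lookup_smul: "Poly_Mapping.lookup (smul c x) \<mu> = c * Poly_Mapping.lookup x \<mu>"
  by (simp add: smul_def Poly_Mapping.map.rep_eq when_def)

global_interpretation K: module smul
  by standard
    (simp_all add: poly_mapping_eq_iff fun_eq_iff lookup_smul Poly_Mapping.lookup_add
      distrib_left distrib_right mult.assoc)

text \<open>
  The quotient of the two alternating sums exists and is unique, because the group algebra is
  a domain.
\<close>

definition weyl_alternating :: "'a::ab_group_add root_datum \<Rightarrow> 'a \<Rightarrow> ('a \<Rightarrow>\<^sub>0 laurent)" where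
  "weyl_alternating D lam =
     (\<Sum>w\<in>weyl_group D. Poly_Mapping.single (dot D w lam) (of_int (lattice_det w)))"

definition weyl_char :: "'a::ab_group_add root_datum \<Rightarrow> 'a \<Rightarrow> ('a \<Rightarrow>\<^sub>0 laurent)" where
  "weyl_char D lam = (THE f. f * weyl_alternating D 0 = weyl_alternating D lam)"


section \<open>The abstract Fock space\<close>

definition ket0 :: "'a \<Rightarrow> ('a \<Rightarrow>\<^sub>0 laurent)" where
  "ket0 lam = Poly_Mapping.single lam 1"

text \<open>
  Relators of the Fock space. If $\langle\lambda+\rho,\alpha_i^\vee\rangle = 0$ the relation is
  $|\lambda\rangle = 0$, which is stronger than $|\lambda\rangle = -|\lambda\rangle$.
\<close>

inductive_set fock_relators :: "'a::ab_group_add root_datum \<Rightarrow> nat \<Rightarrow> ('a \<Rightarrow>\<^sub>0 laurent) set"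
  for D :: "'a::ab_group_add root_datum" and l :: nat where
  zero: "\<lbrakk>i \<in> idx D; coroot D (simple D i) (lam + rho D) = 0\<rbrakk>
      \<Longrightarrow> ket0 lam \<in> fock_relators D l"
| wall: "\<lbrakk>i \<in> idx D; coroot D (simple D i) (lam + rho D) = int k * int l\<rbrakk>
      \<Longrightarrow> ket0 (dot D (reflect D (simple D i)) lam) - (- ket0 lam) \<in> fock_relators D l"
| first: "\<lbrakk>i \<in> idx D; 0 < coroot D (simple D i) (lam + rho D);
       coroot D (simple D i) (lam + rho D) < int l\<rbrakk>
      \<Longrightarrow> ket0 (dot D (reflect D (simple D i)) lam) - (- smul (th 1) (ket0 lam)) \<in> fock_relators D l"
| higher: "\<lbrakk>i \<in> idx D; coroot D (simple D i) (lam + rho D) = int k * int l + int j;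
       0 < k; 0 < j; j < l; lam1 = lam - zmul (int j) (simple D i)\<rbrakk>
      \<Longrightarrow> ket0 (dot D (reflect D (simple D i)) lam)
          - (- smul (th 1) (ket0 (dot D (reflect D (simple D i)) lam1))
             - ket0 lam1 - smul (th 1) (ket0 lam)) \<in> fock_relators D l"

definition fock_eq ::
  "'a::ab_group_add root_datum \<Rightarrow> nat \<Rightarrow> (('a \<Rightarrow>\<^sub>0 laurent) \<times> ('a \<Rightarrow>\<^sub>0 laurent)) set" where
  "fock_eq D l = {(x, y). x - y \<in> K.span (fock_relators D l)}"

lemma equiv_fock_eq: "equiv UNIV (fock_eq D l)"
proof (rule equivI)
  show "refl (fock_eq D l)"
    by (simp add: refl_on_def fock_eq_def K.span_zero)
  show "sym (fock_eq D l)"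
    unfolding sym_def fock_eq_def using K.span_neg by fastforce
  show "trans (fock_eq D l)"
    unfolding trans_def fock_eq_def using K.span_add by fastforce
qed auto

text \<open>
  The Fock space is a quotient module, and its elements are the cosets. The operations below
  are lifted from the free module in the manner of \<^theory>\<open>HOL.Equiv_Relations\<close>.
\<close>

definition fock_space :: "'a::ab_group_add root_datum \<Rightarrow> nat \<Rightarrow> ('a \<Rightarrow>\<^sub>0 laurent) set set" where
  "fock_space D l = UNIV // fock_eq D l"

definition fock_class ::
  "'a::ab_group_add root_datum \<Rightarrow> nat \<Rightarrow> ('a \<Rightarrow>\<^sub>0 laurent) \<Rightarrow> ('a \<Rightarrow>\<^sub>0 laurent) set" where
  "fock_class D l x = fock_eq D l `` {x}"

definition wall_count :: "'a::ab_group_add root_datum \<Rightarrow> nat \<Rightarrow> 'a \<Rightarrow> nat" where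
  "wall_count D l lam = card {\<alpha> \<in> pos_roots D. int l dvd coroot D \<alpha> (lam + rho D)}"

definition bar_ket :: "'a::ab_group_add root_datum \<Rightarrow> nat \<Rightarrow> 'a \<Rightarrow> ('a \<Rightarrow>\<^sub>0 laurent)" where
  "bar_ket D l lam =
     smul ((- 1) ^ weyl_length D (w0 D)
           * th (- (int (weyl_length D (w0 D)) - int (wall_count D l lam))))
       (ket0 (dot D (w0 D) lam))"

definition bar0 ::
  "'a::ab_group_add root_datum \<Rightarrow> nat \<Rightarrow> ('a \<Rightarrow>\<^sub>0 laurent) \<Rightarrow> ('a \<Rightarrow>\<^sub>0 laurent)" where
  "bar0 D l x =
     (\<Sum>lam\<in>Poly_Mapping.keys x. smul (laurent_bar (Poly_Mapping.lookup x lam)) (bar_ket D l lam))"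

definition fock_bar ::
  "'a::ab_group_add root_datum \<Rightarrow> nat \<Rightarrow> ('a \<Rightarrow>\<^sub>0 laurent) set \<Rightarrow> ('a \<Rightarrow>\<^sub>0 laurent) set" where
  "fock_bar D l A = (\<Union>x\<in>A. fock_class D l (bar0 D l x))"

text \<open>
  The bilinear operation \<open>act0\<close> makes sense for every element of the group algebra, but only
  the invariant ones, such as Weyl characters, act on the quotient.
\<close>

definition act0 ::
  "'a::ab_group_add root_datum \<Rightarrow> nat \<Rightarrow> ('a \<Rightarrow>\<^sub>0 laurent) \<Rightarrow> ('a \<Rightarrow>\<^sub>0 laurent) \<Rightarrow> ('a \<Rightarrow>\<^sub>0 laurent)"
  where
  "act0 D l f x =
     (\<Sum>\<gamma>\<in>Poly_Mapping.keys x. \<Sum>\<mu>\<in>Poly_Mapping.keys f.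
        smul (Poly_Mapping.lookup x \<gamma> * Poly_Mapping.lookup f \<mu>)
          (ket0 (zmul (int l) (dual_weight D \<mu>) + \<gamma>)))"

definition fock_act ::
  "'a::ab_group_add root_datum \<Rightarrow> nat \<Rightarrow> ('a \<Rightarrow>\<^sub>0 laurent) \<Rightarrow> ('a \<Rightarrow>\<^sub>0 laurent) set
     \<Rightarrow> ('a \<Rightarrow>\<^sub>0 laurent) set" where
  "fock_act D l f A = (\<Union>x\<in>A. fock_class D l (act0 D l f x))"

text \<open>In the following definition \<open>p\<close> is the formal sum of the $p_{\mu\lambda} |\mu\rangle$.\<close>

definition is_canonical ::
  "'a::ab_group_add root_datum \<Rightarrow> nat \<Rightarrow> 'a \<Rightarrow> ('a \<Rightarrow>\<^sub>0 laurent) set \<Rightarrow> bool" where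
  "is_canonical D l lam c \<longleftrightarrow>
     c \<in> fock_space D l \<and> fock_bar D l c = c \<and>
     (\<exists>p. Poly_Mapping.keys p \<subseteq> dominant D - {lam} \<and>
          (\<forall>\<mu>. Poly_Mapping.lookup p \<mu> \<in> th_positive) \<and>
          c = fock_class D l (ket0 lam + p))"

definition canonical :: "'a::ab_group_add root_datum \<Rightarrow> nat \<Rightarrow> 'a \<Rightarrow> ('a \<Rightarrow>\<^sub>0 laurent) set" where
  "canonical D l lam = (THE c. is_canonical D l lam c)"

end

theory Submission
  imports Defs
begin

text \<open>
  Modulo $t^{1/2}$ the straightening relations say that $|\ell(s_i\circ\mu) + \lambda_0\rangle =
  -|\ell\mu + \lambda_0\rangle$ for restricted $\lambda_0$. Hence, by the Weyl character formula,
  $s_{\lambda_1^*}\cdot|\lambda_0\rangle \equiv |\lambda\rangle$, and the same holds for $C_{\lambda_0}$ in place of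
  $|\lambda_0\rangle$ because the action preserves the $\mathbb{Z}[t^{1/2}]$-lattice spanned by the kets. The action
  also commutes with the bar involution, so that $s_{\lambda_1^*}\cdot C_{\lambda_0}$ has the two properties
  that determine $C_\lambda$.

  That these properties determine an element rests on the linear independence of the kets of dominant
  weights in the Fock space. On the free module on all kets the finite Hecke algebra acts by
  Demazure--Lusztig operators $T_i$, the relators are essentially in the images of the $T_i + t^{1/2}$, and the
  sign projector kills these images while it is unitriangular on the dominant kets. To see that
  the product of the $T_i$ along a word depends only on the Weyl group element, one lifts the kets to a regular
  module, on which the $T_i$ commute with right operators attached to the affine simple roots.
  Straightening a ket only produces kets of smaller norm, for a Weyl group invariant form; this
  gives the triangularity of the bar involution and all inductions.
\<close>


text \<open>Independence of T_w of the chosen word would normally come from braid relations.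
  Commuting left and right actions replace them, but the right generators must include affine
  reflections in the upper walls of the alcove: only then does every weight come from a regular
  module, because its affine orbit meets the closed fundamental alcove. The roots of these upper
  walls are quasi-minuscule; there may be several, since the root system may be reducible. All
  arguments stay over the integers: neither 2 nor the order of W is invertible. Terms are therefore
  grouped in pairs, and a factor 2 or |W| is cancelled only where torsion is known to be absent. The
  invariant form is the sum of the squares of all coroots. It vanishes on characters orthogonal to
  the coroots, so it is only semidefinite, but norms still drop strictly inside root strings, and
  this is all that the inductions require.\<close>

locale brd =
  fixes D :: "'a::ab_group_add root_datum"
  assumes brd: "based_root_datum D"
begin

abbreviation R where "R \<equiv> roots D"
abbreviation Rp where "Rp \<equiv> pos_roots D"
abbreviation W where "W \<equiv> weyl_group D"
abbreviation al where "al \<equiv> simple D"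
abbreviation ip where "ip \<equiv> coroot D"
abbreviation rf where "rf \<equiv> reflect D"
definition I where "I = idx D"

section \<open>Elementary consequences of the axioms of a root datum\<close>

lemma rrd: "reduced_root_datum D" and base: "root_base D"
  using brd by (auto simp: based_root_datum_def)

lemma finite_R: "finite R" and inj_coroot: "inj_on ip R"
  and coroot_add: "\<alpha> \<in> R \<Longrightarrow> ip \<alpha> (x + y) = ip \<alpha> x + ip \<alpha> y"
  and coroot_self: "\<alpha> \<in> R \<Longrightarrow> ip \<alpha> \<alpha> = 2"
  and reflect_root: "\<alpha> \<in> R \<Longrightarrow> \<beta> \<in> R \<Longrightarrow> rf \<alpha> \<beta> \<in> R"
  and coroot_reflected: "\<alpha> \<in> R \<Longrightarrow> \<beta> \<in> R \<Longrightarrow> (\<lambda>x. ip \<beta> x - ip \<beta> \<alpha> * ip \<alpha> x) \<in> ip ` R"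
  and reduced: "\<alpha> \<in> R \<Longrightarrow> zmul k \<alpha> \<in> R \<Longrightarrow> k = 1 \<or> k = - 1"
  using rrd unfolding reduced_root_datum_def by blast+

lemma simple_root: "i \<in> I \<Longrightarrow> al i \<in> R"
  and inj_simple: "inj_on al I"
  and pos_or_neg: "\<beta> \<in> R \<Longrightarrow> \<beta> \<in> Rp \<or> - \<beta> \<in> Rp"
  and simple_indep: "Z.independent (al ` I)"
  using base unfolding root_base_def I_def by auto

lemma finite_I: "finite I" by (simp add: I_def)

lemma weyl_group_I: "W = {word_prod D is | is. set is \<subseteq> I}"
  by (simp add: weyl_group_def I_def)

lemma pos_root: "\<beta> \<in> Rp \<Longrightarrow> \<beta> \<in> R"
  by (simp add: pos_roots_def)

text \<open>Coordinates in a lattice basis are integers and scale with the vector.\<close>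

lemma torsion_free:
  assumes "zmul k (x::'a) = 0" shows "k = 0 \<or> x = 0"
proof -
  obtain B :: "'a set" where B: "lattice_basis B"
    using rrd unfolding reduced_root_datum_def by blast
  then have ind: "Z.independent B" and sp: "Z.span B = UNIV" by (auto simp: lattice_basis_def)
  have "Z.representation B (zmul k x) = (\<lambda>b. k * Z.representation B x b)"
    using Z.representation_scale[OF ind, of x k] sp by simp
  then have "k * Z.representation B x b = 0" for b
    using assms Z.representation_zero by (metis (no_types))
  then have "k = 0 \<or> (\<forall>b. Z.representation B x b = 0)" by auto
  moreover have "(\<Sum>b | Z.representation B x b \<noteq> 0. zmul (Z.representation B x b) b) = x"
    by (rule Z.sum_nonzero_representation_eq[OF ind]) (simp add: sp)
  ultimately show ?thesis by auto
qed

lemma zmul_cancel: "k \<noteq> 0 \<Longrightarrow> zmul k (x::'a) = zmul k y \<Longrightarrow> x = y"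
  using torsion_free[of k "x - y"] by (simp add: Z.scale_right_diff_distrib)

lemma coroot_0: "\<alpha> \<in> R \<Longrightarrow> ip \<alpha> 0 = 0"
  using coroot_add[of \<alpha> 0 0] by simp

lemma coroot_neg: "\<alpha> \<in> R \<Longrightarrow> ip \<alpha> (- x) = - ip \<alpha> x"
  using coroot_add[of \<alpha> x "- x"] coroot_0 by simp

lemma coroot_diff: "\<alpha> \<in> R \<Longrightarrow> ip \<alpha> (x - y) = ip \<alpha> x - ip \<alpha> y"
  using coroot_add[of \<alpha> x "- y"] by (simp add: coroot_neg)

lemma coroot_sum: "\<alpha> \<in> R \<Longrightarrow> ip \<alpha> (\<Sum>x\<in>A. f x) = (\<Sum>x\<in>A. ip \<alpha> (f x))"
  by (induction A rule: infinite_finite_induct) (auto simp: coroot_0 coroot_add)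

lemma coroot_zmul: "\<alpha> \<in> R \<Longrightarrow> ip \<alpha> (zmul k x) = k * ip \<alpha> x"
  by (induction k rule: int_induct[where k = 0])
    (auto simp: zmul_0_left zmul_Suc_left zmul_diff_1_left coroot_0 coroot_add coroot_diff algebra_simps)

lemmas coroot_lin = coroot_0 coroot_neg coroot_diff coroot_add coroot_zmul coroot_self

lemma reflect_add: "\<alpha> \<in> R \<Longrightarrow> rf \<alpha> (x + y) = rf \<alpha> x + rf \<alpha> y"
  by (simp add: reflect_def coroot_add zmul_add_left algebra_simps)

lemma reflect_zmul: "\<alpha> \<in> R \<Longrightarrow> rf \<alpha> (zmul k x) = zmul k (rf \<alpha> x)"
  by (simp add: reflect_def coroot_zmul Z.scale_right_diff_distrib zmul_mult)

lemma reflect_neg: "\<alpha> \<in> R \<Longrightarrow> rf \<alpha> (- x) = - rf \<alpha> x"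
  by (simp add: reflect_def coroot_neg)

lemma reflect_diff: "\<alpha> \<in> R \<Longrightarrow> rf \<alpha> (x - y) = rf \<alpha> x - rf \<alpha> y"
  using reflect_add[of \<alpha> x "- y"] by (simp add: reflect_neg)

lemma zmul_two: "zmul 2 x = x + x"
  using zmul_add_left[of 1 1 x] by (simp add: zmul_1_left)

lemma reflect_self: "\<alpha> \<in> R \<Longrightarrow> rf \<alpha> \<alpha> = - \<alpha>"
  by (simp add: reflect_def coroot_self zmul_two)

lemma neg_root: "\<alpha> \<in> R \<Longrightarrow> - \<alpha> \<in> R"
  using reflect_root[of \<alpha> \<alpha>] by (simp add: reflect_self)

lemma coroot_reflect_self: "\<alpha> \<in> R \<Longrightarrow> ip \<alpha> (rf \<alpha> x) = - ip \<alpha> x"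
  by (simp add: reflect_def coroot_lin)

lemma reflect_reflect: "\<alpha> \<in> R \<Longrightarrow> rf \<alpha> (rf \<alpha> x) = x"
  by (simp add: reflect_def[of D \<alpha> "rf \<alpha> x"] coroot_reflect_self) (simp add: reflect_def)

lemma root_nz: "\<alpha> \<in> R \<Longrightarrow> \<alpha> \<noteq> 0"
  using coroot_self coroot_0 by fastforce

text \<open>
  The product of $s_\gamma$ and $x \mapsto x - \langle x, \gamma^\vee\rangle \delta$ is unipotent, and it
  permutes the finite set of roots; so it is trivial.
\<close>

lemma reflect_unique:
  assumes g: "\<gamma> \<in> R" and gd: "ip \<gamma> \<delta> = 2"
    and t: "\<And>x. x \<in> R \<Longrightarrow> x - zmul (ip \<gamma> x) \<delta> \<in> R"
  shows "\<delta> = \<gamma>"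
proof (rule ccontr)
  assume ne: "\<delta> \<noteq> \<gamma>"
  have 0: "ip \<gamma> (\<delta> - \<gamma>) = 0" using g gd by (simp add: coroot_lin)
  \<comment> \<open>The product of the two maps is the transvection along \<delta> - \<gamma>; its
    iterates move \<gamma> along an infinite progression.\<close>
  have step: "x + zmul (ip \<gamma> x) (\<delta> - \<gamma>) \<in> R" if "x \<in> R" for x
  proof -
    have "rf \<gamma> x - zmul (ip \<gamma> (rf \<gamma> x)) \<delta> \<in> R" using t reflect_root g that by blast
    then show ?thesis using g
      by (simp add: coroot_reflect_self) (simp add: reflect_def Z.scale_right_diff_distrib algebra_simps)
  qed
  have mem: "\<gamma> + zmul (2 * int n) (\<delta> - \<gamma>) \<in> R" for n
  proof (induction n)
    case 0 then show ?case using g by (simp add: zmul_0_left)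
  next
    case (Suc n)
    have "ip \<gamma> (\<gamma> + zmul (2 * int n) (\<delta> - \<gamma>)) = 2" using g 0 by (simp add: coroot_lin)
    with step[OF Suc] have "\<gamma> + zmul (2 * int n) (\<delta> - \<gamma>) + zmul 2 (\<delta> - \<gamma>) \<in> R" by simp
    moreover have "zmul (2 * int (Suc n)) (\<delta> - \<gamma>) = zmul (2 * int n) (\<delta> - \<gamma>) + zmul 2 (\<delta> - \<gamma>)"
      using zmul_add_left[of "2 * int n" 2 "\<delta> - \<gamma>"] by (simp add: algebra_simps)
    ultimately show ?case by (simp add: add.assoc)
  qed
  have "inj (\<lambda>n. \<gamma> + zmul (2 * int n) (\<delta> - \<gamma>))"
  proof (rule injI)
    fix m n assume "\<gamma> + zmul (2 * int m) (\<delta> - \<gamma>) = \<gamma> + zmul (2 * int n) (\<delta> - \<gamma>)"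
    then have "zmul (2 * int m - 2 * int n) (\<delta> - \<gamma>) = 0" by (simp add: Z.scale_left_diff_distrib)
    then show "m = n" using torsion_free ne by fastforce
  qed
  then have "infinite (range (\<lambda>n. \<gamma> + zmul (2 * int n) (\<delta> - \<gamma>)))" by (simp add: finite_image_iff)
  moreover have "range (\<lambda>n. \<gamma> + zmul (2 * int n) (\<delta> - \<gamma>)) \<subseteq> R" using mem by auto
  ultimately show False using finite_R finite_subset by blast
qed

text \<open>The axioms only say that the reflected coroot belongs to some root \<gamma>. Conjugating
  s_\<beta> by s_\<alpha> gives a second map on the roots with the same coroot, and
  \<open>reflect_unique\<close> then identifies \<gamma> with s_\<alpha> \<beta>.\<close>

lemma coroot_reflect:
  assumes a: "\<alpha> \<in> R" and b: "\<beta> \<in> R"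
  shows "ip (rf \<alpha> \<beta>) x = ip \<beta> (rf \<alpha> x)"
proof -
  obtain \<gamma> where g: "\<gamma> \<in> R" and gi: "ip \<gamma> = (\<lambda>x. ip \<beta> x - ip \<beta> \<alpha> * ip \<alpha> x)"
    using coroot_reflected[OF a b] by auto
  have gx: "ip \<gamma> x = ip \<beta> (rf \<alpha> x)" for x
    using a b gi by (simp add: reflect_def coroot_lin algebra_simps)
  have "rf \<alpha> \<beta> = \<gamma>"
  proof (rule reflect_unique[OF g])
    show "ip \<gamma> (rf \<alpha> \<beta>) = 2" using a b by (simp add: gx reflect_reflect coroot_self)
    fix x assume x: "x \<in> R"
    have "rf \<alpha> (rf \<beta> (rf \<alpha> x)) = x - zmul (ip \<gamma> x) (rf \<alpha> \<beta>)"
      using a b by (simp add: reflect_def[of D \<beta>] reflect_diff reflect_zmul reflect_reflect gx)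
    then show "x - zmul (ip \<gamma> x) (rf \<alpha> \<beta>) \<in> R" using a b x reflect_root by metis
  qed
  then show ?thesis using gx by simp
qed

lemma coroot_neg_root: "\<alpha> \<in> R \<Longrightarrow> ip (- \<alpha>) x = - ip \<alpha> x"
  using coroot_reflect[of \<alpha> \<alpha> x] by (simp add: reflect_self coroot_reflect_self)

lemma reflect_neg_root: "\<alpha> \<in> R \<Longrightarrow> rf (- \<alpha>) = rf \<alpha>"
  by (rule ext) (simp add: reflect_def coroot_neg_root)

subsection \<open>The Weyl group\<close>

lemma word_prod_Nil: "word_prod D [] = id"
  and word_prod_Cons: "word_prod D (i # is) = rf (al i) \<circ> word_prod D is"
  by (simp_all add: word_prod_def)

lemma word_prod_append: "word_prod D (is @ js) = word_prod D is \<circ> word_prod D js"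
  by (induction "is") (auto simp: word_prod_Nil word_prod_Cons o_assoc)

lemma W_id: "id \<in> W"
  unfolding weyl_group_I using word_prod_Nil by (auto intro!: exI[of _ "[]"])

lemma W_simple: "i \<in> I \<Longrightarrow> rf (al i) \<in> W"
  unfolding weyl_group_I by (auto intro!: exI[of _ "[i]"] simp: word_prod_Nil word_prod_Cons)

lemma W_comp: "v \<in> W \<Longrightarrow> w \<in> W \<Longrightarrow> v \<circ> w \<in> W"
  unfolding weyl_group_I by (auto, rule_tac x = "is @ isa" in exI) (auto simp: word_prod_append)

lemma W_induct [consumes 1, case_names id step]:
  assumes "w \<in> W" "P id" "\<And>i w. i \<in> I \<Longrightarrow> w \<in> W \<Longrightarrow> P w \<Longrightarrow> P (rf (al i) \<circ> w)"
  shows "P w"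
proof -
  obtain js where j: "set js \<subseteq> I" "w = word_prod D js" using assms(1) by (auto simp: weyl_group_I)
  have "word_prod D js \<in> W \<and> P (word_prod D js)" using j(1)
  proof (induction js)
    case Nil then show ?case using assms(2) W_id unfolding word_prod_Nil by blast
  next
    case (Cons i js)
    then have "i \<in> I" "word_prod D js \<in> W" "P (word_prod D js)" by auto
    then show ?case unfolding word_prod_Cons using assms(3) W_comp W_simple by blast
  qed
  then show ?thesis using j by simp
qed

lemma W_add: "w \<in> W \<Longrightarrow> w (x + y) = w x + w y"
  by (induction rule: W_induct) (auto simp: reflect_add simple_root)

lemma W_0: "w \<in> W \<Longrightarrow> w 0 = 0" using W_add[of w 0 0] by simp

lemma W_neg: "w \<in> W \<Longrightarrow> w (- x) = - w x"
  using W_add[of w x "- x"] W_0[of w] by (simp add: eq_neg_iff_add_eq_0 add.commute)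

lemma W_diff: "w \<in> W \<Longrightarrow> w (x - y) = w x - w y"
  using W_add[of w x "- y"] W_neg by simp

lemma W_zmul: "w \<in> W \<Longrightarrow> w (zmul k x) = zmul k (w x)"
  by (induction rule: W_induct) (auto simp: reflect_zmul simple_root)

lemma W_sum: "w \<in> W \<Longrightarrow> w (\<Sum>x\<in>A. f x) = (\<Sum>x\<in>A. w (f x))"
  by (induction A rule: infinite_finite_induct) (auto simp: W_0 W_add)

lemma W_root: "w \<in> W \<Longrightarrow> \<alpha> \<in> R \<Longrightarrow> w \<alpha> \<in> R"
  by (induction rule: W_induct) (auto simp: reflect_root simple_root)

lemma W_inverse: "w \<in> W \<Longrightarrow> \<exists>v\<in>W. v \<circ> w = id \<and> w \<circ> v = id"
proof (induction rule: W_induct)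
  case id show ?case by (rule bexI[OF _ W_id]) simp
next
  case (step i w)
  then obtain v where v: "v \<in> W" "v \<circ> w = id" "w \<circ> v = id" by blast
  have "\<And>x. v (w x) = x" "\<And>x. w (v x) = x" using v by (auto simp: fun_eq_iff)
  then have "(v \<circ> rf (al i)) \<circ> (rf (al i) \<circ> w) = id" "(rf (al i) \<circ> w) \<circ> (v \<circ> rf (al i)) = id"
    using step(1) by (auto simp: fun_eq_iff reflect_reflect simple_root)
  then show ?case using v(1) step(1) W_comp W_simple by blast
qed

lemma W_bij: "w \<in> W \<Longrightarrow> bij w"
  using W_inverse by (metis o_bij)

lemma W_inv: "w \<in> W \<Longrightarrow> inv w \<in> W"
  using W_inverse by (metis inv_unique_comp)

lemma W_inv_left: "w \<in> W \<Longrightarrow> inv w (w x) = x"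
  by (simp add: W_bij bij_is_inj)

lemma W_inv_right: "w \<in> W \<Longrightarrow> w (inv w x) = x"
  by (simp add: W_bij bij_is_surj surj_f_inv_f)

lemma W_eq_iff: "w \<in> W \<Longrightarrow> w x = w y \<longleftrightarrow> x = y"
  using W_inv_left by metis

lemma inv_comp_W: "v \<in> W \<Longrightarrow> w \<in> W \<Longrightarrow> inv (v \<circ> w) = inv w \<circ> inv v"
  by (simp add: W_bij o_inv_distrib)

lemma inv_reflect: "\<alpha> \<in> R \<Longrightarrow> inv (rf \<alpha>) = rf \<alpha>"
  by (rule inv_unique_comp) (auto simp: fun_eq_iff reflect_reflect)

lemma coroot_W: "w \<in> W \<Longrightarrow> \<beta> \<in> R \<Longrightarrow> ip (w \<beta>) (w x) = ip \<beta> x"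
  by (induction arbitrary: x rule: W_induct)
    (auto simp: coroot_reflect simple_root W_root reflect_reflect)

lemma coroot_W_inv: "w \<in> W \<Longrightarrow> \<beta> \<in> R \<Longrightarrow> ip \<beta> (w x) = ip (inv w \<beta>) x"
  using coroot_W[of w "inv w \<beta>" x] by (simp add: W_inv_right W_inv W_root)

lemma reflect_W: "w \<in> W \<Longrightarrow> \<beta> \<in> R \<Longrightarrow> w (rf \<beta> x) = rf (w \<beta>) (w x)"
  by (simp add: reflect_def W_diff W_zmul coroot_W)

subsection \<open>The invariant form\<close>

text \<open>Summing over all coroots makes invariance immediate, without choosing root lengths on
  the irreducible components. The radical consists of the characters orthogonal to every
  coroot.\<close>

definition B :: "'a \<Rightarrow> 'a \<Rightarrow> int" where "B x y = (\<Sum>\<alpha>\<in>R. ip \<alpha> x * ip \<alpha> y)"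

lemma B_add_left: "B (x + y) z = B x z + B y z" and B_neg_left: "B (- x) z = - B x z"
  and B_zmul_left: "B (zmul k x) z = k * B x z" and B_0_left: "B 0 z = 0"
  by (simp_all add: B_def coroot_lin algebra_simps sum.distrib sum_negf sum_distrib_left)

lemma B_diff_left: "B (x - y) z = B x z - B y z"
  using B_add_left[of x "- y" z] by (simp add: B_neg_left)

lemma B_sym: "B x y = B y x" by (simp add: B_def mult.commute)

lemma B_diff_right: "B z (x - y) = B z x - B z y" and B_zmul_right: "B z (zmul k x) = k * B z x"
  and B_add_right: "B z (x + y) = B z x + B z y"
  by (metis B_sym B_diff_left, metis B_sym B_zmul_left, metis B_sym B_add_left)

lemma B_neg_right: "B z (- x) = - B z x" by (metis B_sym B_neg_left)

lemma B_sum_right: "B z (\<Sum>x\<in>A. f x) = (\<Sum>x\<in>A. B z (f x))"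
  by (induction A rule: infinite_finite_induct) (auto simp: B_add_right B_0_left B_sym[of z 0])

lemma B_nonneg: "B x x \<ge> 0" by (simp add: B_def sum_nonneg)

lemma reflect_image_R: "\<alpha> \<in> R \<Longrightarrow> rf \<alpha> ` R = R"
  using reflect_root reflect_reflect by (auto simp: image_iff) (metis)

lemma reflect_inj: "\<alpha> \<in> R \<Longrightarrow> inj_on (rf \<alpha>) A"
  by (metis inj_onI reflect_reflect)

lemma B_reflect: assumes "\<beta> \<in> R" shows "B (rf \<beta> x) (rf \<beta> y) = B x y"
proof -
  have "B x y = (\<Sum>\<alpha>\<in>rf \<beta> ` R. ip \<alpha> x * ip \<alpha> y)" using assms by (simp add: B_def reflect_image_R)
  also have "\<dots> = (\<Sum>\<alpha>\<in>R. ip (rf \<beta> \<alpha>) x * ip (rf \<beta> \<alpha>) y)"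
    using assms by (simp add: sum.reindex reflect_inj)
  also have "\<dots> = B (rf \<beta> x) (rf \<beta> y)" using assms by (simp add: B_def coroot_reflect)
  finally show ?thesis by simp
qed

lemma B_W: "w \<in> W \<Longrightarrow> B (w x) (w y) = B x y"
  by (induction rule: W_induct) (auto simp: B_reflect simple_root)

text \<open>Invariance under s_\<beta> is compared with s_\<beta> \<beta> = - \<beta>. So each
  coroot is a positive multiple of the form against its root, also when the form is
  degenerate.\<close>

lemma B_root: assumes "\<beta> \<in> R" shows "2 * B x \<beta> = ip \<beta> x * B \<beta> \<beta>"
proof -
  have "B (rf \<beta> x) (rf \<beta> \<beta>) = B x \<beta>" using assms by (rule B_reflect)
  moreover have "B (rf \<beta> x) (- \<beta>) = - B x \<beta> + ip \<beta> x * B \<beta> \<beta>"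
    by (simp add: B_neg_right reflect_def B_diff_left B_zmul_left)
  ultimately show ?thesis using assms by (simp add: reflect_self)
qed

lemma B_root_pos: assumes "\<beta> \<in> R" shows "B \<beta> \<beta> > 0"
proof -
  have "0 < ip \<beta> \<beta> * ip \<beta> \<beta>" using assms by (simp add: coroot_self)
  also have "\<dots> \<le> B \<beta> \<beta>" unfolding B_def by (rule member_le_sum) (use assms finite_R in auto)
  finally show ?thesis .
qed

text \<open>The coroot is not additive in the root, but the form is. Signs of pairings are moved to
  the form in order to pass from simple roots to positive roots.\<close>

lemma B_sgn: "\<beta> \<in> R \<Longrightarrow> 0 \<le> B x \<beta> \<longleftrightarrow> 0 \<le> ip \<beta> x" "\<beta> \<in> R \<Longrightarrow> 0 < B x \<beta> \<longleftrightarrow> 0 < ip \<beta> x"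
  using B_root[of \<beta> x] B_root_pos[of \<beta>]
  by (smt (verit) zero_le_mult_iff, smt (verit) zero_less_mult_iff)

definition Q :: "'a \<Rightarrow> nat" where "Q x = nat (B x x)"

lemma Q_W: "w \<in> W \<Longrightarrow> Q (w x) = Q x" by (simp add: Q_def B_W)

lemma Q_reflect: "\<alpha> \<in> R \<Longrightarrow> Q (rf \<alpha> x) = Q x" by (simp add: Q_def B_reflect)

text \<open>The norm drops by k (<x, \<beta>^v> - k) times the norm of \<beta>: points strictly
  between x and its reflection are shorter.\<close>

lemma Q_string:
  assumes b: "\<beta> \<in> R" and k: "0 < k \<and> k < ip \<beta> x \<or> ip \<beta> x < k \<and> k < 0"
  shows "Q (x - zmul k \<beta>) < Q x"
proof -
  have "B (x - zmul k \<beta>) (x - zmul k \<beta>) = B x x - k * (2 * B x \<beta>) + k * k * B \<beta> \<beta>"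
    by (simp add: B_diff_left B_diff_right B_zmul_left B_zmul_right B_sym[of \<beta> x] algebra_simps)
  also have "\<dots> = B x x - (k * (ip \<beta> x - k)) * B \<beta> \<beta>" using b by (simp add: B_root algebra_simps)
  finally have e: "B (x - zmul k \<beta>) (x - zmul k \<beta>) = B x x - (k * (ip \<beta> x - k)) * B \<beta> \<beta>" .
  have "k * (ip \<beta> x - k) > 0" using k by (auto simp: zero_less_mult_iff)
  then have "k * (ip \<beta> x - k) * B \<beta> \<beta> > 0" using B_root_pos[OF b] by simp
  then show ?thesis using e B_nonneg[of "x - zmul k \<beta>"] by (simp add: Q_def)
qed

end

context brd
begin

subsection \<open>Positive roots and lengths\<close>

lemma simple_combo_zero:
  assumes "(\<Sum>i\<in>I. zmul (c i) (al i)) = 0" "i \<in> I" shows "c i = 0"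
proof -
  let ?u = "\<lambda>v. c (inv_into I al v)"
  have "(\<Sum>v\<in>al ` I. zmul (?u v) v) = (\<Sum>i\<in>I. zmul (c i) (al i))"
    by (simp add: sum.reindex inj_simple cong: sum.cong)
  then have "?u (al i) = 0"
    using Z.independentD[OF simple_indep, of "al ` I" ?u "al i"] assms finite_I by simp
  then show ?thesis using inj_simple assms(2) by simp
qed

definition nonneg_comb :: "'a \<Rightarrow> bool" where
  "nonneg_comb x \<longleftrightarrow> (\<exists>c :: nat \<Rightarrow> nat. x = (\<Sum>i\<in>I. zmul (int (c i)) (al i)))"

lemma nonneg_comb_0: "nonneg_comb 0" unfolding nonneg_comb_def by (rule exI[of _ "\<lambda>_. 0"]) simp

lemma nonneg_comb_add: "nonneg_comb x \<Longrightarrow> nonneg_comb y \<Longrightarrow> nonneg_comb (x + y)"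
  unfolding nonneg_comb_def by (auto, rule_tac x = "\<lambda>i. c i + ca i" in exI) (simp add: zmul_add_left sum.distrib)

lemma nonneg_comb_zmul: "nonneg_comb x \<Longrightarrow> nonneg_comb (zmul (int k) x)"
  unfolding nonneg_comb_def
  by (auto, rule_tac x = "\<lambda>i. k * c i" in exI) (simp add: Z.scale_sum_right zmul_mult)

lemma nonneg_comb_sum: "(\<And>i. i \<in> A \<Longrightarrow> nonneg_comb (f i)) \<Longrightarrow> nonneg_comb (\<Sum>i\<in>A. f i)"
  by (induction A rule: infinite_finite_induct) (auto simp: nonneg_comb_0 nonneg_comb_add)

lemma nonneg_comb_antisym: assumes "nonneg_comb x" "nonneg_comb (- x)" shows "x = 0"
proof -
  obtain c d :: "nat \<Rightarrow> nat" where c: "x = (\<Sum>i\<in>I. zmul (int (c i)) (al i))"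
    and d: "- x = (\<Sum>i\<in>I. zmul (int (d i)) (al i))" using assms by (auto simp: nonneg_comb_def)
  have "(\<Sum>i\<in>I. zmul (int (c i) + int (d i)) (al i)) = x + - x"
    unfolding d by (simp add: zmul_add_left sum.distrib c)
  then have "int (c i) + int (d i) = 0" if "i \<in> I" for i
    using simple_combo_zero[of "\<lambda>i. int (c i) + int (d i)"] that by simp
  then have "c i = 0" if "i \<in> I" for i using that by fastforce
  then show ?thesis using c by (simp add: zmul_0_left)
qed

lemma pos_iff: "\<beta> \<in> Rp \<longleftrightarrow> \<beta> \<in> R \<and> nonneg_comb \<beta>"
  by (auto simp: pos_roots_def nonneg_comb_def I_def)

lemma finite_Rp: "finite Rp" using finite_R by (auto simp: pos_roots_def)

lemma pos_not_neg: "\<beta> \<in> Rp \<Longrightarrow> - \<beta> \<notin> Rp"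
  using nonneg_comb_antisym root_nz by (auto simp: pos_iff)

lemma neg_iff: "\<beta> \<in> R \<Longrightarrow> - \<beta> \<in> Rp \<longleftrightarrow> \<beta> \<notin> Rp"
  using pos_not_neg pos_or_neg by blast

lemma simple_pos: "i \<in> I \<Longrightarrow> al i \<in> Rp"
  unfolding pos_iff nonneg_comb_def
  by (auto simp: simple_root intro!: exI[of _ "\<lambda>j. if j = i then 1 else 0"]
      simp: if_distrib[of int] if_distrib[of "\<lambda>k. zmul k _"] zmul_0_left zmul_1_left finite_I cong: if_cong)

text \<open>Because the root system is reduced, \<beta> involves another simple root besides
  \<alpha>_i, and s_i does not change its positive coefficient; so the reflected root cannot be
  negative.\<close>

lemma simple_perm:
  assumes i: "i \<in> I" and b: "\<beta> \<in> Rp" "\<beta> \<noteq> al i" shows "rf (al i) \<beta> \<in> Rp"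
proof -
  obtain c where c: "\<beta> = (\<Sum>j\<in>I. zmul (int (c j)) (al j))" using b by (auto simp: pos_iff nonneg_comb_def)
  have ex: "\<exists>j\<in>I. j \<noteq> i \<and> c j > 0"
  proof (rule ccontr)
    assume "\<not> ?thesis"
    then have "\<beta> = (\<Sum>j\<in>I. if j = i then zmul (int (c i)) (al i) else 0)"
      unfolding c by (intro sum.cong) (auto simp: zmul_0_left)
    then have e: "\<beta> = zmul (int (c i)) (al i)" using i finite_I by simp
    then have "int (c i) = 1 \<or> int (c i) = - 1"
      using reduced[of "al i" "int (c i)"] simple_root[OF i] b pos_root by metis
    then show False using b e pos_not_neg simple_pos i by (auto simp: zmul_1_left)
  qed
  then obtain j where j: "j \<in> I" "j \<noteq> i" "c j > 0" by auto
  show ?thesis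
  proof (rule ccontr)
    assume "rf (al i) \<beta> \<notin> Rp"
    then have "- rf (al i) \<beta> \<in> Rp"
      using pos_or_neg reflect_root simple_root[OF i] b pos_root by blast
    then obtain d where d: "- rf (al i) \<beta> = (\<Sum>j\<in>I. zmul (int (d j)) (al j))"
      by (auto simp: pos_iff nonneg_comb_def)
    let ?m = "ip (al i) \<beta>"
    let ?e = "\<lambda>j. int (c j) + int (d j) - (if j = i then ?m else 0)"
    have "(\<Sum>j\<in>I. zmul (?e j) (al j))
       = (\<Sum>j\<in>I. zmul (int (c j)) (al j) + zmul (int (d j)) (al j) - (if j = i then zmul ?m (al i) else 0))"
      by (intro sum.cong) (auto simp: Z.scale_left_diff_distrib zmul_add_left)
    also have "\<dots> = \<beta> + - rf (al i) \<beta> - zmul ?m (al i)"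
      unfolding d using i finite_I by (simp add: sum.distrib sum_subtractf flip: c)
    also have "\<dots> = 0" by (simp add: reflect_def)
    finally have "?e j = 0" using simple_combo_zero[of ?e j] j by simp
    then show False using j by simp
  qed
qed

text \<open>Reading the word from the right, some letter j first turns the root negative. By
  \<open>simple_perm\<close> the root is then \<alpha>_j itself, so that reflection on the left
  equals s_i on the right, and the letter can be deleted.\<close>

lemma exchange:
  assumes "set js \<subseteq> I" "i \<in> I" "- word_prod D js (al i) \<in> Rp"
  shows "\<exists>ks. set ks \<subseteq> I \<and> Suc (length ks) = length js \<and> word_prod D ks = word_prod D js \<circ> rf (al i)"
  using assms
proof (induction js)
  case Nil then show ?case using simple_pos pos_not_neg by (simp add: word_prod_Nil)
next
  case (Cons j js)
  let ?u = "word_prod D js"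
  have u: "?u \<in> W" using Cons.prems by (auto simp: weyl_group_I)
  have ua: "?u (al i) \<in> R" using u Cons.prems W_root simple_root by blast
  have j: "j \<in> I" using Cons.prems by simp
  show ?case
  proof (cases "- ?u (al i) \<in> Rp")
    case True
    then obtain ks where ks: "set ks \<subseteq> I" "Suc (length ks) = length js" "word_prod D ks = ?u \<circ> rf (al i)"
      using Cons.IH[OF _ Cons.prems(2) True] Cons.prems(1) by fastforce
    have "word_prod D (j # ks) = word_prod D (j # js) \<circ> rf (al i)"
      unfolding word_prod_Cons ks(3) by (simp add: o_assoc)
    moreover have "set (j # ks) \<subseteq> I" "Suc (length (j # ks)) = length (j # js)" using ks j by auto
    ultimately show ?thesis by blast
  next
    case False
    then have p: "?u (al i) \<in> Rp" using ua pos_or_neg by blast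
    have "- rf (al j) (?u (al i)) \<in> Rp" using Cons.prems(3) by (simp add: word_prod_Cons)
    then have "?u (al i) = al j" using simple_perm[OF j p] pos_not_neg by blast
    then have "?u (rf (al i) x) = rf (al j) (?u x)" for x
      using reflect_W[OF u simple_root[OF Cons.prems(2)], of x] by simp
    then have "word_prod D js = word_prod D (j # js) \<circ> rf (al i)"
      using j by (simp add: word_prod_Cons fun_eq_iff reflect_reflect simple_root)
    then show ?thesis using Cons.prems by auto
  qed
qed

definition inv_num :: "('a \<Rightarrow> 'a) \<Rightarrow> nat" where "inv_num w = card {\<beta> \<in> Rp. - w \<beta> \<in> Rp}"

lemma word_ex: assumes "w \<in> W"
  shows "\<exists>js. set js \<subseteq> I \<and> length js = weyl_length D w \<and> w = word_prod D js"
proof -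
  have "\<exists>k js. length js = k \<and> set js \<subseteq> I \<and> w = word_prod D js" using assms by (auto simp: weyl_group_I)
  from LeastI_ex[OF this] show ?thesis unfolding weyl_length_def I_def
    by (elim exE conjE) (intro exI conjI; assumption)
qed

lemma weyl_length_le: "set js \<subseteq> I \<Longrightarrow> weyl_length D (word_prod D js) \<le> length js"
  unfolding weyl_length_def I_def by (rule Least_le) blast

lemma W_word: "set js \<subseteq> I \<Longrightarrow> word_prod D js \<in> W" by (auto simp: weyl_group_I)

text \<open>For the other sign, \<open>exchange\<close> would delete a letter and produce a word
  shorter than the length.\<close>

lemma last_neg:
  assumes js: "set js \<subseteq> I" "i \<in> I" and l: "weyl_length D (word_prod D (js @ [i])) = Suc (length js)"
  shows "- word_prod D (js @ [i]) (al i) \<in> Rp"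
proof (rule ccontr)
  have e: "word_prod D (js @ [i]) = word_prod D js \<circ> rf (al i)"
    by (simp add: word_prod_append word_prod_Cons word_prod_Nil)
  assume n: "\<not> ?thesis"
  have u: "word_prod D js \<in> W" using js W_word by blast
  have "word_prod D (js @ [i]) (al i) = - word_prod D js (al i)"
    using u js by (simp add: e reflect_self simple_root W_neg)
  then have "- word_prod D js (al i) \<in> Rp"
    using n neg_iff W_root[OF u simple_root[OF js(2)]] by auto
  from exchange[OF js this] obtain ks where "set ks \<subseteq> I" "Suc (length ks) = length js"
      "word_prod D ks = word_prod D (js @ [i])" using e by auto
  then show False using weyl_length_le[of ks] l by simp
qed

lemma pos_W_cases: "w \<in> W \<Longrightarrow> \<beta> \<in> R \<Longrightarrow> - w \<beta> \<in> Rp \<longleftrightarrow> w \<beta> \<notin> Rp"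
  using neg_iff W_root by blast

text \<open>Besides \<alpha>_i itself, the inversions of w correspond under s_i to those of w
  s_i.\<close>

lemma inv_num_step:
  assumes w: "w \<in> W" and i: "i \<in> I" and n: "- w (al i) \<in> Rp"
  shows "inv_num w = Suc (inv_num (w \<circ> rf (al i)))"
proof -
  let ?N = "\<lambda>w. {\<beta> \<in> Rp. - w \<beta> \<in> Rp}"
  have "?N (w \<circ> rf (al i)) = rf (al i) ` (?N w - {al i})"
  proof (intro set_eqI iffI)
    fix \<beta> assume "\<beta> \<in> ?N (w \<circ> rf (al i))"
    then have b: "\<beta> \<in> Rp" "- w (rf (al i) \<beta>) \<in> Rp" by auto
    have ne: "\<beta> \<noteq> al i"
    proof
      assume "\<beta> = al i"
      then have "w (al i) \<in> Rp" using b i w by (simp add: reflect_self simple_root W_neg)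
      then show False using n pos_not_neg by blast
    qed
    then have "rf (al i) \<beta> \<in> ?N w - {al i}"
      using simple_perm[OF i b(1)] b i simple_pos pos_not_neg
      by (auto) (metis reflect_reflect reflect_self simple_root)
    then show "\<beta> \<in> rf (al i) ` (?N w - {al i})"
      using reflect_reflect[OF simple_root[OF i]] by (metis imageI)
  next
    fix \<beta> assume "\<beta> \<in> rf (al i) ` (?N w - {al i})"
    then show "\<beta> \<in> ?N (w \<circ> rf (al i))"
      using simple_perm[OF i] i by (auto simp: reflect_reflect simple_root)
  qed
  then have "inv_num (w \<circ> rf (al i)) = card (?N w - {al i})"
    unfolding inv_num_def using i by (simp add: card_image reflect_inj simple_root)
  moreover have "al i \<in> ?N w" using n i simple_pos by simp
  moreover have "finite (?N w)" using finite_Rp by simp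
  ultimately show ?thesis using card_Suc_Diff1[of "?N w" "al i"] by (simp add: inv_num_def)
qed

lemma comp_reflect_twice: "i \<in> I \<Longrightarrow> w \<circ> rf (al i) \<circ> rf (al i) = w"
  by (auto simp: fun_eq_iff reflect_reflect simple_root)

lemma weyl_length_inv_num: "w \<in> W \<Longrightarrow> weyl_length D w = inv_num w"
proof (induction "weyl_length D w" arbitrary: w)
  case 0
  then obtain js where "length js = 0" "w = word_prod D js" using word_ex[OF 0(2)] by auto
  then have w: "w = id" by (simp add: word_prod_Nil)
  have "{\<beta> \<in> Rp. - w \<beta> \<in> Rp} = {}" unfolding w using pos_not_neg by auto
  then have "inv_num w = 0" unfolding inv_num_def by (simp only: card.empty)
  then show ?case using 0 by simp
next
  case (Suc k)
  then obtain ks where ks: "set ks \<subseteq> I" "length ks = Suc k" "w = word_prod D ks" using word_ex[OF Suc.prems] by auto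
  then obtain js i where ji: "ks = js @ [i]" by (metis length_Suc_conv_rev)
  have js: "set js \<subseteq> I" "i \<in> I" "length js = k" using ks ji by auto
  have e: "w = word_prod D js \<circ> rf (al i)" unfolding ks ji
    by (simp add: word_prod_append word_prod_Cons word_prod_Nil)
  have n: "- w (al i) \<in> Rp" using last_neg[OF js(1,2)] ks ji Suc js by metis
  have u: "w \<circ> rf (al i) = word_prod D js" unfolding e using js by (simp add: comp_reflect_twice)
  have "k \<le> weyl_length D (word_prod D js)"
  proof -
    obtain ms where ms: "set ms \<subseteq> I" "length ms = weyl_length D (word_prod D js)"
        "word_prod D js = word_prod D ms" using word_ex[OF W_word[OF js(1)]] by auto
    have wm: "w = word_prod D (ms @ [i])" unfolding e ms(3)
      by (simp add: word_prod_append word_prod_Cons word_prod_Nil)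
    have "set (ms @ [i]) \<subseteq> I" using ms(1) js(2) by simp
    from weyl_length_le[OF this] have "weyl_length D w \<le> length (ms @ [i])" by (simp only: wm)
    then show ?thesis using ms(2) Suc.hyps(2) by simp
  qed
  then have "k = weyl_length D (word_prod D js)" using weyl_length_le js by force
  then have "weyl_length D (word_prod D js) = inv_num (word_prod D js)" using Suc.hyps(1) W_word js by blast
  then show ?case using inv_num_step[OF Suc.prems js(2) n] u \<open>k = _\<close> Suc.hyps(2) by simp
qed

lemma W_pos_id: assumes w: "w \<in> W" and p: "\<And>\<beta>. \<beta> \<in> Rp \<Longrightarrow> w \<beta> \<in> Rp" shows "w = id"
proof -
  have "{\<beta> \<in> Rp. - w \<beta> \<in> Rp} = {}" using p pos_not_neg by blast
  then have "inv_num w = 0" unfolding inv_num_def by (simp only: card.empty)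
  then have "weyl_length D w = 0" using w weyl_length_inv_num by simp
  then obtain js where "length js = 0" "w = word_prod D js" using word_ex[OF w] by auto
  then show ?thesis by (simp add: word_prod_Nil)
qed

text \<open>The roots need not span, yet restriction to them is faithful: an element that fixes all
  roots has no inversions, hence length 0.\<close>

lemma finite_W: "finite W"
proof -
  let ?f = "\<lambda>w. restrict w R"
  have "inj_on ?f W"
  proof (rule inj_onI)
    fix v w assume v: "v \<in> W" and w: "w \<in> W" and e: "?f v = ?f w"
    have "v \<beta> = w \<beta>" if "\<beta> \<in> R" for \<beta> using e that by (metis restrict_apply')
    then have "(inv v \<circ> w) \<beta> = \<beta>" if "\<beta> \<in> R" for \<beta> using that v by (metis W_inv_left comp_apply)
    then have "inv v \<circ> w = id" using W_pos_id W_comp W_inv v w pos_root by metis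
    then have "v (inv v (w x)) = v x" for x by (metis comp_apply id_apply)
    then show "v = w" using v by (auto simp: fun_eq_iff W_inv_right)
  qed
  moreover have "?f ` W \<subseteq> R \<rightarrow>\<^sub>E R" using W_root by auto
  moreover have "finite (R \<rightarrow>\<^sub>E R)" using finite_R by (simp add: finite_PiE)
  ultimately show ?thesis by (metis finite_subset finite_imageD)
qed

text \<open>For an element with the most inversions every simple root must become negative, since
  otherwise multiplication by s_i would add an inversion.\<close>

lemma longest_ex: "\<exists>w\<in>W. \<forall>\<beta>\<in>Rp. - w \<beta> \<in> Rp"
proof -
  have fin: "finite (inv_num ` W)" and ne: "inv_num ` W \<noteq> {}" using finite_W W_id by auto
  obtain w where w: "w \<in> W" "inv_num w = Max (inv_num ` W)" using Max_in[OF fin ne] by auto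
  have mx: "inv_num v \<le> inv_num w" if "v \<in> W" for v using w fin that by simp
  have s: "- w (al i) \<in> Rp" if i: "i \<in> I" for i
  proof (rule ccontr)
    assume "\<not> ?thesis"
    then have p: "w (al i) \<in> Rp" using neg_iff W_root w simple_root i by blast
    let ?v = "w \<circ> rf (al i)"
    have v: "?v \<in> W" using w i W_comp W_simple by blast
    have "- ?v (al i) \<in> Rp" using p i w by (simp add: reflect_self simple_root W_neg)
    from inv_num_step[OF v i this] show False using mx[OF v] i by (simp only: comp_reflect_twice)
  qed
  have "- w \<beta> \<in> Rp" if b: "\<beta> \<in> Rp" for \<beta>
  proof -
    obtain c where c: "\<beta> = (\<Sum>j\<in>I. zmul (int (c j)) (al j))" using b by (auto simp: pos_iff nonneg_comb_def)
    have "- w \<beta> = (\<Sum>j\<in>I. zmul (int (c j)) (- w (al j)))"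
      unfolding c using w by (simp add: W_sum W_zmul sum_negf)
    moreover have "nonneg_comb \<dots>" using s by (intro nonneg_comb_sum nonneg_comb_zmul) (auto simp: pos_iff)
    ultimately have "nonneg_comb (- w \<beta>)" by simp
    then show ?thesis using neg_root W_root w b pos_root unfolding pos_iff by blast
  qed
  then show ?thesis using w by blast
qed

lemma inv_num_max: "inv_num w \<le> card Rp"
  unfolding inv_num_def by (rule card_mono[OF finite_Rp]) auto

lemma inv_num_full: "inv_num w = card Rp \<Longrightarrow> \<beta> \<in> Rp \<Longrightarrow> - w \<beta> \<in> Rp"
  unfolding inv_num_def using card_subset_eq[OF finite_Rp, of "{\<beta> \<in> Rp. - w \<beta> \<in> Rp}"] by auto

lemma longest_unique:
  assumes v: "v \<in> W" "\<And>\<beta>. \<beta> \<in> Rp \<Longrightarrow> - v \<beta> \<in> Rp" and w: "w \<in> W" "\<And>\<beta>. \<beta> \<in> Rp \<Longrightarrow> - w \<beta> \<in> Rp"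
  shows "v = w"
proof -
  have "v (w \<beta>) \<in> Rp" if "\<beta> \<in> Rp" for \<beta> using v(2)[OF w(2)[OF that]] v(1) by (simp add: W_neg)
  then have "v \<circ> w = id" using W_pos_id[of "v \<circ> w"] W_comp v w by simp
  moreover have "w (w \<beta>) \<in> Rp" if "\<beta> \<in> Rp" for \<beta> using w(2)[OF w(2)[OF that]] w(1) by (simp add: W_neg)
  then have "w \<circ> w = id" using W_pos_id[of "w \<circ> w"] W_comp w by simp
  ultimately have "v (w x) = w (w x)" for x by (metis comp_apply)
  then show ?thesis using w(1) by (metis W_inv_right ext)
qed

abbreviation wo where "wo \<equiv> w0 D"

lemma wo_W: "wo \<in> W" and wo_neg: "\<beta> \<in> Rp \<Longrightarrow> - wo \<beta> \<in> Rp"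
  and weyl_length_wo: "weyl_length D wo = card Rp"
proof -
  obtain w where w: "w \<in> W" "\<And>\<beta>. \<beta> \<in> Rp \<Longrightarrow> - w \<beta> \<in> Rp" using longest_ex by blast
  have "{\<beta> \<in> Rp. - w \<beta> \<in> Rp} = Rp" using w by auto
  then have l: "weyl_length D w = card Rp" using w(1) by (simp add: weyl_length_inv_num inv_num_def)
  have "wo = w" unfolding w0_def
  proof (rule the_equality)
    show "w \<in> W \<and> (\<forall>v\<in>W. weyl_length D v \<le> weyl_length D w)"
      unfolding l using w inv_num_max by (simp add: weyl_length_inv_num)
    fix v assume v: "v \<in> W \<and> (\<forall>x\<in>W. weyl_length D x \<le> weyl_length D v)"
    then have "inv_num v = card Rp" using l w inv_num_max weyl_length_inv_num by (metis le_antisym)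
    then show "v = w" using longest_unique v w inv_num_full by blast
  qed
  then show "wo \<in> W" "\<beta> \<in> Rp \<Longrightarrow> - wo \<beta> \<in> Rp" "weyl_length D wo = card Rp" using w l by auto
qed

lemma wo_wo: "wo (wo x) = x"
proof -
  have "wo (wo \<beta>) \<in> Rp" if "\<beta> \<in> Rp" for \<beta>
    using wo_neg[OF wo_neg[OF that]] wo_W by (simp add: W_neg)
  then have "wo \<circ> wo = id" using W_pos_id[of "wo \<circ> wo"] W_comp wo_W by simp
  then show ?thesis by (metis comp_apply id_apply)
qed

text \<open>The conjugate of s_i by the longest element has a single inversion, so it has length 1
  and is some s_j. The positive root that s_j makes negative must be \<alpha>_j.\<close>

lemma wo_simple: assumes i: "i \<in> I" shows "\<exists>j\<in>I. wo (al i) = - al j"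
proof -
  let ?v = "wo \<circ> rf (al i) \<circ> wo"
  have v: "?v \<in> W" using W_comp W_simple wo_W i by blast
  have "{\<beta> \<in> Rp. - ?v \<beta> \<in> Rp} = {- wo (al i)}"
  proof (intro set_eqI iffI)
    fix \<beta> assume "\<beta> \<in> {\<beta> \<in> Rp. - ?v \<beta> \<in> Rp}"
    then have b: "\<beta> \<in> Rp" and nb: "- wo (rf (al i) (wo \<beta>)) \<in> Rp" by auto
    have "- wo \<beta> = al i"
    proof (rule ccontr)
      assume "- wo \<beta> \<noteq> al i"
      then have "rf (al i) (- wo \<beta>) \<in> Rp" using simple_perm i wo_neg b by blast
      from wo_neg[OF this] have "wo (rf (al i) (wo \<beta>)) \<in> Rp"
        using i wo_W by (simp add: reflect_neg simple_root W_neg)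
      then show False using nb pos_not_neg by blast
    qed
    then have "wo (al i) = - wo (wo \<beta>)" using wo_W by (metis W_neg)
    then show "\<beta> \<in> {- wo (al i)}" by (simp add: wo_wo)
  next
    fix \<beta> assume "\<beta> \<in> {- wo (al i)}"
    then show "\<beta> \<in> {\<beta> \<in> Rp. - ?v \<beta> \<in> Rp}" using i wo_W wo_neg simple_pos
      by (auto simp: W_neg wo_wo reflect_neg simple_root reflect_self)
  qed
  then have "weyl_length D ?v = 1" using v by (simp add: weyl_length_inv_num inv_num_def)
  then obtain js where js: "set js \<subseteq> I" "length js = 1" "?v = word_prod D js" using word_ex[OF v] by auto
  then obtain j where "js = [j]" by (auto simp: length_Suc_conv)
  then have j: "j \<in> I" "?v = rf (al j)" using js by (auto simp: word_prod_Cons word_prod_Nil)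
  have "rf (al j) (wo (al i)) = - wo (al i)"
    using i wo_W by (simp flip: j(2) add: wo_wo reflect_self simple_root W_neg)
  then have "rf (al j) (- wo (al i)) \<notin> Rp"
    using j wo_neg[OF simple_pos[OF i]] by (simp add: reflect_neg simple_root pos_not_neg) (metis minus_minus pos_not_neg)
  then have "- wo (al i) = al j" using simple_perm[OF j(1) wo_neg[OF simple_pos[OF i]]] by blast
  then show ?thesis using j by (metis minus_minus)
qed

lemma rho_two: "zmul 2 (rho D) = (\<Sum>\<alpha>\<in>Rp. \<alpha>)"
  using brd by (simp add: based_root_datum_def)

text \<open>s_i permutes the positive roots other than \<alpha>_i, so their sum pairs to 0 with its
  coroot and only \<alpha>_i contributes to 2 \<rho>.\<close>

lemma coroot_rho: assumes i: "i \<in> I" shows "ip (al i) (rho D) = 1"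
proof -
  let ?S = "Rp - {al i}"
  have sp: "(\<Sum>\<alpha>\<in>Rp. f \<alpha>) = f (al i) + (\<Sum>\<alpha>\<in>?S. f \<alpha>)" for f :: "'a \<Rightarrow> 'a"
    using simple_pos[OF i] finite_Rp by (simp add: sum.remove)
  have im: "rf (al i) ` ?S = ?S"
  proof (intro equalityI subsetI)
    fix x assume "x \<in> rf (al i) ` ?S"
    then obtain b where b: "b \<in> Rp" "b \<noteq> al i" "x = rf (al i) b" by auto
    then have "x \<noteq> al i" using i pos_not_neg simple_pos by (metis reflect_reflect reflect_self simple_root)
    then show "x \<in> ?S" using b simple_perm i by auto
  next
    fix x assume x: "x \<in> ?S"
    then have "rf (al i) x \<in> ?S" using simple_perm i pos_not_neg simple_pos
      by auto (metis reflect_reflect reflect_self simple_root)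
    then show "x \<in> rf (al i) ` ?S" using i reflect_reflect simple_root by (metis imageI)
  qed
  have "(\<Sum>\<alpha>\<in>?S. \<alpha>) = (\<Sum>\<alpha>\<in>rf (al i) ` ?S. \<alpha>)" by (simp only: im)
  also have "\<dots> = (\<Sum>\<alpha>\<in>?S. rf (al i) \<alpha>)" using i by (simp add: sum.reindex reflect_inj simple_root)
  also have "\<dots> = rf (al i) (\<Sum>\<alpha>\<in>?S. \<alpha>)" using i by (simp add: W_sum W_simple)
  finally have "ip (al i) (\<Sum>\<alpha>\<in>?S. \<alpha>) = - ip (al i) (\<Sum>\<alpha>\<in>?S. \<alpha>)"
    using i coroot_reflect_self simple_root by metis
  then have "ip (al i) (zmul 2 (rho D)) = 2"
    unfolding rho_two sp using i by (simp add: coroot_add simple_root coroot_self)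
  then show ?thesis using i by (simp add: coroot_zmul simple_root)
qed

lemma wo_image: "wo ` Rp = uminus ` Rp"
proof (intro equalityI subsetI)
  fix x assume "x \<in> wo ` Rp"
  then show "x \<in> uminus ` Rp" using wo_neg by (auto simp: image_iff) (metis minus_minus)
next
  fix x assume "x \<in> uminus ` Rp"
  then obtain b where b: "b \<in> Rp" "x = - b" by auto
  then have "x = wo (- wo b)" using wo_W by (simp add: W_neg wo_wo)
  then show "x \<in> wo ` Rp" using wo_neg b by blast
qed

lemma wo_rho: "wo (rho D) = - rho D"
proof -
  have "zmul 2 (wo (rho D)) = (\<Sum>\<alpha>\<in>Rp. wo \<alpha>)"
    by (simp flip: W_zmul[OF wo_W] add: rho_two W_sum[OF wo_W])
  also have "\<dots> = (\<Sum>\<alpha>\<in>wo ` Rp. \<alpha>)"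
    by (subst sum.reindex) (use wo_W in \<open>auto simp: inj_on_def W_eq_iff\<close>)
  also have "\<dots> = - zmul 2 (rho D)"
    by (simp add: wo_image sum.reindex inj_on_def sum_negf rho_two)
  finally show ?thesis using zmul_cancel[of 2 "wo (rho D)" "- rho D"] by simp
qed

subsection \<open>Dominance\<close>

lemma B_pos_root_expand:
  assumes "\<beta> \<in> Rp"
  obtains c :: "nat \<Rightarrow> nat" and j where "\<And>x. B x \<beta> = (\<Sum>i\<in>I. int (c i) * B x (al i))" "j \<in> I" "c j > 0"
proof -
  obtain c where c: "\<beta> = (\<Sum>j\<in>I. zmul (int (c j)) (al j))" using assms by (auto simp: pos_iff nonneg_comb_def)
  have "\<exists>j\<in>I. c j > 0"
  proof (rule ccontr)
    assume "\<not> ?thesis"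
    then have "\<beta> = 0" using c by (simp add: zmul_0_left)
    then show False using assms pos_root root_nz by blast
  qed
  moreover have "B x \<beta> = (\<Sum>i\<in>I. int (c i) * B x (al i))" for x
    unfolding c by (simp add: B_sum_right B_zmul_right)
  ultimately show ?thesis using that by blast
qed

lemma dom_pos: assumes d: "\<And>i. i \<in> I \<Longrightarrow> ip (al i) x \<ge> 0" and b: "\<beta> \<in> Rp" shows "ip \<beta> x \<ge> 0"
proof -
  obtain c j where e: "\<And>x. B x \<beta> = (\<Sum>i\<in>I. int (c i) * B x (al i))" using B_pos_root_expand[OF b] by metis
  have "B x \<beta> \<ge> 0" unfolding e using d B_sgn(1) simple_root by (intro sum_nonneg mult_nonneg_nonneg) auto
  then show ?thesis using B_sgn(1) pos_root b by blast
qed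

lemma reg_pos: assumes d: "\<And>i. i \<in> I \<Longrightarrow> ip (al i) x > 0" and b: "\<beta> \<in> Rp" shows "ip \<beta> x > 0"
proof -
  obtain c j where e: "\<And>x. B x \<beta> = (\<Sum>i\<in>I. int (c i) * B x (al i))" and j: "j \<in> I" "c j > 0"
    using B_pos_root_expand[OF b] by metis
  have bp: "i \<in> I \<Longrightarrow> B x (al i) > 0" for i using d B_sgn(2) simple_root by blast
  then have "0 < int (c j) * B x (al j)" using j by simp
  also have "\<dots> \<le> B x \<beta>" unfolding e
    by (rule member_le_sum) (use j bp finite_I in \<open>auto intro!: mult_nonneg_nonneg dest: less_imp_le\<close>)
  finally show ?thesis using B_sgn(2) pos_root b by blast
qed

lemma rho_pos: "\<beta> \<in> Rp \<Longrightarrow> ip \<beta> (rho D) > 0"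
  by (rule reg_pos) (simp_all add: coroot_rho)

text \<open>An orbit point that maximizes the form against \<rho> is dominant: a negative pairing
  with a simple coroot could be reflected to give a larger value.\<close>

lemma dominant_conj: "\<exists>w\<in>W. \<forall>i\<in>I. ip (al i) (w x) \<ge> 0"
proof -
  let ?f = "\<lambda>w. B (w x) (rho D)"
  have fin: "finite (?f ` W)" and ne: "?f ` W \<noteq> {}" using finite_W W_id by auto
  obtain w where w: "w \<in> W" "?f w = Max (?f ` W)" using Max_in[OF fin ne] by auto
  have mx: "?f v \<le> ?f w" if "v \<in> W" for v using w fin that by simp
  have "ip (al i) (w x) \<ge> 0" if i: "i \<in> I" for i
  proof (rule ccontr)
    assume n: "\<not> ?thesis"
    have "?f (rf (al i) \<circ> w) = ?f w - ip (al i) (w x) * B (rho D) (al i)"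
      by (simp add: reflect_def B_diff_left B_zmul_left B_sym[of "al i"])
    moreover have "B (rho D) (al i) > 0" using B_sgn(2) i simple_root coroot_rho by auto
    then have "ip (al i) (w x) * B (rho D) (al i) < 0" using n by (simp add: mult_less_0_iff)
    ultimately show False using mx[of "rf (al i) \<circ> w"] w i W_comp W_simple by fastforce
  qed
  then show ?thesis using w by blast
qed

text \<open>Positive coroots are positive on x, so their images are positive on w x; as w x is also
  regular dominant, w cannot make a positive root negative.\<close>

lemma regular_stab:
  assumes w: "w \<in> W" and x: "\<And>i. i \<in> I \<Longrightarrow> ip (al i) x > 0" and y: "\<And>i. i \<in> I \<Longrightarrow> ip (al i) (w x) > 0"
  shows "w = id"
proof (rule W_pos_id[OF w])
  fix \<beta> assume b: "\<beta> \<in> Rp"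
  have "ip (w \<beta>) (w x) > 0" using coroot_W w b pos_root reg_pos[OF x b] by simp
  moreover have "ip (- w \<beta>) (w x) > 0" if "- w \<beta> \<in> Rp" using reg_pos[OF y that] .
  ultimately show "w \<beta> \<in> Rp" using pos_W_cases[OF w] W_root[OF w] pos_root[OF b] coroot_neg_root by fastforce
qed

text \<open>The pairing with twice the half-sum of the positive coroots. It serves as the height for
  leading terms of characters.\<close>

definition ht :: "'a \<Rightarrow> int" where "ht x = (\<Sum>\<alpha>\<in>Rp. ip \<alpha> x)"

lemma ht_diff: "ht (x - y) = ht x - ht y"
  unfolding ht_def by (simp add: coroot_diff pos_root sum_subtractf cong: sum.cong)

text \<open>Roots that stay positive contribute the same amount to both heights; an inversion
  contributes with opposite signs, whence the factor 2.\<close>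

lemma ht_W: assumes w: "w \<in> W"
  shows "ht x - ht (w x) = 2 * (\<Sum>\<alpha> | \<alpha> \<in> Rp \<and> - w \<alpha> \<in> Rp. ip \<alpha> x)"
proof -
  let ?P = "{\<alpha> \<in> Rp. w \<alpha> \<in> Rp}" and ?M = "{\<alpha> \<in> Rp. - w \<alpha> \<in> Rp}"
  have Rp: "Rp = ?P \<union> ?M" "?P \<inter> ?M = {}" "finite ?P" "finite ?M"
    using pos_W_cases[OF w] pos_root finite_Rp by auto
  have "ht x = (\<Sum>\<alpha>\<in>?P \<union> ?M. ip \<alpha> x)" unfolding ht_def using Rp(1) by (rule arg_cong)
  then have 1: "ht x = (\<Sum>\<alpha>\<in>?P. ip \<alpha> x) + (\<Sum>\<alpha>\<in>?M. ip \<alpha> x)" using Rp(2-4) by (simp only: sum.union_disjoint)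
  have R': "Rp = w ` ?P \<union> (\<lambda>\<alpha>. - w \<alpha>) ` ?M"
  proof (intro equalityI subsetI)
    fix \<beta> assume b: "\<beta> \<in> Rp"
    have r: "inv w \<beta> \<in> R" using b pos_root W_root W_inv w by blast
    show "\<beta> \<in> w ` ?P \<union> (\<lambda>\<alpha>. - w \<alpha>) ` ?M"
    proof (cases "inv w \<beta> \<in> Rp")
      case True then show ?thesis using b w by (auto simp: image_iff W_inv_right intro!: exI[of _ "inv w \<beta>"])
    next
      case False
      then have "- inv w \<beta> \<in> Rp" using neg_iff r by blast
      then have "- inv w \<beta> \<in> ?M" "\<beta> = - w (- inv w \<beta>)" using b w by (auto simp: W_inv_right W_neg)
      then show ?thesis by blast
    qed
  qed auto
  have disj: "w ` ?P \<inter> (\<lambda>\<alpha>. - w \<alpha>) ` ?M = {}"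
  proof (rule ccontr)
    assume "\<not> ?thesis"
    then obtain \<alpha> \<beta> where ab: "\<alpha> \<in> Rp" "\<beta> \<in> Rp" "w \<alpha> = - w \<beta>" by auto
    then have "w \<alpha> = w (- \<beta>)" using w by (simp add: W_neg)
    then have "\<alpha> = - \<beta>" using w W_eq_iff by blast
    then show False using ab pos_not_neg by blast
  qed
  have "ht (w x) = (\<Sum>\<alpha>\<in>w ` ?P \<union> (\<lambda>\<alpha>. - w \<alpha>) ` ?M. ip \<alpha> (w x))"
    unfolding ht_def using R' by (rule arg_cong)
  also have "\<dots> = (\<Sum>\<alpha>\<in>w ` ?P. ip \<alpha> (w x)) + (\<Sum>\<alpha>\<in>(\<lambda>\<alpha>. - w \<alpha>) ` ?M. ip \<alpha> (w x))"
    by (rule sum.union_disjoint) (use Rp(3,4) disj in blast)+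
  finally have "ht (w x) = (\<Sum>\<alpha>\<in>w ` ?P. ip \<alpha> (w x)) + (\<Sum>\<alpha>\<in>(\<lambda>\<alpha>. - w \<alpha>) ` ?M. ip \<alpha> (w x))" .
  moreover have "(\<Sum>\<alpha>\<in>w ` ?P. ip \<alpha> (w x)) = (\<Sum>\<alpha>\<in>?P. ip \<alpha> x)"
    by (subst sum.reindex) (use w pos_root in \<open>auto simp: inj_on_def W_eq_iff coroot_W intro!: sum.cong\<close>)
  moreover have "(\<Sum>\<alpha>\<in>(\<lambda>\<alpha>. - w \<alpha>) ` ?M. ip \<alpha> (w x)) = (\<Sum>\<alpha>\<in>?M. - ip \<alpha> x)"
    by (subst sum.reindex)
      (use w pos_root in \<open>auto simp: inj_on_def W_eq_iff coroot_W coroot_neg_root W_root intro!: sum.cong\<close>)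
  ultimately show ?thesis using 1 by (simp add: sum_negf)
qed

lemma ht_W_le: "w \<in> W \<Longrightarrow> (\<And>i. i \<in> I \<Longrightarrow> ip (al i) x \<ge> 0) \<Longrightarrow> ht (w x) \<le> ht x"
  using ht_W[of w x] dom_pos[of x] by (smt (verit, best) mem_Collect_eq sum_nonneg)

text \<open>A nontrivial w inverts some simple root, which is then orthogonal to x; so s_i fixes x
  and can be split off. Together with \<open>ht_W\<close> this gives strictness in
  \<open>ht_W_less\<close>.\<close>

lemma W_fix:
  assumes "w \<in> W" "\<And>\<alpha>. \<alpha> \<in> Rp \<Longrightarrow> - w \<alpha> \<in> Rp \<Longrightarrow> ip \<alpha> x = 0" shows "w x = x"
  using assms
proof (induction "inv_num w" arbitrary: w)
  case 0
  then have "{\<beta> \<in> Rp. - w \<beta> \<in> Rp} = {}" using finite_Rp by (simp add: inv_num_def)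
  then have "w = id" using W_pos_id[OF 0(2)] pos_W_cases[OF 0(2)] pos_root by blast
  then show ?case by simp
next
  case (Suc n)
  have "\<exists>i\<in>I. - w (al i) \<in> Rp"
  proof (rule ccontr)
    assume a: "\<not> ?thesis"
    have "w \<beta> \<in> Rp" if b: "\<beta> \<in> Rp" for \<beta>
    proof -
      obtain c where c: "\<beta> = (\<Sum>j\<in>I. zmul (int (c j)) (al j))" using b by (auto simp: pos_iff nonneg_comb_def)
      have "w (al j) \<in> Rp" if "j \<in> I" for j using a that pos_W_cases Suc.prems simple_root by blast
      then have "nonneg_comb (\<Sum>j\<in>I. zmul (int (c j)) (w (al j)))" by (intro nonneg_comb_sum nonneg_comb_zmul) (auto simp: pos_iff)
      moreover have "w \<beta> = (\<Sum>j\<in>I. zmul (int (c j)) (w (al j)))" unfolding c using Suc.prems by (simp add: W_sum W_zmul)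
      ultimately have "nonneg_comb (w \<beta>)" by simp
      then show ?thesis using W_root[OF Suc.prems(1)] b pos_root unfolding pos_iff by blast
    qed
    then have "{\<beta> \<in> Rp. - w \<beta> \<in> Rp} = {}" using pos_not_neg by blast
    then have "inv_num w = 0" unfolding inv_num_def by (simp only: card.empty)
    then show False using Suc by simp
  qed
  then obtain i where i: "i \<in> I" "- w (al i) \<in> Rp" by blast
  have 0: "ip (al i) x = 0" using Suc.prems i simple_pos by blast
  then have sx: "rf (al i) x = x" by (simp add: reflect_def zmul_0_left)
  have W: "w \<circ> rf (al i) \<in> W" using Suc.prems i W_comp W_simple by blast
  have "(w \<circ> rf (al i)) x = x"
  proof (rule Suc.hyps(1)[OF _ W])
    show "n = inv_num (w \<circ> rf (al i))" using inv_num_step[OF Suc.prems(1) i] Suc by simp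
    fix \<alpha> assume a: "\<alpha> \<in> Rp" "- (w \<circ> rf (al i)) \<alpha> \<in> Rp"
    show "ip \<alpha> x = 0"
    proof (cases "\<alpha> = al i")
      case False
      then have "ip (rf (al i) \<alpha>) x = 0" using a simple_perm i Suc.prems by auto
      then show ?thesis using a i sx by (simp add: coroot_reflect simple_root pos_root)
    qed (simp add: 0)
  qed
  then show ?case using sx by simp
qed

lemma ht_W_less:
  assumes w: "w \<in> W" and d: "\<And>i. i \<in> I \<Longrightarrow> ip (al i) x \<ge> 0" and n: "w x \<noteq> x" shows "ht (w x) < ht x"
proof -
  obtain \<alpha> where a: "\<alpha> \<in> Rp" "- w \<alpha> \<in> Rp" "ip \<alpha> x \<noteq> 0" using W_fix[OF w] n by blast
  then have "0 < ip \<alpha> x" using dom_pos[OF d a(1)] by simp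
  also have "\<dots> \<le> (\<Sum>\<alpha> | \<alpha> \<in> Rp \<and> - w \<alpha> \<in> Rp. ip \<alpha> x)"
    by (rule member_le_sum) (use a finite_Rp dom_pos[OF d] in auto)
  finally show ?thesis using ht_W[OF w, of x] by simp
qed

end

subsection \<open>Determinants of reflections\<close>

text \<open>The matrix is a function on a set rather than an indexed array, because
  \<open>lattice_det\<close> sums over permutations of an unordered basis.\<close>

definition leibniz :: "'b set \<Rightarrow> ('b \<Rightarrow> 'b \<Rightarrow> int) \<Rightarrow> int" where
  "leibniz B c = (\<Sum>p | p permutes B. sign p * (\<Prod>b\<in>B. c b (p b)))"

lemma leibniz_add_row:
  assumes B: "finite B" "b \<in> B"
  shows "leibniz B (c(b := (\<lambda>j. x j + k * y j))) = leibniz B (c(b := x)) + k * leibniz B (c(b := y))"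
proof -
  have s: "(\<Prod>a\<in>B. (c(b := z)) a (p a)) = z (p b) * (\<Prod>a\<in>B - {b}. c a (p a))" for z p
  proof -
    have "(\<Prod>a\<in>B. (c(b := z)) a (p a)) = (c(b := z)) b (p b) * (\<Prod>a\<in>B - {b}. (c(b := z)) a (p a))"
      using B by (rule prod.remove)
    also have "(\<Prod>a\<in>B - {b}. (c(b := z)) a (p a)) = (\<Prod>a\<in>B - {b}. c a (p a))"
      by (rule prod.cong) auto
    finally show ?thesis by simp
  qed
  show ?thesis unfolding leibniz_def s
    by (simp add: sum_distrib_left sum.distrib[symmetric] algebra_simps)
qed

lemma leibniz_sum_row:
  assumes "finite B" "b \<in> B" "finite S"
  shows "leibniz B (c(b := (\<lambda>j. \<Sum>k\<in>S. u k * y k j))) = (\<Sum>k\<in>S. u k * leibniz B (c(b := y k)))"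
  using assms(3)
proof (induction S rule: finite_induct)
  case empty
  have "leibniz B (c(b := \<lambda>j. 0)) = leibniz B (c(b := \<lambda>j. 0)) + 1 * leibniz B (c(b := \<lambda>j. 0))"
    using leibniz_add_row[OF assms(1,2), of c "\<lambda>_. 0" 1 "\<lambda>_. 0"] by simp
  then show ?case by (simp del: fun_upd_apply add: fun_upd_def)
next
  case (insert k S)
  then show ?case
    using leibniz_add_row[OF assms(1,2), of c "\<lambda>j. \<Sum>k\<in>S. u k * y k j" "u k" "y k"]
    by (simp add: add.commute del: fun_upd_apply)
qed

lemma leibniz_equal_rows:
  assumes B: "finite B" "a \<in> B" "b \<in> B" "a \<noteq> b" and e: "c a = c b"
  shows "leibniz B c = 0"
proof -
  let ?t = "Transposition.transpose a b"
  have t: "?t permutes B" using B by (simp add: permutes_swap_id)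
  have ct: "c (?t x) = c x" for x using e by (cases "x = a"; cases "x = b") auto
  have "leibniz B c = (\<Sum>p | p permutes B. sign (p \<circ> ?t) * (\<Prod>x\<in>B. c x ((p \<circ> ?t) x)))"
    unfolding leibniz_def by (rule sum_permutations_compose_right[OF t])
  also have "\<dots> = (\<Sum>p | p permutes B. - (sign p * (\<Prod>x\<in>B. c x (p x))))"
  proof (rule sum.cong[OF refl])
    fix p assume "p \<in> {p. p permutes B}"
    then have p: "permutation p" using B(1) by (auto simp: permutation_permutes)
    have "(\<Prod>x\<in>B. c x (p x)) = (\<Prod>x\<in>B. c (?t x) (p (?t x)))"
      using prod.permute[OF t, of "\<lambda>x. c x (p x)"] by (simp add: o_def)
    then show "sign (p \<circ> ?t) * (\<Prod>x\<in>B. c x ((p \<circ> ?t) x)) = - (sign p * (\<Prod>x\<in>B. c x (p x)))"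
      using p B(4) by (simp add: sign_compose permutation_swap_id sign_swap_id ct)
  qed
  finally show ?thesis by (simp add: leibniz_def sum_negf)
qed

text \<open>The matrix determinant lemma, for a rank one update whose row vector is a combination of
  the rows of the matrix. In this form no inverse matrix occurs.\<close>

lemma leibniz_rank_one:
  fixes c :: "'b \<Rightarrow> 'b \<Rightarrow> int"
  assumes B: "finite B" and r: "r = (\<lambda>j. \<Sum>k\<in>B. u k * c k j)"
  shows "leibniz B (\<lambda>b j. c b j - v b * r j) = leibniz B c * (1 - (\<Sum>b\<in>B. v b * u b))"
proof -
  \<comment> \<open>\<open>M S\<close> interpolates between the two matrices: only the rows in
    \<open>S\<close> have been updated.\<close>
  define M where "M S = (\<lambda>b. if b \<in> S then (\<lambda>j. c b j - v b * r j) else c b)" for S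
  have row: "(M (insert b S)) = (M S)(b := (\<lambda>j. c b j + - v b * r j))" if "b \<notin> S" for b S
    using that by (auto simp: M_def fun_eq_iff)
  have MS: "(M S)(b := c b) = M S" if "b \<notin> S" for b S using that by (auto simp: M_def fun_eq_iff)
  \<comment> \<open>Once row b is r itself, the multiples of r subtracted from the other rows no
    longer matter.\<close>
  have restore: "leibniz B ((M S)(b := r)) = leibniz B (c(b := r))"
    if "finite S" "S \<subseteq> B" "b \<in> B" "b \<notin> S" for S b using that
  proof (induction S rule: finite_induct)
    case empty then show ?case by (simp add: M_def)
  next
    case (insert a S)
    then have ab: "a \<noteq> b" "a \<in> B" by auto
    have "(M (insert a S))(b := r) = ((M S)(b := r))(a := (\<lambda>j. c a j + - v a * r j))"
      using row[OF insert.hyps(2)] ab by (simp add: fun_upd_twist)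
    then have "leibniz B ((M (insert a S))(b := r))
      = leibniz B (((M S)(b := r))(a := c a)) + - v a * leibniz B (((M S)(b := r))(a := r))"
      using leibniz_add_row[OF B ab(2)] by metis
    moreover have "leibniz B (((M S)(b := r))(a := r)) = 0"
      by (rule leibniz_equal_rows[OF B ab(2) insert.prems(2) ab(1)]) (use ab in auto)
    moreover have "((M S)(b := r))(a := c a) = (M S)(b := r)"
      using MS[OF insert.hyps(2)] ab by (metis fun_upd_twist)
    ultimately show ?case using insert by (simp del: fun_upd_apply)
  qed
  have col: "leibniz B (c(b := r)) = u b * leibniz B c" if b: "b \<in> B" for b
  proof -
    have "leibniz B (c(b := r)) = (\<Sum>k\<in>B. u k * leibniz B (c(b := c k)))"
      unfolding r by (rule leibniz_sum_row[OF B b B])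
    also have "\<dots> = (\<Sum>k\<in>B. if k = b then u b * leibniz B c else 0)"
    proof (rule sum.cong[OF refl])
      fix k assume "k \<in> B"
      then show "u k * leibniz B (c(b := c k)) = (if k = b then u b * leibniz B c else 0)"
        using leibniz_equal_rows[OF B b, of k "c(b := c k)"] by auto
    qed
    finally show ?thesis using b B by simp
  qed
  have "leibniz B (M S) = leibniz B c * (1 - (\<Sum>b\<in>S. v b * u b))" if "finite S" "S \<subseteq> B" for S
    using that
  proof (induction S rule: finite_induct)
    case empty then show ?case by (simp add: M_def)
  next
    case (insert b S)
    then have b: "b \<in> B" by simp
    have "leibniz B (M (insert b S)) = leibniz B ((M S)(b := c b)) + - v b * leibniz B ((M S)(b := r))"
      unfolding row[OF insert.hyps(2)] by (rule leibniz_add_row[OF B b])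
    then show ?case using insert b by (simp add: MS restore col algebra_simps del: fun_upd_apply)
  qed
  from this[OF B] have "leibniz B (M B) = leibniz B c * (1 - (\<Sum>b\<in>B. v b * u b))" by simp
  moreover have "leibniz B (M B) = leibniz B (\<lambda>b j. c b j - v b * r j)"
    by (auto simp: leibniz_def M_def intro!: sum.cong prod.cong)
  ultimately show ?thesis by simp
qed

section \<open>Finitely supported functions and integer coefficients\<close>

abbreviation lk where "lk \<equiv> Poly_Mapping.lookup"
abbreviation sg where "sg \<equiv> Poly_Mapping.single"
abbreviation ks where "ks \<equiv> Poly_Mapping.keys"

lemma pm_expand: "(\<Sum>k\<in>Poly_Mapping.keys f. Poly_Mapping.single k (Poly_Mapping.lookup f k)) = f"
  by (rule poly_mapping_eqI) (simp add: lookup_sum lookup_single when_def in_keys_iff finite_keys)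

lemma range_of_int_add: "(c :: 'r::ring_1) \<in> range of_int \<Longrightarrow> d \<in> range of_int \<Longrightarrow> c + d \<in> range of_int"
  by (auto simp flip: of_int_add)

lemma range_of_int_diff: "(c :: 'r::ring_1) \<in> range of_int \<Longrightarrow> d \<in> range of_int \<Longrightarrow> c - d \<in> range of_int"
  by (auto simp flip: of_int_diff)

lemma range_of_int_mult: "(c :: 'r::ring_1) \<in> range of_int \<Longrightarrow> d \<in> range of_int \<Longrightarrow> c * d \<in> range (of_int)"
  by (auto simp flip: of_int_mult)

lemma range_of_int_sum: "(\<And>x. x \<in> A \<Longrightarrow> (f x :: 'r::ring_1) \<in> range of_int) \<Longrightarrow> sum f A \<in> range (of_int)"
proof (induction A rule: infinite_finite_induct)
  case (insert x A) then obtain a b where "f x = of_int a" "sum f A = of_int b" by fastforce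
  then have "sum f (insert x A) = of_int (a + b)" using insert by simp
  then show ?case by blast
qed (auto intro: image_eqI[of _ _ 0])

lemma smul_mult: fixes f g :: "'b::monoid_add \<Rightarrow>\<^sub>0 laurent" shows "smul c f * g = smul c (f * g)"
proof -
  have e: "smul c h = sg 0 c * h" for h :: "'b \<Rightarrow>\<^sub>0 laurent"
  proof -
    have "sg 0 c * h = sg 0 c * (\<Sum>k\<in>ks h. sg k (lk h k))" by (simp add: pm_expand)
    also have "\<dots> = (\<Sum>k\<in>ks h. smul c (sg k (lk h k)))"
      unfolding sum_distrib_left by (intro sum.cong poly_mapping_eqI)
        (auto simp: mult_single lookup_smul lookup_single when_def)
    also have "\<dots> = smul c h" by (simp add: pm_expand flip: K.scale_sum_right)
    finally show ?thesis by simp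
  qed
  show ?thesis unfolding e by (simp only: mult.assoc)
qed

context brd
begin

section \<open>The determinant as sign character of the Weyl group\<close>

definition basis :: "'a set" where "basis = (SOME B. lattice_basis B)"

lemma basis: "finite basis" "Z.independent basis" "Z.span basis = UNIV"
proof -
  have "\<exists>B :: 'a set. lattice_basis B" using rrd by (simp add: reduced_root_datum_def)
  then have "lattice_basis basis" unfolding basis_def by (rule someI_ex)
  then show "finite basis" "Z.independent basis" "Z.span basis = UNIV" by (auto simp: lattice_basis_def)
qed

abbreviation rep where "rep \<equiv> Z.representation basis"

lemma rep_sum: "(\<Sum>b\<in>basis. zmul (rep x b) b) = x"
proof -
  have "(\<Sum>b | rep x b \<noteq> 0. zmul (rep x b) b) = x"
    by (rule Z.sum_nonzero_representation_eq) (use basis in auto)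
  moreover have "(\<Sum>b | rep x b \<noteq> 0. zmul (rep x b) b) = (\<Sum>b\<in>basis. zmul (rep x b) b)"
    by (rule sum.mono_neutral_left) (use basis Z.representation_ne_zero in \<open>auto simp: zmul_0_left\<close>)
  ultimately show ?thesis by simp
qed

lemma lattice_det_leibniz: "lattice_det w = leibniz basis (\<lambda>b. rep (w b))"
  by (simp add: lattice_det_def leibniz_def basis_def Let_def)

lemma lattice_det_id: "lattice_det (id :: 'a \<Rightarrow> 'a) = 1"
proof -
  have "(\<Prod>b\<in>basis. rep (id b) (p b)) = (if p = id then 1 else 0)" if p: "p permutes basis" for p
  proof (cases "p = id")
    case True then show ?thesis using basis by (auto simp: Z.representation_basis intro!: prod.neutral)
  next
    case False
    then obtain b where b: "p b \<noteq> b" by (auto simp: fun_eq_iff)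
    then have bb: "b \<in> basis" using p permutes_not_in by metis
    then have "rep (id b) (p b) = 0" using b basis by (simp add: Z.representation_basis)
    then show ?thesis using False bb basis(1) by (auto simp: prod_zero_iff)
  qed
  then have "lattice_det (id :: 'a \<Rightarrow> 'a) = (\<Sum>p | p permutes basis. if p = id then 1 else 0)"
    unfolding lattice_det_leibniz leibniz_def by (intro sum.cong) (auto simp: sign_id)
  then show ?thesis using basis(1) by (simp add: finite_permutations permutes_id)
qed

text \<open>A reflection is a rank one update of the identity, so the determinant is multiplied by 1
  - <\<alpha>, \<alpha>^v> = - 1.\<close>

lemma lattice_det_reflect:
  assumes w: "w \<in> W" and a: "\<alpha> \<in> R" shows "lattice_det (w \<circ> rf \<alpha>) = - lattice_det w"
proof -
  have 1: "rep (w (rf \<alpha> b)) = (\<lambda>j. rep (w b) j - ip \<alpha> b * rep (w \<alpha>) j)" for b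
    using w basis by (simp add: reflect_def W_diff W_zmul Z.representation_diff Z.representation_scale)
  have 2: "rep (w \<alpha>) = (\<lambda>j. \<Sum>k\<in>basis. rep \<alpha> k * rep (w k) j)"
  proof -
    have "rep (w \<alpha>) = rep (\<Sum>k\<in>basis. zmul (rep \<alpha> k) (w k))"
      by (subst rep_sum[of \<alpha>, symmetric]) (use w in \<open>simp only: W_sum W_zmul\<close>)
    also have "\<dots> = (\<lambda>j. \<Sum>k\<in>basis. rep \<alpha> k * rep (w k) j)"
      using basis by (simp add: Z.representation_sum Z.representation_scale)
    finally show ?thesis .
  qed
  have "ip \<alpha> \<alpha> = ip \<alpha> (\<Sum>k\<in>basis. zmul (rep \<alpha> k) k)" by (simp add: rep_sum)
  then have "(\<Sum>k\<in>basis. ip \<alpha> k * rep \<alpha> k) = 2"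
    using a by (simp add: coroot_sum coroot_zmul coroot_self mult.commute)
  then show ?thesis
    unfolding lattice_det_leibniz comp_def 1 using leibniz_rank_one[OF basis(1) 2, of "ip \<alpha>"] by simp
qed

abbreviation eps :: "('a \<Rightarrow> 'a) \<Rightarrow> int" where "eps \<equiv> lattice_det"

lemma eps_word: "set js \<subseteq> I \<Longrightarrow> eps (word_prod D js) = (- 1) ^ length js"
proof (induction js rule: rev_induct)
  case Nil then show ?case by (simp only: word_prod_Nil lattice_det_id) simp
next
  case (snoc i js)
  have "word_prod D (js @ [i]) = word_prod D js \<circ> rf (al i)"
    by (simp add: word_prod_append word_prod_Cons word_prod_Nil)
  moreover have "eps (word_prod D js \<circ> rf (al i)) = - eps (word_prod D js)"
    using snoc.prems by (intro lattice_det_reflect W_word simple_root) auto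
  ultimately show ?case using snoc by (simp del: comp_apply)
qed

lemma eps_simple: assumes "w \<in> W" "i \<in> I" shows "eps (rf (al i) \<circ> w) = - eps w"
proof -
  obtain js where js: "set js \<subseteq> I" "w = word_prod D js" using assms by (auto simp: weyl_group_I)
  then have "rf (al i) \<circ> w = word_prod D (i # js)" by (simp add: word_prod_Cons)
  then show ?thesis using eps_word[of "i # js"] eps_word[of js] js assms(2) by simp
qed

lemma eps_comp: assumes "v \<in> W" "w \<in> W" shows "eps (v \<circ> w) = eps v * eps w"
  using assms(1)
proof (induction rule: W_induct)
  case id show ?case by (simp only: lattice_det_id id_o mult_1_left)
next
  case (step i u)
  have "eps (rf (al i) \<circ> u \<circ> w) = - eps (u \<circ> w)"
    using eps_simple[OF W_comp[OF step(2) assms(2)] step(1)] by (simp add: o_assoc)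
  then show ?case using step(3) eps_simple[OF step(2,1)] by (simp del: comp_apply)
qed

lemma eps_sq: assumes "w \<in> W" shows "eps w * eps w = 1"
proof -
  obtain js where js: "set js \<subseteq> I" "w = word_prod D js" using assms by (auto simp: weyl_group_I)
  then show ?thesis by (simp add: eps_word flip: power_add)
qed

subsection \<open>Weyl characters\<close>

lemma dot_comp: "dot D (v \<circ> w) x = dot D v (dot D w x)" by (simp add: dot_def)

lemma dot_id: "dot D id x = x" by (simp add: dot_def)

lemma dot_inj: "w \<in> W \<Longrightarrow> dot D w x = dot D w y \<longleftrightarrow> x = y"
  by (simp add: dot_def W_eq_iff)

lemma dot_add: "w \<in> W \<Longrightarrow> dot D w (x + y) = dot D w x + w y"
  by (simp add: dot_def W_add algebra_simps)

lemma dominant_iff: "x \<in> dominant D \<longleftrightarrow> (\<forall>i\<in>I. ip (al i) (x + rho D) > 0)"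
  by (simp add: dominant_def I_def)

lemma dominant_iff': "x \<in> dominant D \<longleftrightarrow> (\<forall>i\<in>I. ip (al i) x \<ge> 0)"
  unfolding dominant_iff by (auto simp: coroot_add simple_root coroot_rho)

text \<open>Coefficients are also required to be integer constants: they are then fixed by the bar
  involution and preserve the lattice over the polynomials in t^(1/2). Weyl characters have this
  property.\<close>

definition invariant :: "('a \<Rightarrow>\<^sub>0 laurent) \<Rightarrow> bool" where
  "invariant f \<longleftrightarrow> (\<forall>w\<in>W. \<forall>x. lk f (w x) = lk f x) \<and> (\<forall>x. lk f x \<in> range of_int)"

text \<open>Antisymmetry refers to the dot action, because the alternating sums of the Weyl formula
  are written with the shift by \<rho>.\<close>

definition alternating :: "('a \<Rightarrow>\<^sub>0 laurent) \<Rightarrow> bool" where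
  "alternating f \<longleftrightarrow> (\<forall>w\<in>W. \<forall>x. lk f (dot D w x) = of_int (eps w) * lk f x) \<and> (\<forall>x. lk f x \<in> range of_int)"

abbreviation wa where "wa \<equiv> weyl_alternating D"

lemma invariant_add: "invariant f \<Longrightarrow> invariant g \<Longrightarrow> invariant (f + g)"
  by (simp add: invariant_def lookup_add range_of_int_add)

lemma invariant_smul: "c \<in> range of_int \<Longrightarrow> invariant f \<Longrightarrow> invariant (smul c f)"
  by (simp add: invariant_def lookup_smul range_of_int_mult)

lemma invariant_0: "invariant 0" by (auto simp: invariant_def intro: image_eqI[of _ _ 0])

lemma invariant_sum: "(\<And>x. x \<in> A \<Longrightarrow> invariant (f x)) \<Longrightarrow> invariant (sum f A)"
  by (induction A rule: infinite_finite_induct) (auto simp: invariant_0 invariant_add)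

lemma mult_wa0: "f * wa 0 = (\<Sum>w\<in>W. \<Sum>k\<in>ks f. sg (k + dot D w 0) (lk f k * of_int (eps w)))"
proof -
  have "f * wa 0 = (\<Sum>k\<in>ks f. sg k (lk f k)) * wa 0" by (simp add: pm_expand)
  also have "\<dots> = (\<Sum>w\<in>W. \<Sum>k\<in>ks f. sg (k + dot D w 0) (lk f k * of_int (eps w)))"
    by (simp add: weyl_alternating_def sum_product mult_single) (rule sum.swap)
  finally show ?thesis .
qed

lemma lk_mult_wa0: "lk (f * wa 0) x = (\<Sum>w\<in>W. of_int (eps w) * lk f (x - dot D w 0))"
proof -
  have "(\<Sum>k\<in>ks f. lk (sg (k + dot D w 0) (lk f k * of_int (eps w))) x) = of_int (eps w) * lk f (x - dot D w 0)" for w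
  proof -
    have "(\<Sum>k\<in>ks f. lk (sg (k + dot D w 0) (lk f k * of_int (eps w))) x)
      = (\<Sum>k\<in>ks f. if k = x - dot D w 0 then lk f k * of_int (eps w) else 0)"
      by (intro sum.cong) (auto simp: lookup_single when_def)
    then show ?thesis by (simp add: finite_keys in_keys_iff mult.commute)
  qed
  then show ?thesis unfolding mult_wa0 lookup_sum by simp
qed

lemma lk_wa: "lk (wa y) x = (\<Sum>w\<in>W. if dot D w y = x then of_int (eps w) else 0)"
  by (simp add: weyl_alternating_def lookup_sum lookup_single when_def)

lemma sum_W_left: assumes "v \<in> W" shows "(\<Sum>w\<in>W. f (v \<circ> w)) = (\<Sum>w\<in>W. f w)"
proof (rule sum.reindex_bij_witness[of _ "\<lambda>w. inv v \<circ> w" "\<lambda>w. v \<circ> w"])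
  fix w assume w: "w \<in> W"
  show "inv v \<circ> (v \<circ> w) = w" "v \<circ> (inv v \<circ> w) = w"
    using assms by (auto simp: fun_eq_iff W_inv_left W_inv_right)
  show "v \<circ> w \<in> W" "inv v \<circ> w \<in> W" using assms w W_comp W_inv by blast+
qed simp

lemma alternating_mult: assumes f: "invariant f" shows "alternating (f * wa 0)"
  unfolding alternating_def
proof (intro conjI ballI allI)
  fix v x assume v: "v \<in> W"
  have "lk (f * wa 0) (dot D v x) = (\<Sum>w\<in>W. of_int (eps (v \<circ> w)) * lk f (dot D v x - dot D (v \<circ> w) 0))"
    unfolding lk_mult_wa0
    using sum_W_left[OF v, of "\<lambda>w. of_int (eps w) * lk f (dot D v x - dot D w 0)"] by simp
  also have "\<dots> = (\<Sum>w\<in>W. of_int (eps v) * (of_int (eps w) * lk f (x - dot D w 0)))"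
  proof (rule sum.cong[OF refl])
    fix w assume w: "w \<in> W"
    have "dot D v x - dot D (v \<circ> w) 0 = v (x - dot D w 0)"
      using v by (simp add: dot_def W_diff W_add algebra_simps)
    moreover have "lk f (v (x - dot D w 0)) = lk f (x - dot D w 0)" using f v by (simp add: invariant_def)
    ultimately show "of_int (eps (v \<circ> w)) * lk f (dot D v x - dot D (v \<circ> w) 0)
        = of_int (eps v) * (of_int (eps w) * lk f (x - dot D w 0))"
      using v w by (simp add: eps_comp mult.assoc)
  qed
  finally show "lk (f * wa 0) (dot D v x) = of_int (eps v) * lk (f * wa 0) x"
    by (simp add: lk_mult_wa0 sum_distrib_left)
next
  fix x show "lk (f * wa 0) x \<in> range of_int" unfolding lk_mult_wa0
    using f by (intro range_of_int_sum range_of_int_mult) (auto simp: invariant_def)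
qed

lemma alternating_wa: "alternating (wa y)"
  unfolding alternating_def
proof (intro conjI ballI allI)
  fix v x assume v: "v \<in> W"
  have "lk (wa y) (dot D v x) = (\<Sum>w\<in>W. if dot D (v \<circ> w) y = dot D v x then of_int (eps (v \<circ> w)) else 0)"
    unfolding lk_wa
    by (rule sum_W_left[OF v, symmetric])
  also have "\<dots> = of_int (eps v) * lk (wa y) x"
    unfolding lk_wa sum_distrib_left using v
    by (intro sum.cong) (auto simp: dot_comp dot_inj eps_comp simp flip: of_int_mult)
  finally show "lk (wa y) (dot D v x) = of_int (eps v) * lk (wa y) x" .
next
  fix x show "lk (wa y) x \<in> range of_int" unfolding lk_wa
    by (intro range_of_int_sum) (auto intro: image_eqI[of _ _ 0])
qed

lemma alternating_diff: "alternating f \<Longrightarrow> alternating g \<Longrightarrow> alternating (f - g)"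
  by (simp add: alternating_def lookup_minus range_of_int_diff right_diff_distrib)

lemma alternating_smul: "c \<in> range of_int \<Longrightarrow> alternating f \<Longrightarrow> alternating (smul c f)"
  by (simp add: alternating_def lookup_smul range_of_int_mult mult.left_commute)

lemma alternating_0: "alternating 0" by (auto simp: alternating_def intro: image_eqI[of _ _ 0])

lemma alternating_sum: "(\<And>x. x \<in> A \<Longrightarrow> alternating (f x)) \<Longrightarrow> alternating (sum f A)"
proof (induction A rule: infinite_finite_induct)
  case (insert x A)
  have "sum f (insert x A) = f x - (0 - sum f A)" using insert by simp
  then show ?case using insert alternating_diff alternating_0 by (metis insert_iff)
qed (auto simp: alternating_0)

lemma laurent_double: "(c :: laurent) = - c \<Longrightarrow> c = 0"
proof (rule poly_mapping_eqI)
  fix k assume "c = - c"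
  then have "lk c k = - lk c k" by (metis lookup_uminus)
  then show "lk c k = lk 0 k" by simp
qed

text \<open>Each dot orbit meets the closed chamber. On a wall the coefficient equals its own
  negative; elsewhere the representative is dominant.\<close>

lemma alternating_zero:
  assumes f: "alternating f" and d: "\<And>x. x \<in> dominant D \<Longrightarrow> lk f x = 0" shows "f = 0"
proof (rule poly_mapping_eqI)
  fix x
  obtain w where w: "w \<in> W" "\<And>i. i \<in> I \<Longrightarrow> ip (al i) (w (x + rho D)) \<ge> 0" using dominant_conj by blast
  let ?y = "dot D w x"
  have y: "?y + rho D = w (x + rho D)" by (simp add: dot_def)
  have "lk f ?y = 0"
  proof (cases "?y \<in> dominant D")
    case False
    then obtain i where i: "i \<in> I" "ip (al i) (w (x + rho D)) = 0"
      using w(2) unfolding dominant_iff y by force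
    then have "dot D (rf (al i)) ?y = ?y" by (simp add: dot_def reflect_def zmul_0_left)
    then have "lk f ?y = of_int (eps (rf (al i))) * lk f ?y"
      using f W_simple[OF i(1)] by (metis alternating_def)
    moreover have "eps (rf (al i)) = - 1"
      using lattice_det_reflect[OF W_id simple_root[OF i(1)]] lattice_det_id by (simp only: id_o)
    ultimately show ?thesis using laurent_double by simp
  qed (simp add: d)
  moreover have "lk f ?y = of_int (eps w) * lk f x" using f w by (simp add: alternating_def)
  ultimately have "of_int (eps w) * (of_int (eps w) * lk f x) = 0" by simp
  then have "of_int (eps w * eps w) * lk f x = 0" by (simp only: of_int_mult mult.assoc)
  then show "lk f x = lk 0 x" using eps_sq[OF w(1)] by simp
qed

lemma lk_wa_dominant: assumes x: "x \<in> dominant D" and y: "y \<in> dominant D"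
  shows "lk (wa y) x = (if x = y then 1 else 0)"
proof -
  have "dot D w y = x \<longleftrightarrow> w = id \<and> x = y" if w: "w \<in> W" for w
  proof
    assume e: "dot D w y = x"
    then have "w (y + rho D) = x + rho D" by (auto simp: dot_def)
    then have "w = id" using regular_stab[OF w, of "y + rho D"] x y by (simp add: dominant_iff)
    then show "w = id \<and> x = y" using e dot_id by simp
  next
    assume "w = id \<and> x = y" then show "dot D w y = x" using dot_id by simp
  qed
  then have "lk (wa y) x = (\<Sum>w\<in>W. if w = id \<and> x = y then of_int (eps w) else 0)"
    unfolding lk_wa by (intro sum.cong) auto
  also have "\<dots> = (if x = y then of_int (eps id) else 0)"
    using finite_W W_id by (cases "x = y") (simp_all add: sum.delta)
  finally show ?thesis by (simp only: lattice_det_id of_int_1)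
qed

lemma alternating_expand:
  assumes f: "alternating f" shows "f = (\<Sum>x\<in>ks f \<inter> dominant D. smul (lk f x) (wa x))"
proof -
  let ?S = "\<Sum>x\<in>ks f \<inter> dominant D. smul (lk f x) (wa x)"
  have r: "lk f x \<in> range of_int" for x using f by (simp add: alternating_def)
  have "f - ?S = 0"
  proof (rule alternating_zero)
    show "alternating (f - ?S)" using f r by (intro alternating_diff alternating_sum alternating_smul alternating_wa)
    fix y assume y: "y \<in> dominant D"
    have "lk ?S y = (\<Sum>x\<in>ks f \<inter> dominant D. if x = y then lk f y else 0)"
      unfolding lookup_sum lookup_smul using y by (intro sum.cong) (auto simp: lk_wa_dominant)
    also have "\<dots> = lk f y" using y by (simp add: finite_keys in_keys_iff)
    finally show "lk (f - ?S) y = 0" by (simp add: lookup_minus)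
  qed
  then show ?thesis by simp
qed

lemma ht_dot_0: assumes "w \<in> W" shows "ht (dot D w 0) \<le> 0" "w \<noteq> id \<Longrightarrow> ht (dot D w 0) < 0"
proof -
  have r: "ip (al i) (rho D) > 0" if "i \<in> I" for i using that by (simp add: coroot_rho)
  then show "ht (dot D w 0) \<le> 0"
    using ht_W_le[OF assms, of "rho D"] by (force simp: dot_def ht_diff)
  assume "w \<noteq> id"
  then have "w (rho D) \<noteq> rho D" using regular_stab[OF assms, of "rho D"] r by auto
  then show "ht (dot D w 0) < 0"
    using ht_W_less[OF assms, of "rho D"] r by (force simp: dot_def ht_diff)
qed

text \<open>At a point of maximal height in the support of f, only the term w = \<open>id\<close> of
  the denominator contributes, so that coefficient survives in the product.\<close>

lemma mult_wa0_cancel: assumes "f * wa 0 = 0" shows "f = 0"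
proof (rule ccontr)
  assume "f \<noteq> 0"
  then have ne: "ht ` ks f \<noteq> {}" and fin: "finite (ht ` ks f)" by (auto simp: finite_keys)
  obtain x where x: "x \<in> ks f" "ht x = Max (ht ` ks f)" using Max_in[OF fin ne] by (metis imageE)
  have mx: "ht y \<le> ht x" if "y \<in> ks f" for y using that fin x(2) by simp
  have "lk (f * wa 0) x = (\<Sum>w\<in>W. if w = id then lk f x else 0)"
    unfolding lk_mult_wa0
  proof (rule sum.cong[OF refl])
    fix w assume w: "w \<in> W"
    show "of_int (eps w) * lk f (x - dot D w 0) = (if w = id then lk f x else 0)"
    proof (cases "w = id")
      case True then show ?thesis using lattice_det_id dot_id by (simp del: id_apply)
    next
      case False
      then have "ht (x - dot D w 0) > ht x" using ht_dot_0 w by (simp add: ht_diff)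
      then have "x - dot D w 0 \<notin> ks f" using mx by force
      then show ?thesis using False by (simp add: in_keys_iff)
    qed
  qed
  also have "\<dots> = lk f x" using finite_W W_id by (simp add: sum.delta)
  finally show False using assms x(1) by (simp add: in_keys_iff)
qed

definition orbit_sum :: "'a \<Rightarrow> ('a \<Rightarrow>\<^sub>0 laurent)" where
  "orbit_sum y = (\<Sum>x\<in>(\<lambda>w. w y) ` W. sg x 1)"

lemma lk_orbit_sum: "lk (orbit_sum y) x = (if \<exists>w\<in>W. x = w y then 1 else 0)"
  unfolding orbit_sum_def lookup_sum using finite_W by (auto simp: lookup_single when_def)

lemma invariant_orbit_sum: "invariant (orbit_sum y)"
  unfolding invariant_def
proof (intro conjI ballI allI)
  fix w x assume w: "w \<in> W"
  have "(\<exists>v\<in>W. w x = v y) \<longleftrightarrow> (\<exists>v\<in>W. x = v y)"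
  proof
    assume "\<exists>v\<in>W. w x = v y"
    then obtain v where v: "v \<in> W" "w x = v y" by blast
    then have "x = (inv w \<circ> v) y" using W_inv_left[OF w] by (metis comp_apply)
    then show "\<exists>v\<in>W. x = v y" using W_comp W_inv w v by blast
  next
    assume "\<exists>v\<in>W. x = v y"
    then obtain v where v: "v \<in> W" "x = v y" by blast
    then have "w x = (w \<circ> v) y" by simp
    then show "\<exists>v\<in>W. w x = v y" using W_comp w v by blast
  qed
  then show "lk (orbit_sum y) (w x) = lk (orbit_sum y) x" by (simp add: lk_orbit_sum)
qed (auto simp: lk_orbit_sum intro: image_eqI[of _ _ 0] image_eqI[of _ _ 1])

text \<open>The orbit of y reaches its maximal height only at y, and the denominator only at 0. Thus
  the product has the single top term y.\<close>

lemma lk_orbit_mult: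
  assumes y: "y \<in> dominant D" and h: "ht x \<ge> ht y"
  shows "lk (orbit_sum y * wa 0) x = (if x = y then 1 else 0)"
proof -
  have yd: "ip (al i) y \<ge> 0" if "i \<in> I" for i using y that by (simp add: dominant_iff')
  have "lk (orbit_sum y * wa 0) x = (\<Sum>w\<in>W. if w = id then (if x = y then 1 else 0) else 0)"
    unfolding lk_mult_wa0
  proof (rule sum.cong[OF refl])
    fix w assume w: "w \<in> W"
    show "of_int (eps w) * lk (orbit_sum y) (x - dot D w 0) = (if w = id then (if x = y then 1 else 0) else 0)"
    proof (cases "w = id")
      case True
      have "(\<exists>v\<in>W. x = v y) \<longleftrightarrow> x = y"
      proof
        assume "\<exists>v\<in>W. x = v y"
        then obtain v where v: "v \<in> W" "x = v y" by blast
        then show "x = y" using ht_W_less[OF v(1) yd] h by force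
      next
        assume "x = y" then show "\<exists>v\<in>W. x = v y" by (intro bexI[OF _ W_id]) simp
      qed
      then show ?thesis unfolding True dot_id lattice_det_id lk_orbit_sum by simp
    next
      case False
      have "\<not> (\<exists>v\<in>W. x - dot D w 0 = v y)"
      proof
        assume "\<exists>v\<in>W. x - dot D w 0 = v y"
        then obtain v where v: "v \<in> W" "x - dot D w 0 = v y" by blast
        then have "ht x - ht (dot D w 0) \<le> ht y" using ht_W_le[OF v(1) yd] by (metis ht_diff)
        then show False using ht_dot_0(2)[OF w False] h by simp
      qed
      then show ?thesis using False by (simp add: lk_orbit_sum)
    qed
  qed
  also have "\<dots> = (if x = y then 1 else 0)" using finite_W W_id by (simp add: sum.delta)
  finally show ?thesis .
qed

text \<open>Divisibility by the denominator is obtained by descent: subtracting an orbit sum times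
  the denominator leaves an alternating element whose dominant exponents are lower, and these
  quotients exist by induction.\<close>

lemma weyl_char_exists: "y \<in> dominant D \<Longrightarrow> \<exists>f. invariant f \<and> f * wa 0 = wa y"
proof (induction "nat (ht y)" arbitrary: y rule: less_induct)
  case less
  let ?g = "wa y - orbit_sum y * wa 0"
  have alt: "alternating ?g" by (intro alternating_diff alternating_wa alternating_mult invariant_orbit_sum)
  have "\<exists>f. invariant f \<and> f * wa 0 = wa x" if x: "x \<in> ks ?g \<inter> dominant D" for x
  proof -
    have "ht x < ht y"
    proof (rule ccontr)
      assume "\<not> ht x < ht y"
      then have "lk ?g x = 0" using x less.prems by (simp add: lookup_minus lk_wa_dominant lk_orbit_mult)
      then show False using x by (simp add: in_keys_iff)
    qed
    moreover have "ht x \<ge> 0" using x dom_pos[of x] unfolding ht_def by (auto simp: dominant_iff' intro!: sum_nonneg)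
    ultimately show ?thesis using less.hyps[of x] x by simp
  qed
  then obtain F where F: "\<And>x. x \<in> ks ?g \<inter> dominant D \<Longrightarrow> invariant (F x) \<and> F x * wa 0 = wa x" by metis
  let ?f = "orbit_sum y + (\<Sum>x\<in>ks ?g \<inter> dominant D. smul (lk ?g x) (F x))"
  have "invariant ?f" using F alt
    by (intro invariant_add invariant_orbit_sum invariant_sum invariant_smul) (auto simp: alternating_def)
  moreover have "?f * wa 0 = orbit_sum y * wa 0 + (\<Sum>x\<in>ks ?g \<inter> dominant D. smul (lk ?g x) (wa x))"
    by (simp only: distrib_right sum_distrib_right smul_mult) (use F in \<open>auto intro!: sum.cong\<close>)
  then have "?f * wa 0 = orbit_sum y * wa 0 + ?g" using alternating_expand[OF alt] by simp
  then have "?f * wa 0 = wa y" by simp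
  ultimately show ?case by blast
qed

lemma weyl_char:
  assumes "y \<in> dominant D"
  shows "invariant (weyl_char D y)" and "weyl_char D y * wa 0 = wa y"
proof -
  obtain f where f: "invariant f" "f * wa 0 = wa y" using weyl_char_exists[OF assms] by blast
  have "g = f" if "g * wa 0 = wa y" for g
    using mult_wa0_cancel[of "g - f"] that f by (simp add: left_diff_distrib)
  then have "weyl_char D y = f" unfolding weyl_char_def using f by (intro the_equality)
  then show "invariant (weyl_char D y)" "weyl_char D y * wa 0 = wa y" using f by auto
qed

end

subsection \<open>Linear extensions\<close>

definition lin :: "('b \<Rightarrow> ('c \<Rightarrow>\<^sub>0 laurent)) \<Rightarrow> ('b \<Rightarrow>\<^sub>0 laurent) \<Rightarrow> ('c \<Rightarrow>\<^sub>0 laurent)" where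
  "lin f x = (\<Sum>k\<in>ks x. smul (lk x k) (f k))"

lemma lin_superset: "finite S \<Longrightarrow> ks x \<subseteq> S \<Longrightarrow> lin f x = (\<Sum>k\<in>S. smul (lk x k) (f k))"
  unfolding lin_def by (rule sum.mono_neutral_left) (auto simp: in_keys_iff)

lemma lin_add: "lin f (x + y) = lin f x + lin f y"
  using lin_superset[of "ks x \<union> ks y" _ f] Poly_Mapping.keys_add[of x y]
  by (simp add: finite_keys lookup_add K.scale_left_distrib sum.distrib)

lemma lin_smul: "lin f (smul c x) = smul c (lin f x)"
proof -
  have "ks (smul c x) \<subseteq> ks x" by (auto simp: in_keys_iff lookup_smul)
  then show ?thesis using lin_superset[of "ks x" _ f]
    by (simp add: finite_keys lookup_smul K.scale_sum_right)
qed

lemma lin_single: "lin f (sg k c) = smul c (f k)"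
  by (cases "c = 0") (simp_all add: lin_def)

lemma lin_ket0: "lin f (ket0 k) = f k" by (simp add: ket0_def lin_single)

lemma lin_0: "lin f 0 = 0" by (simp add: lin_def)

lemma lin_sum: "lin f (sum g A) = (\<Sum>a\<in>A. lin f (g a))"
  by (induction A rule: infinite_finite_induct) (auto simp: lin_0 lin_add)

lemma lin_neg: "lin f (- x) = - lin f x"
  using lin_add[of f x "- x"] by (simp add: lin_0 eq_neg_iff_add_eq_0 add.commute)

lemma lin_diff: "lin f (x - y) = lin f x - lin f y"
  using lin_add[of f x "- y"] by (simp add: lin_neg)

lemma ket_expand: "(\<Sum>k\<in>ks x. smul (lk x k) (ket0 k)) = x"
  by (rule poly_mapping_eqI)
    (simp add: lookup_sum lookup_smul ket0_def lookup_single when_def in_keys_iff finite_keys if_distrib cong: if_cong)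

lemma lk_ket0: "lk (ket0 x) y = (if x = y then 1 else 0)"
  by (simp add: ket0_def lookup_single when_def)

lemma lookup_laurent_bar: "lk (laurent_bar c) k = lk c (- k)"
  unfolding laurent_bar_def by (subst map_key.rep_eq) auto

lemma laurent_bar_add: "laurent_bar (c + d) = laurent_bar c + laurent_bar d"
  by (rule poly_mapping_eqI) (simp add: lookup_laurent_bar lookup_add)

lemma laurent_bar_neg: "laurent_bar (- c) = - laurent_bar c"
  by (rule poly_mapping_eqI) (simp add: lookup_laurent_bar)

lemma laurent_bar_0: "laurent_bar 0 = 0"
  by (rule poly_mapping_eqI) (simp add: lookup_laurent_bar)

lemma laurent_bar_bar: "laurent_bar (laurent_bar c) = c"
  by (rule poly_mapping_eqI) (simp add: lookup_laurent_bar)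

lemma laurent_bar_single: "laurent_bar (sg k c) = sg (- k) c"
  by (rule poly_mapping_eqI) (auto simp: lookup_laurent_bar lookup_single when_def)

lemma laurent_bar_sum: "laurent_bar (sum f A) = (\<Sum>x\<in>A. laurent_bar (f x))"
  by (induction A rule: infinite_finite_induct) (auto simp: laurent_bar_0 laurent_bar_add)

lemma laurent_bar_mult: "laurent_bar (c * d) = laurent_bar c * laurent_bar d"
proof -
  have "laurent_bar (c * d) = laurent_bar ((\<Sum>k\<in>ks c. sg k (lk c k)) * (\<Sum>k\<in>ks d. sg k (lk d k)))"
    by (simp only: pm_expand)
  also have "\<dots> = laurent_bar (\<Sum>k\<in>ks c. sg k (lk c k)) * laurent_bar (\<Sum>k\<in>ks d. sg k (lk d k))"
    by (simp add: sum_product mult_single laurent_bar_sum laurent_bar_single)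
  finally show ?thesis by (simp only: pm_expand)
qed

lemma th_add: "th (a + b) = th a * th b" by (simp add: th_def mult_single)

lemma th_0: "th 0 = 1" by (simp add: th_def)

lemma th_inverse: "th a * th (- a) = 1" by (simp add: th_0 flip: th_add)

lemma laurent_bar_th: "laurent_bar (th k) = th (- k)" by (simp add: th_def laurent_bar_single)

lemma of_int_laurent: "(of_int n :: laurent) = sg 0 n"
  by (induction n rule: int_induct[where k = 0]) (simp_all add: single_add single_diff flip: single_one)

lemma laurent_bar_of_int: "laurent_bar (of_int n) = of_int n"
  by (simp add: of_int_laurent laurent_bar_single)

lemma laurent_bar_1: "laurent_bar 1 = 1" using laurent_bar_of_int[of 1] by simp

lemma laurent_bar_minus_one_power: "laurent_bar ((- 1) ^ n) = (- 1) ^ n"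
  by (induction n) (simp_all add: laurent_bar_1 laurent_bar_neg)

section \<open>The straightening relations in symmetric form\<close>

locale fock = brd D for D :: "'a::ab_group_add root_datum" +
  fixes l :: nat
  assumes l_pos: "l > 0"
begin

abbreviation N where "N \<equiv> K.span (fock_relators D l)"
abbreviation e where "e \<equiv> ket0 :: 'a \<Rightarrow> 'a \<Rightarrow>\<^sub>0 laurent"

text \<open>The quantity on which the relations depend; the shift by \<rho> is included, so that
  \<open>sd\<close> below is the dot action of s_i.\<close>

definition pr :: "nat \<Rightarrow> 'a \<Rightarrow> int" where "pr i x = ip (al i) (x + rho D)"
definition sd :: "nat \<Rightarrow> 'a \<Rightarrow> 'a" where "sd i x = x - zmul (pr i x) (al i)"

lemma sd_dot: "dot D (rf (al i)) x = sd i x"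
  by (simp add: dot_def reflect_def sd_def pr_def)

lemma pr_shift: "i \<in> I \<Longrightarrow> pr i (x - zmul k (al i)) = pr i x - 2 * k"
  "i \<in> I \<Longrightarrow> pr i (x + zmul k (al i)) = pr i x + 2 * k"
  by (simp_all add: pr_def coroot_lin simple_root)

lemma pr_add: "i \<in> I \<Longrightarrow> pr i (y + x) = ip (al i) y + pr i x"
  by (simp add: pr_def coroot_add simple_root)

lemma pr_sd: "i \<in> I \<Longrightarrow> pr i (sd i x) = - pr i x"
  by (simp add: sd_def pr_shift)

lemma sd_sd: "i \<in> I \<Longrightarrow> sd i (sd i x) = x"
  using pr_sd by (simp add: sd_def[of i "sd i x"]) (simp add: sd_def)

lemma sd_add: "i \<in> I \<Longrightarrow> sd i (y + x) = rf (al i) y + sd i x"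
  unfolding sd_def pr_add reflect_def zmul_add_left by (simp add: algebra_simps)

lemma sd_shift: "i \<in> I \<Longrightarrow> sd i (x - zmul k (al i)) = sd i x + zmul k (al i)"
  by (simp add: sd_def pr_shift zmul_two Z.scale_left_diff_distrib algebra_simps zmul_mult[symmetric])

text \<open>The relator of the middle range. The relation with four kets is the vanishing of a sum
  of two such expressions.\<close>

definition rr :: "nat \<Rightarrow> 'a \<Rightarrow> ('a \<Rightarrow>\<^sub>0 laurent)" where
  "rr i x = e (sd i x) + smul (th 1) (e x)"

lemma rel_zero: "i \<in> I \<Longrightarrow> pr i x = 0 \<Longrightarrow> e x \<in> N"
  using fock_relators.zero[of i D x l] K.span_base by (auto simp: pr_def I_def)

lemma rel_wall: assumes i: "i \<in> I" and d: "int l dvd pr i x" shows "e (sd i x) + e x \<in> N"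
proof -
  have *: "e (sd i y) + e y \<in> N" if y: "int l dvd pr i y" "pr i y \<ge> 0" for y
  proof -
    obtain k where k: "pr i y = int l * k" using y by (auto elim: dvdE)
    then have "k \<ge> 0" using y l_pos by (simp add: zero_le_mult_iff)
    then have p: "ip (al i) (y + rho D) = int (nat k) * int l" using k by (simp add: pr_def)
    have "i \<in> idx D" using i by (simp only: I_def)
    from fock_relators.wall[OF this p]
    have "e (dot D (rf (al i)) y) - (- e y) \<in> fock_relators D l" .
    then show ?thesis using K.span_base by (simp add: sd_dot)
  qed
  show ?thesis
  proof (cases "pr i x \<ge> 0")
    case False
    \<comment> \<open>The relators only cover nonnegative multiples of l; for a negative one the
      relation is taken at the reflected weight.\<close>
    then have "e (sd i (sd i x)) + e (sd i x) \<in> N" using * i d by (simp add: pr_sd)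
    then show ?thesis using i by (simp add: sd_sd add.commute)
  qed (use * d in simp)
qed

lemma rel_first: assumes "i \<in> I" "0 < pr i x" "pr i x < int l" shows "rr i x \<in> N"
proof -
  have "e (dot D (rf (al i)) x) - (- smul (th 1) (e x)) \<in> fock_relators D l"
    using assms by (intro fock_relators.first) (auto simp: pr_def I_def)
  then show ?thesis using K.span_base by (simp add: sd_dot rr_def)
qed

text \<open>Reflecting the translate of x by - k l \<alpha>_i gives x - j \<alpha>_i, so the two
  lower kets of the relation are exactly those of \<open>rr\<close> at this translate.\<close>

lemma higher_form:
  assumes i: "i \<in> I" and p: "pr i x = k * int l + j"
  shows "rr i x + rr i (x - zmul (k * int l) (al i)) =
    e (sd i x) - (- smul (th 1) (e (sd i (x - zmul j (al i)))) - e (x - zmul j (al i)) - smul (th 1) (e x))"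
proof -
  have "sd i (x - zmul (k * int l) (al i)) = x - zmul j (al i)"
    using i p by (simp add: sd_def pr_shift zmul_add_left Z.scale_left_diff_distrib algebra_simps zmul_two
      flip: zmul_mult[of 2])
  moreover from this have "sd i (x - zmul j (al i)) = x - zmul (k * int l) (al i)" using i by (metis sd_sd)
  ultimately show ?thesis unfolding rr_def by (simp only:) (simp add: algebra_simps)
qed

text \<open>In terms of \<open>rr\<close> the third relation is symmetric under $k \mapsto -k$.\<close>

lemma rel_higher:
  assumes i: "i \<in> I" and p: "pr i x = k * int l + j" and j: "0 < j" "j < int l"
  shows "rr i x + rr i (x - zmul (k * int l) (al i)) \<in> N"
proof -
  have *: "rr i x + rr i (x - zmul (k * int l) (al i)) \<in> N" if p: "pr i x = k * int l + j" and k: "k > 0" for x k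
  proof -
    have "e (dot D (rf (al i)) x) - (- smul (th 1) (e (dot D (rf (al i)) (x - zmul j (al i))))
       - e (x - zmul j (al i)) - smul (th 1) (e x)) \<in> fock_relators D l"
      by (rule fock_relators.higher[of i D x "nat k" l "nat j"]) (use i p k j in \<open>auto simp: pr_def I_def\<close>)
    then show ?thesis unfolding higher_form[OF i p] using K.span_base by (simp add: sd_dot)
  qed
  consider "k > 0" | "k = 0" | "k < 0" by linarith
  then show ?thesis
  proof cases
    case 2
    then have "rr i x \<in> N" using rel_first i p j by simp
    then show ?thesis using K.span_add[of "rr i x" _ "rr i x"] 2 by (simp add: zmul_0_left del: one_add_one)
  next
    case 3
    let ?y = "x - zmul (k * int l) (al i)"
    have "rr i ?y + rr i (?y - zmul (- k * int l) (al i)) \<in> N"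
      by (rule *) (use 3 i p in \<open>auto simp: pr_shift\<close>)
    then show ?thesis by (simp add: add.commute)
  qed (use * p in blast)
qed

lemma relator_cases:
  assumes "x \<in> fock_relators D l"
  obtains (zero) i y where "i \<in> I" "pr i y = 0" "x = e y"
  | (wall) i y where "i \<in> I" "int l dvd pr i y" "x = e (sd i y) + e y"
  | (first) i y where "i \<in> I" "0 < pr i y" "pr i y < int l" "x = rr i y"
  | (higher) i y k j where "i \<in> I" "pr i y = k * int l + j" "0 < j" "j < int l"
      "x = rr i y + rr i (y - zmul (k * int l) (al i))"
  using assms
proof (cases rule: fock_relators.cases)
  case (zero i lam) then show ?thesis using that(1)[of i lam] by (simp add: pr_def I_def)
next
  case (wall i lam k) then show ?thesis using that(2)[of i lam] by (simp add: pr_def I_def sd_dot)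
next
  case (first i lam) then show ?thesis using that(3)[of i lam] by (simp add: pr_def I_def sd_dot rr_def)
next
  case (higher i lam k j lam1)
  have p: "pr i lam = int k * int l + int j" and i: "i \<in> I" using higher by (auto simp: pr_def I_def)
  show ?thesis
    by (rule that(4)[OF i p]) (use higher in \<open>auto simp: higher_form[OF i p] sd_dot\<close>)
qed

text \<open>The common frame for maps on the quotient. The twist \<open>h\<close> is the identity
  for the action and the sign projector and \<open>laurent_bar\<close> for the bar involution; the
  target is the relation module or zero.\<close>

lemma span_relators_map:
  fixes g :: "('a \<Rightarrow>\<^sub>0 laurent) \<Rightarrow> ('b \<Rightarrow>\<^sub>0 laurent)"
  assumes V: "K.subspace V" and add: "\<And>x y. g (x + y) = g x + g y" and smul: "\<And>c x. g (smul c x) = smul (h c) (g x)"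
    and zero: "\<And>i y. i \<in> I \<Longrightarrow> pr i y = 0 \<Longrightarrow> g (e y) \<in> V"
    and wall: "\<And>i y. i \<in> I \<Longrightarrow> int l dvd pr i y \<Longrightarrow> g (e (sd i y)) + g (e y) \<in> V"
    and first: "\<And>i y. i \<in> I \<Longrightarrow> 0 < pr i y \<Longrightarrow> pr i y < int l \<Longrightarrow> g (rr i y) \<in> V"
    and higher: "\<And>i y k j. i \<in> I \<Longrightarrow> pr i y = k * int l + j \<Longrightarrow> 0 < j \<Longrightarrow> j < int l \<Longrightarrow>
      g (rr i y) + g (rr i (y - zmul (k * int l) (al i))) \<in> V"
    and x: "x \<in> N"
  shows "g x \<in> V"
  using x
proof (induction rule: K.span_induct)
  case base
  have "g 0 = 0" using add[of 0 0] by simp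
  then show ?case unfolding K.subspace_def
    using V by (auto simp: add smul K.subspace_0 K.subspace_add K.subspace_scale)
next
  case (step x) then show ?case
    by (cases rule: relator_cases) (use zero wall first higher in \<open>simp_all add: add\<close>)
qed

subsection \<open>The action of invariants\<close>

lemma N_sum: "(\<And>a. a \<in> A \<Longrightarrow> f a \<in> N) \<Longrightarrow> sum f A \<in> N" by (rule K.span_sum)

text \<open>The sum is split into orbits of s_i. A fixed point has to lie in \<open>N\<close> by
  itself; otherwise only the sum over the two points of an orbit has to.\<close>

lemma pair_sum:
  assumes i: "i \<in> I" and fin: "finite S" and S: "\<And>x. x \<in> S \<Longrightarrow> rf (al i) x \<in> S"
    and g: "\<And>x. g (rf (al i) x) = g x"
    and 0: "\<And>x. ip (al i) x = 0 \<Longrightarrow> F x \<in> N" and 1: "\<And>x. F x + F (rf (al i) x) \<in> N"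
  shows "(\<Sum>x\<in>S. smul (g x) (F x)) \<in> N"
proof -
  let ?P = "{x \<in> S. ip (al i) x > 0}" and ?Z = "{x \<in> S. ip (al i) x = 0}" and ?M = "{x \<in> S. ip (al i) x < 0}"
  have r: "al i \<in> R" using i simple_root by blast
  have SU: "S = ?Z \<union> (?P \<union> ?M)" by auto
  have "(\<Sum>x\<in>S. smul (g x) (F x)) = (\<Sum>x\<in>?Z \<union> (?P \<union> ?M). smul (g x) (F x))" using SU by (rule arg_cong)
  also have "\<dots> = (\<Sum>x\<in>?Z. smul (g x) (F x)) + (\<Sum>x\<in>?P \<union> ?M. smul (g x) (F x))"
    by (rule sum.union_disjoint) (use fin in auto)
  also have "(\<Sum>x\<in>?P \<union> ?M. smul (g x) (F x)) = (\<Sum>x\<in>?P. smul (g x) (F x)) + (\<Sum>x\<in>?M. smul (g x) (F x))"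
    by (rule sum.union_disjoint) (use fin in auto)
  also have "(\<Sum>x\<in>?M. smul (g x) (F x)) = (\<Sum>x\<in>?P. smul (g x) (F (rf (al i) x)))"
    by (rule sum.reindex_bij_witness[of _ "rf (al i)" "rf (al i)"])
      (use S g r in \<open>auto simp: reflect_reflect coroot_reflect_self\<close>)
  finally have "(\<Sum>x\<in>S. smul (g x) (F x)) = (\<Sum>x\<in>?Z. smul (g x) (F x)) + (\<Sum>x\<in>?P. smul (g x) (F x + F (rf (al i) x)))"
    by (simp add: K.scale_right_distrib sum.distrib)
  moreover have "(\<Sum>x\<in>?Z. smul (g x) (F x)) \<in> N" using 0 by (intro N_sum K.span_scale) auto
  moreover have "(\<Sum>x\<in>?P. smul (g x) (F x + F (rf (al i) x))) \<in> N" using 1 by (intro N_sum K.span_scale) auto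
  ultimately show ?thesis by (simp add: K.span_add)
qed

abbreviation dual where "dual \<equiv> dual_weight D"

lemma dual_dual: "dual (dual x) = x"
  using wo_W by (simp add: dual_weight_def W_neg wo_wo)

lemma dual_W: assumes w: "w \<in> W" shows "\<exists>v\<in>W. dual (w x) = v (dual x)"
proof -
  have "wo \<circ> w \<circ> wo \<in> W" using w W_comp wo_W by blast
  moreover have "dual (w x) = (wo \<circ> w \<circ> wo) (dual x)"
    using w wo_W by (simp add: dual_weight_def W_neg wo_wo)
  ultimately show ?thesis by blast
qed

lemma act0_lin: "act0 D l f x = lin (\<lambda>\<gamma>. \<Sum>\<mu>\<in>ks f. smul (lk f \<mu>) (e (zmul (int l) (dual \<mu>) + \<gamma>))) x"
  by (simp add: act0_def lin_def K.scale_sum_right)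

lemma act0_ket:
  "act0 D l f (e x) = (\<Sum>y\<in>dual ` ks f. smul (lk f (dual y)) (e (zmul (int l) y + x)))"
proof -
  have "inj_on dual (ks f)" by (metis dual_dual inj_onI)
  then show ?thesis unfolding act0_lin lin_ket0 by (simp add: sum.reindex dual_dual)
qed

lemma invariant_dual:
  assumes f: "invariant f" and w: "w \<in> W"
  shows "lk f (dual (w x)) = lk f (dual x)" and "x \<in> dual ` ks f \<Longrightarrow> w x \<in> dual ` ks f"
proof -
  show *: "lk f (dual (w x)) = lk f (dual x)" using dual_W[OF w, of x] f by (auto simp: invariant_def)
  assume "x \<in> dual ` ks f"
  then have "dual x \<in> ks f" using dual_dual by auto
  then have "dual (w x) \<in> ks f" using * by (simp add: in_keys_iff)
  then show "w x \<in> dual ` ks f" using dual_dual by (metis imageI)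
qed

lemma act0_reindex:
  assumes f: "invariant f" and w: "w \<in> W"
  shows "(\<Sum>y\<in>dual ` ks f. smul (lk f (dual y)) (F (w y))) = (\<Sum>y\<in>dual ` ks f. smul (lk f (dual y)) (F y))"
proof (rule sum.reindex_bij_witness[of _ "inv w" w])
  fix y assume y: "y \<in> dual ` ks f"
  show "inv w (w y) = y" "w (inv w y) = y" using w by (auto simp: W_inv_left W_inv_right)
  show "w y \<in> dual ` ks f" "inv w y \<in> dual ` ks f" using invariant_dual(2)[OF f] w W_inv y by blast+
  show "smul (lk f (dual (w y))) (F (w y)) = smul (lk f (dual y)) (F (w y))"
    using invariant_dual(1)[OF f w] by simp
qed

lemma act0_add: "act0 D l f (x + y) = act0 D l f x + act0 D l f y"
  and act0_smul: "act0 D l f (smul c x) = smul c (act0 D l f x)"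
  by (simp_all add: act0_lin lin_add lin_smul)

text \<open>
  The translates of a relation by $\ell\nu$ and by $\ell s_i\nu$ add up to a relation. They are
  grouped in pairs, because division by 2 is not possible.
\<close>

lemma act0_N: assumes f: "invariant f" and x: "x \<in> N" shows "act0 D l f x \<in> N"
proof (rule span_relators_map[where g = "act0 D l f" and h = "\<lambda>c. c", OF K.subspace_span act0_add act0_smul _ _ _ _ x])
  let ?S = "dual ` ks f" and ?g = "\<lambda>y. lk f (dual y)"
  have fin: "finite ?S" by (simp add: finite_keys)
  fix i y assume i: "i \<in> I"
  have Wi: "rf (al i) \<in> W" using i W_simple by blast
  note S = invariant_dual(2)[OF f Wi] and g = invariant_dual(1)[OF f Wi]
  have sdl: "sd i (zmul (int l) m + x) = zmul (int l) (rf (al i) m) + sd i x" for m x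
    using i by (simp add: sd_add reflect_zmul simple_root)
  \<comment> \<open>Reflecting the translation part subtracts a multiple of l \<alpha>_i, which is
    precisely the shift between the two halves of \<open>rel_higher\<close>.\<close>
  have refl: "zmul (int l) (rf (al i) m) + x = zmul (int l) m + x - zmul (ip (al i) m * int l) (al i)" for m x
    by (simp add: reflect_def Z.scale_right_diff_distrib zmul_mult algebra_simps)
  have prl: "pr i (zmul (int l) m + x) = int l * ip (al i) m + pr i x" for m x
    using i by (simp add: pr_add coroot_zmul simple_root)
  have arr: "act0 D l f (rr i x) = (\<Sum>m\<in>?S. smul (?g m) (rr i (zmul (int l) m + x)))" for x
  proof -
    have "act0 D l f (e (sd i x)) = (\<Sum>m\<in>?S. smul (?g m) (e (sd i (zmul (int l) m + x))))"
      unfolding act0_ket sdl by (rule act0_reindex[OF f Wi, symmetric])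
    then show ?thesis
      by (simp add: rr_def act0_add act0_smul act0_ket K.scale_right_distrib sum.distrib K.scale_sum_right mult.commute)
  qed
  { assume p: "pr i y = 0"
    show "act0 D l f (e y) \<in> N" unfolding act0_ket
    proof (rule pair_sum[where g = ?g, OF i fin S g])
      fix m show "ip (al i) m = 0 \<Longrightarrow> e (zmul (int l) m + y) \<in> N" using p i by (intro rel_zero) (auto simp: prl)
      have "sd i y = y" using p by (simp add: sd_def zmul_0_left)
      then have "e (sd i (zmul (int l) m + y)) = e (zmul (int l) (rf (al i) m) + y)" by (simp add: sdl)
      then show "e (zmul (int l) m + y) + e (zmul (int l) (rf (al i) m) + y) \<in> N"
        using rel_wall[OF i, of "zmul (int l) m + y"] p by (subst add.commute) (simp add: prl)
    qed }
  { assume p: "int l dvd pr i y"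
    have "act0 D l f (e (sd i y)) = (\<Sum>m\<in>?S. smul (?g m) (e (sd i (zmul (int l) m + y))))"
      unfolding act0_ket sdl by (rule act0_reindex[OF f Wi, symmetric])
    then have "act0 D l f (e (sd i y)) + act0 D l f (e y)
      = (\<Sum>m\<in>?S. smul (?g m) (e (sd i (zmul (int l) m + y)) + e (zmul (int l) m + y)))"
      by (simp add: act0_ket K.scale_right_distrib sum.distrib)
    also have "\<dots> \<in> N" using i p by (intro N_sum K.span_scale rel_wall) (auto simp: prl)
    finally show "act0 D l f (e (sd i y)) + act0 D l f (e y) \<in> N" . }
  { assume p: "0 < pr i y" "pr i y < int l"
    show "act0 D l f (rr i y) \<in> N" unfolding arr
    proof (rule pair_sum[where g = ?g, OF i fin S g])
      fix m show "ip (al i) m = 0 \<Longrightarrow> rr i (zmul (int l) m + y) \<in> N"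
        using p i by (intro rel_first) (auto simp: prl)
      show "rr i (zmul (int l) m + y) + rr i (zmul (int l) (rf (al i) m) + y) \<in> N"
        unfolding refl using p i by (intro rel_higher[where j = "pr i y"]) (auto simp: prl)
    qed }
  { fix k j assume p: "pr i y = k * int l + j" "0 < j" "j < int l"
    let ?z = "y - zmul (k * int l) (al i)"
    have "act0 D l f (rr i ?z) = (\<Sum>m\<in>?S. smul (?g m) (rr i (zmul (int l) (rf (al i) m) + ?z)))"
      unfolding arr by (rule act0_reindex[OF f Wi, symmetric])
    then have "act0 D l f (rr i y) + act0 D l f (rr i ?z)
      = (\<Sum>m\<in>?S. smul (?g m) (rr i (zmul (int l) m + y) + rr i (zmul (int l) (rf (al i) m) + ?z)))"
      by (simp add: arr K.scale_right_distrib sum.distrib)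
    also have "\<dots> \<in> N"
    proof (intro N_sum K.span_scale)
      fix m
      have r: "zmul (int l) (rf (al i) m) + ?z
        = zmul (int l) m + y - zmul ((ip (al i) m + k) * int l) (al i)"
        unfolding refl by (simp add: distrib_right zmul_add_left algebra_simps)
      show "rr i (zmul (int l) m + y) + rr i (zmul (int l) (rf (al i) m) + ?z) \<in> N"
        unfolding r by (rule rel_higher[OF i _ p(2,3)]) (simp add: prl p(1) distrib_right)
    qed
    finally show "act0 D l f (rr i y) + act0 D l f (rr i ?z) \<in> N" . }
qed

subsection \<open>The bar involution\<close>

abbreviation wc where "wc \<equiv> wall_count D l"

text \<open>The bijection fixes \<alpha>_i, whose pairing only changes sign, and applies s_i to all
  other positive roots.\<close>

lemma wc_simple: assumes i: "i \<in> I" shows "wc (sd i x) = wc x"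
proof -
  let ?A = "\<lambda>x. {\<alpha> \<in> Rp. int l dvd ip \<alpha> (x + rho D)}"
  let ?f = "\<lambda>\<alpha>. if \<alpha> = al i then \<alpha> else rf (al i) \<alpha>"
  have r: "al i \<in> R" using i simple_root by blast
  have sx: "sd i x + rho D = rf (al i) (x + rho D)" for x by (simp flip: sd_dot add: dot_def)
  have ne: "rf (al i) \<alpha> \<noteq> al i" if "\<alpha> \<in> Rp" for \<alpha>
    using that r pos_not_neg simple_pos[OF i] by (metis reflect_reflect reflect_self)
  have m: "?f \<alpha> \<in> ?A (sd i x)" if "\<alpha> \<in> ?A x" for \<alpha> x
    using that simple_perm[OF i, of \<alpha>] r pos_root
    by (auto simp: sx coroot_reflect_self coroot_reflect reflect_reflect)
  have ff: "?f (?f \<alpha>) = \<alpha>" if "\<alpha> \<in> Rp" for \<alpha> using ne[OF that] r by (simp add: reflect_reflect)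
  have "bij_betw ?f (?A x) (?A (sd i x))"
  proof (rule bij_betw_byWitness[of _ ?f])
    show "?f ` ?A x \<subseteq> ?A (sd i x)" using m[of _ x] by blast
    show "?f ` ?A (sd i x) \<subseteq> ?A x" using m[of _ "sd i x"] unfolding sd_sd[OF i] by blast
  qed (use ff in blast)+
  from bij_betw_same_card[OF this] show ?thesis by (simp only: wall_count_def)
qed

lemma wc_W: "w \<in> W \<Longrightarrow> wc (dot D w x) = wc x"
proof (induction rule: W_induct)
  case id show ?case by (simp only: dot_id)
next
  case (step i w) then show ?case by (simp only: dot_comp sd_dot wc_simple)
qed

lemma wc_shift: "wc (x + zmul (k * int l) y) = wc x"
proof -
  have "int l dvd ip \<alpha> (x + zmul (k * int l) y + rho D) \<longleftrightarrow> int l dvd ip \<alpha> (x + rho D)" if "\<alpha> \<in> Rp" for \<alpha>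
  proof -
    have "ip \<alpha> (x + zmul (k * int l) y + rho D) = ip \<alpha> (x + rho D) + int l * (k * ip \<alpha> y)"
      using that pos_root by (simp add: coroot_add coroot_zmul)
    then show ?thesis using dvd_add_left_iff[of "int l" "int l * (k * ip \<alpha> y)"] by simp
  qed
  then show ?thesis unfolding wall_count_def by (intro arg_cong[where f = card] Collect_cong conj_cong refl)
qed

lemma wc_shift': "wc (x - zmul (k * int l) y) = wc x"
  using wc_shift[of x "- k" y] by simp

text \<open>The scalar of the bar involution on a ket. It depends only on \<open>wc\<close>, hence
  is constant on dot orbits and under translation by l times the lattice.\<close>

definition bar_coeff :: "'a \<Rightarrow> laurent" where
  "bar_coeff x = (- 1) ^ card Rp * th (- (int (card Rp) - int (wc x)))"

abbreviation bar where "bar \<equiv> bar0 D l"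

lemma bar_semilin:
  assumes "finite S" "ks x \<subseteq> S"
  shows "bar x = (\<Sum>k\<in>S. smul (laurent_bar (lk x k)) (bar_ket D l k))"
  unfolding bar0_def by (rule sum.mono_neutral_left) (use assms in \<open>auto simp: in_keys_iff laurent_bar_0\<close>)

lemma bar_add: "bar (x + y) = bar x + bar y"
  using bar_semilin[of "ks x \<union> ks y"] Poly_Mapping.keys_add[of x y]
  by (simp add: finite_keys lookup_add laurent_bar_add K.scale_left_distrib sum.distrib)

lemma bar_smul: "bar (smul c x) = smul (laurent_bar c) (bar x)"
proof -
  have "ks (smul c x) \<subseteq> ks x" by (auto simp: in_keys_iff lookup_smul)
  then show ?thesis using bar_semilin[of "ks x"]
    by (simp add: finite_keys lookup_smul laurent_bar_mult K.scale_sum_right)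
qed

lemma bar_0: "bar 0 = 0" using bar_add[of 0 0] by simp

lemma bar_neg: "bar (- x) = - bar x"
  using bar_add[of x "- x"] by (simp add: bar_0 eq_neg_iff_add_eq_0 add.commute)

lemma bar_diff: "bar (x - y) = bar x - bar y"
  using bar_add[of x "- y"] by (simp add: bar_neg)

lemma bar_sum: "bar (sum f A) = (\<Sum>x\<in>A. bar (f x))"
  by (induction A rule: infinite_finite_induct) (auto simp: bar_0 bar_add)

lemma bar_ket: "bar (e x) = smul (bar_coeff x) (e (dot D wo x))"
proof -
  have "ks (e x) = {x}" by (simp add: ket0_def)
  then have "bar (e x) = bar_ket D l x" by (simp add: bar0_def lk_ket0 laurent_bar_1)
  then show ?thesis by (simp add: bar_ket_def weyl_length_wo bar_coeff_def)
qed

lemma bar_coeff_bar_coeff: "laurent_bar (bar_coeff x) * bar_coeff x = 1"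
proof -
  have "laurent_bar (bar_coeff x) * bar_coeff x = ((- 1) ^ card Rp * (- 1) ^ card Rp)
    * (th (int (card Rp) - int (wc x)) * th (- (int (card Rp) - int (wc x))))"
    by (simp add: bar_coeff_def laurent_bar_mult laurent_bar_th laurent_bar_minus_one_power mult_ac)
  then show ?thesis unfolding th_inverse by (simp flip: power_mult_distrib)
qed

lemma dot_wo_wo: "dot D wo (dot D wo x) = x" by (simp add: dot_def wo_wo)

lemma bar_bar: "bar (bar x) = x"
proof -
  have "bar (bar (e y)) = e y" for y
    using bar_coeff_bar_coeff[of y] by (simp add: bar_ket bar_smul bar_coeff_def wc_W wo_W dot_wo_wo)
  then have "bar (bar (\<Sum>k\<in>ks x. smul (lk x k) (e k))) = (\<Sum>k\<in>ks x. smul (lk x k) (e k))"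
    by (simp add: bar_sum bar_smul laurent_bar_bar)
  then show ?thesis by (simp add: ket_expand)
qed

text \<open>The longest element carries a translation by l m to one by l w0 m, and the invariance of
  f absorbs w0. The scalars agree because translation by l times a weight preserves
  \<open>wc\<close>.\<close>

lemma bar_act: assumes f: "invariant f" shows "bar (act0 D l f x) = act0 D l f (bar x)"
proof -
  have c: "laurent_bar (lk f y) = lk f y" for y using f unfolding invariant_def by (metis laurent_bar_of_int rangeE)
  have k: "bar (act0 D l f (e y)) = act0 D l f (bar (e y))" for y
  proof -
    have "bar (act0 D l f (e y)) = (\<Sum>m\<in>dual ` ks f. smul (lk f (dual m)) (smul (bar_coeff y) (e (dot D wo (zmul (int l) m + y)))))"
      using wc_shift[of y 1] by (simp add: act0_ket bar_sum bar_smul c bar_ket bar_coeff_def add.commute)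
    also have "\<dots> = (\<Sum>m\<in>dual ` ks f. smul (lk f (dual m)) (smul (bar_coeff y) (e (zmul (int l) (wo m) + dot D wo y))))"
      using wo_W by (simp add: dot_def W_add W_zmul add_diff_eq add.assoc)
    also have "\<dots> = (\<Sum>m\<in>dual ` ks f. smul (lk f (dual m)) (smul (bar_coeff y) (e (zmul (int l) m + dot D wo y))))"
      by (rule act0_reindex[OF f wo_W])
    also have "\<dots> = act0 D l f (bar (e y))"
      by (simp add: bar_ket act0_smul act0_ket K.scale_sum_right mult.commute)
    finally show ?thesis .
  qed
  have lin: "act0 D l f (sum h A) = (\<Sum>a\<in>A. act0 D l f (h a))" for h and A :: "'a set"
    by (simp add: act0_lin lin_sum)
  have "bar (act0 D l f (\<Sum>k\<in>ks x. smul (lk x k) (e k))) = act0 D l f (bar (\<Sum>k\<in>ks x. smul (lk x k) (e k)))"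
    by (simp add: bar_sum bar_smul act0_smul lin k)
  then show ?thesis by (simp add: ket_expand)
qed

text \<open>The longest element conjugates s_i into another simple reflection s_j, and each relation
  for i becomes a unit multiple of one of the same kind for j.\<close>

lemma bar_N: assumes x: "x \<in> N" shows "bar x \<in> N"
proof (rule span_relators_map[where g = bar and h = laurent_bar, OF K.subspace_span bar_add bar_smul _ _ _ _ x])
  fix i y assume i: "i \<in> I"
  obtain j where j: "j \<in> I" "wo (al i) = - al j" using wo_simple[OF i] by blast
  have ri: "al i \<in> R" and rj: "al j \<in> R" using i j simple_root by auto
  \<comment> \<open>The extra s_i is there because the longest element reverses the sign of the
    pairing; with it, \<open>pr j (?z y)\<close> equals \<open>pr i y\<close>.\<close>
  let ?z = "\<lambda>y. dot D wo (sd i y)"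
  have sdy: "sd i y + rho D = rf (al i) (y + rho D)" for y by (simp flip: sd_dot add: dot_def)
  have pz: "pr j (?z y) = pr i y" for y
  proof -
    have "pr j (?z y) = ip (- wo (al i)) (wo (sd i y + rho D))" by (simp add: pr_def dot_def j)
    also have "\<dots> = - ip (al i) (rf (al i) (y + rho D))"
      using ri wo_W by (simp add: coroot_neg_root W_root coroot_W sdy)
    finally show ?thesis using ri by (simp add: coroot_reflect_self pr_def)
  qed
  have sz: "sd j (?z y) = dot D wo y" for y
  proof -
    have "rf (al j) (wo (rf (al i) (y + rho D))) = wo (y + rho D)"
      using reflect_W[OF wo_W ri, of "rf (al i) (y + rho D)"] ri rj
      by (simp add: j reflect_neg_root reflect_reflect)
    then show ?thesis by (simp add: sd_dot[symmetric] dot_def)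
  qed
  have bcs: "bar_coeff (sd i y) = bar_coeff y" for y using i by (simp add: bar_coeff_def wc_simple)
  \<comment> \<open>The bar involution inverts t^(1/2), so the two kets of \<open>rr\<close>
    exchange roles once t^(-1/2) is factored out.\<close>
  have brr: "bar (rr i y) = smul (bar_coeff y * th (- 1)) (rr j (?z y))" for y
  proof -
    have "th (- 1) * th 1 = 1" using th_inverse[of 1] by (simp only: mult.commute)
    then show ?thesis
      by (simp add: rr_def bar_add bar_smul bar_ket bcs sz laurent_bar_th K.scale_right_distrib
          mult.commute[of "th (- 1)" "bar_coeff y"] mult.assoc add.commute)
  qed
  { assume p: "pr i y = 0"
    then have "sd i y = y" by (simp add: sd_def zmul_0_left)
    then have "e (dot D wo y) \<in> N" using rel_zero[OF j(1)] pz[of y] p by simp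
    then show "bar (e y) \<in> N" by (simp add: bar_ket K.span_scale) }
  { assume p: "int l dvd pr i y"
    have "bar (e (sd i y)) + bar (e y) = smul (bar_coeff y) (e (sd j (?z y)) + e (?z y))"
      by (simp add: bar_ket bcs sz K.scale_right_distrib add.commute)
    then show "bar (e (sd i y)) + bar (e y) \<in> N"
      using rel_wall[OF j(1), of "?z y"] p by (simp add: pz K.span_scale) }
  { assume p: "0 < pr i y" "pr i y < int l"
    then show "bar (rr i y) \<in> N" unfolding brr using rel_first[OF j(1), of "?z y"] by (simp add: pz K.span_scale) }
  { fix k m assume p: "pr i y = k * int l + m" "0 < m" "m < int l"
    let ?y = "y - zmul (k * int l) (al i)"
    have "?z ?y = ?z y - zmul (k * int l) (al j)"
      using i wo_W j by (simp add: sd_shift dot_add W_zmul)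
    then have "bar (rr i y) + bar (rr i ?y) = smul (bar_coeff y * th (- 1)) (rr j (?z y) + rr j (?z y - zmul (k * int l) (al j)))"
      unfolding brr by (simp add: bar_coeff_def wc_shift' K.scale_right_distrib)
    then show "bar (rr i y) + bar (rr i ?y) \<in> N"
      using rel_higher[OF j(1) _ p(2,3), of "?z y" k] p by (simp add: pz K.span_scale) }
qed

end

subsection \<open>Demazure--Lusztig strings\<close>

text \<open>The Hecke generators have eigenvalues t^(-1/2) and - t^(1/2), so this is the difference
  between the inverse of T and T.\<close>

definition hecke_par :: laurent where "hecke_par = th 1 - th (- 1)"

text \<open>
  For \<open>sh p\<close> the translation by $-p\alpha$ this is $(X^\mu - X^{\mu - k\alpha}) / (X^\alpha - 1)$, expanded for
  either sign of $k$.
\<close>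

definition string_sum :: "(int \<Rightarrow> 'b \<Rightarrow> 'b) \<Rightarrow> int \<Rightarrow> 'b \<Rightarrow> ('b \<Rightarrow>\<^sub>0 laurent)" where
  "string_sum sh k y = (if k \<ge> 0 then (\<Sum>p\<in>{1..k}. ket0 (sh p y)) else - (\<Sum>p\<in>{k + 1..0}. ket0 (sh p y)))"

lemma string_sum_0: "string_sum sh 0 y = 0" by (simp add: string_sum_def)

lemma string_sum_step: "string_sum sh (k + 1) y = string_sum sh k y + ket0 (sh (k + 1) y)"
proof (cases "k \<ge> 0")
  case True
  then have "{1..k + 1} = insert (k + 1) {1..k}" by auto
  then show ?thesis using True by (simp add: string_sum_def add.commute)
next
  case False
  then have "{k + 1..0} = insert (k + 1) {k + 1 + 1..0}" by auto
  then show ?thesis using False by (cases "k = - 1") (simp_all add: string_sum_def)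
qed

text \<open>The cocycle rule holds for all signs because negative lengths count with a minus sign.
  It makes opposite strings cancel.\<close>

lemma string_sum_add:
  assumes sh: "\<And>p q y. sh p (sh q y) = sh (q + p) y"
  shows "string_sum sh (k + m) y = string_sum sh k y + string_sum sh m (sh k y)"
proof (induction m rule: int_induct[where k = 0])
  case base then show ?case by (simp add: string_sum_0)
next
  case (step1 m)
  then show ?case using string_sum_step[of sh "k + m" y] string_sum_step[of sh m "sh k y"] by (simp add: sh add.assoc)
next
  case (step2 m)
  then show ?case using string_sum_step[of sh "k + m - 1" y] string_sum_step[of sh "m - 1" "sh k y"]
    by (simp add: sh algebra_simps)
qed

lemma lin_string_sum:
  assumes "\<And>p. f (sh p y) = smul c (ket0 (sh' p z))"
  shows "lin f (string_sum sh k y) = smul c (string_sum sh' k z)"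
  by (simp add: string_sum_def lin_sum lin_neg lin_ket0 assms K.scale_sum_right)

lemma lin_gstr2:
  assumes "\<And>p. f (sh p y) = ket0 (sh p z) - smul c (ket0 (sh p y))"
  shows "lin f (string_sum sh k y) = string_sum sh k z - smul c (string_sum sh k y)"
  by (simp add: string_sum_def lin_sum lin_neg lin_ket0 assms K.scale_sum_right sum_subtractf)

context brd
begin

text \<open>The least k for which the affine root \<gamma> + k \<delta> is positive; it also
  switches the correction terms of the Hecke operators on and off.\<close>

definition neg_ind :: "'a \<Rightarrow> int" where "neg_ind \<gamma> = (if \<gamma> \<in> Rp then 0 else 1)"

lemma neg_ind_neg: "\<gamma> \<in> R \<Longrightarrow> neg_ind (- \<gamma>) = 1 - neg_ind \<gamma>"
  using neg_iff by (auto simp: neg_ind_def)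

lemma neg_ind_simple: "i \<in> I \<Longrightarrow> \<gamma> \<in> R \<Longrightarrow> \<gamma> \<noteq> al i \<Longrightarrow> \<gamma> \<noteq> - al i \<Longrightarrow> neg_ind (rf (al i) \<gamma>) = neg_ind \<gamma>"
proof (cases "\<gamma> \<in> Rp")
  case True
  moreover assume "i \<in> I" "\<gamma> \<noteq> al i"
  ultimately show ?thesis using simple_perm by (simp add: neg_ind_def)
next
  case False
  moreover assume i: "i \<in> I" and g: "\<gamma> \<in> R" "\<gamma> \<noteq> - al i"
  ultimately have "- \<gamma> \<in> Rp" "- \<gamma> \<noteq> al i" using pos_or_neg by (blast, metis minus_minus)
  then have "- rf (al i) \<gamma> \<in> Rp" using simple_perm[OF i, of "- \<gamma>"] i by (simp add: reflect_neg simple_root)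
  then have "rf (al i) \<gamma> \<notin> Rp" using pos_not_neg by fastforce
  then show ?thesis using False by (simp add: neg_ind_def)
qed

subsection \<open>The regular module and its left and right operators\<close>

definition shift_pair :: "nat \<Rightarrow> int \<Rightarrow> 'a \<times> ('a \<Rightarrow> 'a) \<Rightarrow> 'a \<times> ('a \<Rightarrow> 'a)" where
  "shift_pair i p y = (fst y - zmul p (al i), snd y)"

text \<open>Left multiplication by T_i in Demazure-Lusztig form. The shortened string at a negative
  root gives (0, w) the image T_w of the identity vector. The value 0 outside W is a convention: the
  second component may be any function.\<close>

definition left_op :: "nat \<Rightarrow> 'a \<times> ('a \<Rightarrow> 'a) \<Rightarrow> ('a \<times> ('a \<Rightarrow> 'a) \<Rightarrow>\<^sub>0 laurent)" where
  "left_op i y = (if snd y \<in> W then ket0 (rf (al i) (fst y), rf (al i) \<circ> snd y)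
     + smul hecke_par (string_sum (shift_pair i) (ip (al i) (fst y) - neg_ind (inv (snd y) (al i))) y) else 0)"

text \<open>Right multiplication by an affine generator. Only the sign of the finite part w b
  decides on the correction, as for the semi-infinite (periodic) order on alcoves; translations
  therefore do not affect it.\<close>

definition right_op :: "'a \<Rightarrow> int \<Rightarrow> 'a \<times> ('a \<Rightarrow> 'a) \<Rightarrow> ('a \<times> ('a \<Rightarrow> 'a) \<Rightarrow>\<^sub>0 laurent)" where
  "right_op b d y = (if snd y \<in> W then ket0 (fst y - zmul d (snd y b), snd y \<circ> rf b)
     - smul (hecke_par * of_int (neg_ind (snd y b))) (ket0 y) else 0)"

text \<open>
  The pair \<open>(b, d)\<close> plays the role of the affine root \<open>b + d\<delta>\<close>, and the condition says that its
  reflection permutes the other positive affine roots.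
\<close>

definition affine_simple :: "'a \<Rightarrow> int \<Rightarrow> bool" where
  "affine_simple b d \<longleftrightarrow> b \<in> R \<and> neg_ind b = d \<and>
     (\<forall>\<gamma>\<in>R. \<gamma> \<noteq> b \<longrightarrow> \<gamma> \<noteq> - b \<longrightarrow> neg_ind (rf b \<gamma>) = neg_ind \<gamma> - d * ip \<gamma> b)"

lemma affine_simple_simple: "i \<in> I \<Longrightarrow> affine_simple (al i) 0"
  unfolding affine_simple_def using simple_root simple_pos neg_ind_simple by (auto simp: neg_ind_def)

text \<open>A positive root has positive norm, so it pairs positively with some simple coroot.
  Unless it is that simple root, reflecting it keeps it positive and lowers its form with
  \<rho>.\<close>

lemma W_reflect: assumes "\<alpha> \<in> R" shows "\<exists>w\<in>W. \<exists>i\<in>I. \<alpha> = w (al i)"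
proof -
  have pos: "\<exists>w\<in>W. \<exists>i\<in>I. \<alpha> = w (al i)" if "\<alpha> \<in> Rp" for \<alpha>
    using that
  proof (induction "nat (B (rho D) \<alpha>)" arbitrary: \<alpha> rule: less_induct)
    case less
    obtain c j where e: "\<And>x. B x \<alpha> = (\<Sum>i\<in>I. int (c i) * B x (al i))" using B_pos_root_expand[OF less.prems] by metis
    have "\<exists>i\<in>I. ip (al i) \<alpha> > 0"
    proof (rule ccontr)
      assume "\<not> ?thesis"
      then have "B \<alpha> (al i) \<le> 0" if "i \<in> I" for i using that B_sgn(2) simple_root by (meson not_less)
      then have "B \<alpha> \<alpha> \<le> 0" unfolding e[of \<alpha>] by (intro sum_nonpos mult_nonneg_nonpos) auto
      then show False using B_root_pos pos_root less.prems by force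
    qed
    then obtain i where i: "i \<in> I" "ip (al i) \<alpha> > 0" by blast
    show ?case
    proof (cases "\<alpha> = al i")
      case True then show ?thesis using i by (intro bexI[OF _ W_id] bexI[OF _ i(1)]) simp
    next
      case False
      let ?b = "rf (al i) \<alpha>"
      have b: "?b \<in> Rp" using simple_perm i False less.prems by blast
      have "B (rho D) (al i) > 0" using B_sgn(2) simple_root i by (simp add: coroot_rho)
      then have "B (rho D) ?b < B (rho D) \<alpha>"
        using i by (simp add: reflect_def B_diff_right B_zmul_right)
      moreover have "B (rho D) \<alpha> > 0" using B_sgn(2) pos_root rho_pos less.prems by blast
      ultimately have "\<exists>w\<in>W. \<exists>k\<in>I. ?b = w (al k)" using less.hyps b by simp
      then obtain w k where w: "w \<in> W" "k \<in> I" "?b = w (al k)" by blast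
      have "\<alpha> = (rf (al i) \<circ> w) (al k)" using i w(3) reflect_reflect simple_root by (metis comp_apply)
      then show ?thesis using W_comp W_simple i w by blast
    qed
  qed
  show ?thesis
  proof (cases "\<alpha> \<in> Rp")
    case False
    then obtain w i where w: "w \<in> W" "i \<in> I" "- \<alpha> = w (al i)" using pos pos_or_neg assms by blast
    have "\<alpha> = - w (al i)" using w(3) by (metis minus_minus)
    also have "\<dots> = (w \<circ> rf (al i)) (al i)" using w by (simp add: reflect_self simple_root W_neg)
    finally show ?thesis using W_comp W_simple w by blast
  qed (use pos in blast)
qed

lemma reflect_in_W: assumes "\<alpha> \<in> R" shows "rf \<alpha> \<in> W"
proof -
  obtain w i where w: "w \<in> W" "i \<in> I" "\<alpha> = w (al i)" using W_reflect[OF assms] by blast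
  have "rf \<alpha> x = (w \<circ> rf (al i) \<circ> inv w) x" for x
    using w reflect_W[OF w(1) simple_root[OF w(2)], of "inv w x"] by (simp add: W_inv_right)
  then have "rf \<alpha> = w \<circ> rf (al i) \<circ> inv w" by blast
  then show ?thesis using W_comp W_inv W_simple w by metis
qed

lemma right_op_shift_pair: assumes "snd y \<in> W"
  shows "lin (right_op b d) (string_sum (shift_pair i) k y) =
    string_sum (shift_pair i) k (fst y - zmul d (snd y b), snd y \<circ> rf b) - smul (hecke_par * of_int (neg_ind (snd y b))) (string_sum (shift_pair i) k y)"
  by (rule lin_gstr2) (use assms in \<open>simp add: right_op_def shift_pair_def algebra_simps\<close>)

text \<open>w b and its image after the reflection have opposite signs, so exactly one of the two
  applications produces the correction.\<close>

lemma right_op_square: assumes as: "affine_simple b d" and y: "snd y \<in> W"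
  shows "lin (right_op b d) (right_op b d y) = ket0 y - smul hecke_par (right_op b d y)"
proof -
  have b: "b \<in> R" using as by (simp add: affine_simple_def)
  obtain m w where yw: "y = (m, w)" by (cases y)
  have w: "w \<in> W" using y yw by simp
  have "w \<circ> rf b \<circ> rf b = w" using b by (auto simp: fun_eq_iff reflect_reflect)
  moreover have "w (rf b b) = - w b" using b w by (simp add: reflect_self W_neg)
  moreover have "neg_ind (- w b) = 1 - neg_ind (w b)" using neg_ind_neg W_root w b by blast
  moreover have "w \<circ> rf b \<in> W" using W_comp w reflect_in_W b by blast
  moreover have "neg_ind (w b) = 0 \<or> neg_ind (w b) = 1" by (simp add: neg_ind_def)
  ultimately show ?thesis using w
    by (elim disjE) (simp_all add: yw right_op_def lin_diff lin_smul lin_ket0 K.scale_right_diff_distrib algebra_simps)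
qed

text \<open>Here left and right reflection coincide, s_i w = w s_b. On one side the string is
  shorter by one ket, and that ket is the correction term of the right operator on the other
  side.\<close>

lemma left_op_right_op_pos:
  assumes as: "affine_simple b d" and i: "i \<in> I" and w: "w \<in> W" and wb: "w b = al i"
  shows "lin (left_op i) (right_op b d (m, w)) = lin (right_op b d) (left_op i (m, w))"
proof -
  have b: "b \<in> R" and nb: "neg_ind b = d" using as by (auto simp: affine_simple_def)
  have r: "al i \<in> R" using i simple_root by blast
  have wr: "w \<circ> rf b = rf (al i) \<circ> w" using reflect_W[OF w b] by (auto simp: fun_eq_iff wb)
  have iw: "inv w (al i) = b" using W_inv_left[OF w] wb by metis
  have W2: "rf (al i) \<circ> w \<in> W" using W_comp W_simple i w by blast
  have iw2: "inv (rf (al i) \<circ> w) (al i) = - b"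
    using inv_comp_W[OF W_simple[OF i] w] r W_inv[OF w] by (simp add: inv_reflect reflect_self W_neg iw)
  have ng1: "neg_ind (al i) = 0" "neg_ind (- al i) = 1" using simple_pos[OF i] pos_not_neg by (auto simp: neg_ind_def)
  have ngb: "neg_ind (- b) = 1 - d" using neg_ind_neg[OF b] nb by simp
  let ?n = "ip (al i) m" and ?y2 = "(m - zmul d (al i), rf (al i) \<circ> w)"
  have R1: "right_op b d (m, w) = ket0 ?y2" using w by (simp add: right_op_def wb wr ng1)
  have k: "ip (al i) (m - zmul d (al i)) - neg_ind (- b) = ?n - d - 1" using r by (simp add: coroot_lin ngb)
  have L1: "lin (left_op i) (right_op b d (m, w)) = ket0 (rf (al i) m + zmul d (al i), w)
      + smul hecke_par (string_sum (shift_pair i) (?n - d - 1) ?y2)"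
    using W2 r unfolding R1 lin_ket0
    by (simp add: left_op_def iw2 k reflect_diff reflect_zmul reflect_self) (simp add: reflect_reflect comp_def)
  have L2: "left_op i (m, w) = ket0 (rf (al i) m, rf (al i) \<circ> w) + smul hecke_par (string_sum (shift_pair i) (?n - d) (m, w))"
    using w by (simp add: left_op_def iw nb)
  have e1: "rf (al i) \<circ> w \<circ> rf b = w" using wr r b by (auto simp: fun_eq_iff reflect_reflect)
  have R2: "right_op b d (rf (al i) m, rf (al i) \<circ> w) = ket0 (rf (al i) m + zmul d (al i), w)
      - smul hecke_par (ket0 (rf (al i) m, rf (al i) \<circ> w))"
    using W2 r e1 by (simp add: right_op_def wb reflect_self ng1 comp_def)
  have R3: "lin (right_op b d) (string_sum (shift_pair i) (?n - d) (m, w)) = string_sum (shift_pair i) (?n - d) ?y2"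
    using right_op_shift_pair[of "(m, w)" b d i "?n - d"] w by (simp add: wb wr ng1)
  have G: "string_sum (shift_pair i) (?n - d) ?y2 = string_sum (shift_pair i) (?n - d - 1) ?y2 + ket0 (rf (al i) m, rf (al i) \<circ> w)"
    using string_sum_step[of "shift_pair i" "?n - d - 1" ?y2]
    by (simp add: shift_pair_def reflect_def Z.scale_left_diff_distrib)
  show ?thesis unfolding L1 unfolding L2 lin_add lin_smul lin_ket0 R2 R3 G
    by (simp add: K.scale_right_distrib)
qed

text \<open>The operators interact only when w b is \<alpha>_i or its negative; otherwise the two
  corrections are independent.\<close>

lemma left_op_right_op: assumes as: "affine_simple b d" and i: "i \<in> I"
  shows "lin (left_op i) (right_op b d y) = lin (right_op b d) (left_op i y)"
proof -
  obtain m w where y: "y = (m, w)" by (cases y)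
  have b: "b \<in> R" using as by (simp add: affine_simple_def)
  have r: "al i \<in> R" using i simple_root by blast
  consider "w \<notin> W" | "w \<in> W" "w b = al i" | "w \<in> W" "w b = - al i" | "w \<in> W" "w b \<noteq> al i" "w b \<noteq> - al i" by blast
  then show ?thesis
  proof cases
    case 1 then show ?thesis by (simp add: y left_op_def right_op_def lin_0)
  next
    case 2 then show ?thesis using left_op_right_op_pos[OF as i] y by simp
  next
    case 3
    \<comment> \<open>The partner of y under the right reflection falls under the positive case, and
      the quadratic relation carries the identity back to y.\<close>
    let ?y = "(m - zmul d (w b), w \<circ> rf b)"
    have W2: "w \<circ> rf b \<in> W" using W_comp 3 reflect_in_W b by blast
    have wb: "(w \<circ> rf b) b = al i" using 3 b by (simp add: reflect_self W_neg)
    have yy: "(fst ?y - zmul d (snd ?y b), snd ?y \<circ> rf b) = y"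
      using 3 b y wb by (auto simp: fun_eq_iff reflect_reflect)
    have "right_op b d ?y = ket0 y"
      using W2 yy wb simple_pos[OF i] by (simp add: right_op_def neg_ind_def del: comp_apply)
    then have 1: "lin (right_op b d) (left_op i ?y) = left_op i y"
      by (simp only: left_op_right_op_pos[OF as i W2 wb, symmetric] lin_ket0)
    have ng1: "neg_ind (w b) = 1" using 3 simple_pos[OF i] pos_not_neg by (auto simp: neg_ind_def)
    have Ry: "right_op b d y = ket0 ?y - smul hecke_par (ket0 y)" using 3 y by (simp add: right_op_def ng1[unfolded 3])
    have sq: "lin (right_op b d) (lin (right_op b d) z) = z - smul hecke_par (lin (right_op b d) z)"
      if "\<forall>k\<in>ks z. snd k \<in> W" for z
    proof -
      have "lin (right_op b d) (lin (right_op b d) (\<Sum>k\<in>ks z. smul (lk z k) (ket0 k)))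
        = (\<Sum>k\<in>ks z. smul (lk z k) (ket0 k)) - smul hecke_par (lin (right_op b d) (\<Sum>k\<in>ks z. smul (lk z k) (ket0 k)))"
        using that by (simp add: lin_sum lin_smul lin_ket0 right_op_square[OF as] K.scale_right_diff_distrib
            sum_subtractf K.scale_sum_right mult.commute)
      then show ?thesis by (simp only: ket_expand)
    qed
    have "\<forall>k\<in>ks (left_op i ?y). snd k \<in> W"
    proof
      fix k assume k: "k \<in> ks (left_op i ?y)"
      show "snd k \<in> W"
      proof (rule ccontr)
        assume n: "snd k \<notin> W"
        have "rf (al i) \<circ> (w \<circ> rf b) \<in> W" using W2 W_comp W_simple i by blast
        then have "lk (left_op i ?y) k = 0" using W2 n
          by (auto simp: left_op_def lookup_add lookup_smul string_sum_def lookup_sum shift_pair_def lk_ket0 intro!: sum.neutral)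
        then show False using k by (simp add: in_keys_iff)
      qed
    qed
    from sq[OF this] have "lin (right_op b d) (left_op i y) = left_op i ?y - smul hecke_par (left_op i y)" by (simp only: 1)
    moreover have "lin (left_op i) (right_op b d y) = left_op i ?y - smul hecke_par (left_op i y)"
      unfolding Ry by (simp add: lin_diff lin_smul lin_ket0)
    ultimately show ?thesis by simp
  next
    case 4
    let ?g = "inv w (al i)"
    have g: "?g \<in> R" using W_inv W_root 4 r by blast
    have wg: "w ?g = al i" using W_inv_right 4 by blast
    have gb: "?g \<noteq> b" "?g \<noteq> - b" using wg 4 W_neg by (metis, metis minus_minus)
    have ngg: "neg_ind (rf b ?g) = neg_ind ?g - d * ip ?g b" using as g gb by (auto simp: affine_simple_def)
    have ipb: "ip (al i) (w b) = ip ?g b" using coroot_W_inv 4 r by blast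
    have W2: "w \<circ> rf b \<in> W" using W_comp 4 reflect_in_W b by blast
    have W3: "rf (al i) \<circ> w \<in> W" using W_comp 4 W_simple i by blast
    have i2: "inv (w \<circ> rf b) (al i) = rf b ?g"
      using inv_comp_W[OF 4(1) reflect_in_W[OF b]] b by (simp add: inv_reflect)
    let ?y2 = "(m - zmul d (w b), w \<circ> rf b)" and ?k = "ip (al i) m - neg_ind ?g"
    \<comment> \<open>This is what the condition in \<open>affine_simple\<close> is made for: the
      right reflection leaves the string length unchanged.\<close>
    have k2: "ip (al i) (m - zmul d (w b)) - neg_ind (rf b ?g) = ?k"
      using r by (simp add: coroot_lin ipb ngg)
    have n2: "neg_ind (rf (al i) (w b)) = neg_ind (w b)" using neg_ind_simple[OF i W_root[OF 4(1) b]] 4 by blast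
    have L: "left_op i y = ket0 (rf (al i) m, rf (al i) \<circ> w) + smul hecke_par (string_sum (shift_pair i) ?k y)"
      using 4 by (simp add: left_op_def y)
    have L2: "left_op i ?y2 = ket0 (rf (al i) (m - zmul d (w b)), rf (al i) \<circ> (w \<circ> rf b)) + smul hecke_par (string_sum (shift_pair i) ?k ?y2)"
      using W2 by (simp only: left_op_def fst_conv snd_conv i2 k2 if_True)
    have R: "right_op b d y = ket0 ?y2 - smul (hecke_par * of_int (neg_ind (w b))) (ket0 y)"
      using 4 by (simp add: right_op_def y)
    have R2: "right_op b d (rf (al i) m, rf (al i) \<circ> w) = ket0 (rf (al i) (m - zmul d (w b)), rf (al i) \<circ> (w \<circ> rf b))
      - smul (hecke_par * of_int (neg_ind (w b))) (ket0 (rf (al i) m, rf (al i) \<circ> w))"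
      using W3 r by (simp only: right_op_def fst_conv snd_conv if_True comp_apply n2 reflect_diff reflect_zmul o_assoc)
    have R3: "lin (right_op b d) (string_sum (shift_pair i) ?k y) = string_sum (shift_pair i) ?k ?y2 - smul (hecke_par * of_int (neg_ind (w b))) (string_sum (shift_pair i) ?k y)"
      using right_op_shift_pair[of y b d i ?k] 4 y by simp
    have "lin (left_op i) (right_op b d y) = left_op i ?y2 - smul (hecke_par * of_int (neg_ind (w b))) (left_op i y)"
      unfolding R by (simp add: lin_diff lin_smul lin_ket0)
    also have "\<dots> = right_op b d (rf (al i) m, rf (al i) \<circ> w) + smul hecke_par (lin (right_op b d) (string_sum (shift_pair i) ?k y))"
      unfolding L2 L R2 R3
      by (simp only: K.scale_right_distrib K.scale_right_diff_distrib K.scale_scale mult_ac) (simp add: algebra_simps)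
    also have "\<dots> = lin (right_op b d) (left_op i y)" unfolding L by (simp add: lin_add lin_smul lin_ket0)
    finally show ?thesis .
  qed
qed

text \<open>T_w along an arbitrary, not necessarily reduced word: a letter acts by T_i if it
  lengthens the element formed by the later letters, and by the inverse T_i +
  \<open>hecke_par\<close> if it shortens it.\<close>

fun word_op :: "(nat \<Rightarrow> ('b \<Rightarrow>\<^sub>0 laurent) \<Rightarrow> ('b \<Rightarrow>\<^sub>0 laurent)) \<Rightarrow> nat list \<Rightarrow> ('b \<Rightarrow>\<^sub>0 laurent) \<Rightarrow> ('b \<Rightarrow>\<^sub>0 laurent)" where
  "word_op T [] x = x"
| "word_op T (i # js) x = T i (word_op T js x)
     + smul (hecke_par * of_int (neg_ind (inv (word_prod D js) (al i)))) (word_op T js x)"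

abbreviation left_word where "left_word \<equiv> word_op (\<lambda>i. lin (left_op i))"

lemma word_op_add: "(\<And>i x y. T i (x + y) = T i x + T i y) \<Longrightarrow> word_op T js (x + y) = word_op T js x + word_op T js y"
  by (induction js) (simp_all add: K.scale_right_distrib algebra_simps)

lemma word_op_smul: "(\<And>i c x. T i (smul c x) = smul c (T i x)) \<Longrightarrow> word_op T js (smul c x) = smul c (word_op T js x)"
  by (induction js) (simp_all add: K.scale_right_distrib mult.commute)

lemma lin_commute: "(\<And>y. lin f (g y) = lin g (f y)) \<Longrightarrow> lin f (lin g x) = lin g (lin f x)"
proof -
  assume a: "\<And>y. lin f (g y) = lin g (f y)"
  have "lin f (lin g (\<Sum>k\<in>ks x. smul (lk x k) (ket0 k))) = lin g (lin f (\<Sum>k\<in>ks x. smul (lk x k) (ket0 k)))"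
    by (simp add: lin_sum lin_smul lin_ket0 a)
  then show ?thesis by (simp only: ket_expand)
qed

lemma left_word_right_op: assumes as: "affine_simple b d" and js: "set js \<subseteq> I"
  shows "left_word js (lin (right_op b d) x) = lin (right_op b d) (left_word js x)"
  using js by (induction js) (auto simp: lin_add lin_smul intro!: lin_commute left_op_right_op[OF as])

text \<open>The correction in \<open>word_op\<close> cancels the one in \<open>left_op\<close>. So
  the result on the identity vector depends only on the group element, which is the seed of
  independence of the word.\<close>

lemma left_word_id: "set js \<subseteq> I \<Longrightarrow> left_word js (ket0 (0, id)) = ket0 (0, word_prod D js)"
proof (induction js)
  case Nil show ?case by (simp only: word_op.simps word_prod_Nil)
next
  case (Cons i js)
  let ?w = "word_prod D js"
  have w: "?w \<in> W" and r: "al i \<in> R" using Cons.prems W_word simple_root by auto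
  have L: "left_word js (ket0 (0, id)) = ket0 (0, ?w)" by (rule Cons.IH) (use Cons.prems in simp)
  have "string_sum (shift_pair i) (- 1) (0, ?w) = - ket0 (0, ?w)"
    by (simp add: string_sum_def shift_pair_def zmul_0_left)
  then have "string_sum (shift_pair i) (- neg_ind (inv ?w (al i))) (0, ?w) = - smul (of_int (neg_ind (inv ?w (al i)))) (ket0 (0, ?w))"
    by (simp add: neg_ind_def string_sum_0)
  then have "left_op i (0, ?w) = ket0 (0, rf (al i) \<circ> ?w) - smul (hecke_par * of_int (neg_ind (inv ?w (al i)))) (ket0 (0, ?w))"
    using w r by (simp add: left_op_def coroot_0) (simp add: reflect_def coroot_0 zmul_0_left)
  then show ?case unfolding word_op.simps L lin_ket0 word_prod_Cons by (simp only: diff_add_cancel)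
qed

text \<open>Affine Weyl group elements as translation part and linear part, generated from the
  right. It is an inductive set since identities known at the identity are to be carried along right
  multiplication.\<close>

inductive_set reach :: "('a \<times> ('a \<Rightarrow> 'a)) set" where
  start: "(0, id) \<in> reach"
| move: "(m, w) \<in> reach \<Longrightarrow> w \<in> W \<Longrightarrow> affine_simple b d \<Longrightarrow> (m - zmul d (w b), w \<circ> rf b) \<in> reach"

text \<open>
  Both sides commute with the right operators, which generate the module from the vector at the
  identity; so it is enough to compare them there. This replaces the braid relations.
\<close>

lemma left_word_shift:
  assumes js: "set js \<subseteq> I" and ms: "set ms \<subseteq> I" and i: "i \<in> I"
    and e: "word_prod D ms = word_prod D js \<circ> rf (al i)" and y: "(m, w) \<in> reach"
  shows "left_word js (left_op i (m, w)) =
    left_word ms (ket0 (m, w)) - smul (hecke_par * of_int (neg_ind (word_prod D js (al i)))) (left_word js (ket0 (m, w)))"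
  using y
proof (induction rule: reach.induct)
  case start
  let ?w = "word_prod D js"
  have r: "al i \<in> R" using i simple_root by blast
  have as: "affine_simple (al i) 0" using affine_simple_simple i by blast
  have ii: "inv id (al i) = al i" by simp
  have n0: "neg_ind (al i) = 0" using i simple_pos by (simp add: neg_ind_def)
  have "left_op i (0, id) = ket0 (0, rf (al i))"
    unfolding left_op_def fst_conv snd_conv ii n0 using W_id r
    by (simp add: coroot_0 string_sum_0 del: id_apply) (simp add: reflect_def coroot_0 zmul_0_left)
  moreover have "right_op (al i) 0 (0, id) = ket0 (0, rf (al i))"
    unfolding right_op_def fst_conv snd_conv using W_id by (simp add: zmul_0_left n0)
  \<comment> \<open>At the identity, left and right multiplication by T_i agree, so T_i can be moved
    past the whole word to the right.\<close>
  ultimately have "left_word js (left_op i (0, id)) = left_word js (lin (right_op (al i) 0) (ket0 (0, id)))" by (simp only: lin_ket0)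
  also have "\<dots> = lin (right_op (al i) 0) (ket0 (0, ?w))" by (simp only: left_word_right_op[OF as js] left_word_id[OF js])
  also have "\<dots> = ket0 (0, ?w \<circ> rf (al i)) - smul (hecke_par * of_int (neg_ind (?w (al i)))) (ket0 (0, ?w))"
    using W_word[OF js] by (simp add: lin_ket0 right_op_def zmul_0_left)
  finally show ?case by (simp only: left_word_id[OF js] left_word_id[OF ms] e)
next
  case (move m w b d)
  let ?y = "(m, w)" and ?z = "(m - zmul d (w b), w \<circ> rf b)"
  let ?A = "\<lambda>x. left_word js (lin (left_op i) x)"
  let ?c = "hecke_par * of_int (neg_ind (word_prod D js (al i)))" and ?h = "hecke_par * of_int (neg_ind (w b))"
  let ?B = "\<lambda>x. left_word ms x - smul ?c (left_word js x)"
  have IH: "?A (ket0 ?y) = ?B (ket0 ?y)" using move.IH by (simp only: lin_ket0)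
  \<comment> \<open>The new basis vector is expressed by the right operator on the old one;
    everything in sight commutes with it.\<close>
  have z: "ket0 ?z = lin (right_op b d) (ket0 ?y) + smul ?h (ket0 ?y)" using move.hyps by (simp add: lin_ket0 right_op_def)
  have A: "?A (lin (right_op b d) x) = lin (right_op b d) (?A x)" for x
    by (simp add: lin_commute[OF left_op_right_op[OF move.hyps(3) i]] left_word_right_op[OF move.hyps(3) js])
  have Bc: "?B (lin (right_op b d) x) = lin (right_op b d) (?B x)" for x
    by (simp add: left_word_right_op[OF move.hyps(3) js] left_word_right_op[OF move.hyps(3) ms] lin_diff lin_smul)
  have "?A (ket0 ?z) = ?A (lin (right_op b d) (ket0 ?y)) + smul ?h (?A (ket0 ?y))"
    unfolding z by (simp only: lin_add lin_smul word_op_add word_op_smul)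
  also have "\<dots> = ?B (lin (right_op b d) (ket0 ?y)) + smul ?h (?B (ket0 ?y))" by (simp only: A Bc IH)
  also have "\<dots> = ?B (ket0 ?z)"
    unfolding z by (simp add: lin_add lin_smul word_op_add word_op_smul K.scale_right_distrib
        K.scale_right_diff_distrib mult.commute)
  finally show ?case by (simp only: lin_ket0)
qed

subsection \<open>Quasi-minuscule roots\<close>

lemma reflect_sym_zero: assumes "\<alpha> \<in> R" "\<beta> \<in> R" shows "ip \<alpha> \<beta> = 0 \<longleftrightarrow> ip \<beta> \<alpha> = 0"
  using B_root[OF assms(1), of \<beta>] B_root[OF assms(2), of \<alpha>] B_sym[of \<alpha> \<beta>]
    B_root_pos[OF assms(1)] B_root_pos[OF assms(2)] by auto

text \<open>A pairing outside 0 and 1 would allow a reflected coroot to exceed the maximum on y, or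
  to vanish on the regular y, except when \<gamma> and \<theta> pair to 2 both ways; then their
  coroots coincide.\<close>

lemma maximal_root:
  assumes y: "\<And>\<beta>. \<beta> \<in> Rp \<Longrightarrow> ip \<beta> y > 0" and t: "\<theta> \<in> Rp" and mx: "\<And>\<beta>. \<beta> \<in> Rp \<Longrightarrow> ip \<beta> y \<le> ip \<theta> y"
    and g: "\<gamma> \<in> Rp" "\<gamma> \<noteq> \<theta>"
  shows "ip \<gamma> \<theta> \<in> {0, 1}"
proof -
  have mxR: "ip \<beta> y \<le> ip \<theta> y" if "\<beta> \<in> R" for \<beta>
  proof (cases "\<beta> \<in> Rp")
    case False
    then have "- \<beta> \<in> Rp" using pos_or_neg that by blast
    then have "ip \<beta> y < 0" using y[of "- \<beta>"] that by (simp add: coroot_neg_root)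
    then show ?thesis using y[OF t] by simp
  qed (use mx in blast)
  have nzR: "ip \<beta> y \<noteq> 0" if "\<beta> \<in> R" for \<beta>
    using y[of \<beta>] y[of "- \<beta>"] pos_or_neg[OF that] that by (force simp: coroot_neg_root)
  have rb: "ip (rf \<beta> \<delta>) y = ip \<delta> y - ip \<beta> y * ip \<delta> \<beta>" if "\<beta> \<in> R" "\<delta> \<in> R" for \<beta> \<delta>
    using that by (simp add: coroot_reflect) (simp add: reflect_def coroot_lin)
  have tR: "\<theta> \<in> R" using t pos_root by blast
  have key: "ip \<delta> \<tau> = 2 \<and> ip \<delta> y = ip \<tau> y"
    if tau: "\<tau> \<in> Rp" "ip \<tau> y = ip \<theta> y" and d: "\<delta> \<in> Rp" "ip \<delta> \<tau> \<ge> 2" for \<delta> \<tau>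
  proof -
    let ?c = "ip \<delta> \<tau>"
    have R: "\<tau> \<in> R" "\<delta> \<in> R" using tau d pos_root by auto
    have "ip (- rf \<tau> \<delta>) y \<le> ip \<theta> y" using mxR neg_root reflect_root R by blast
    then have "ip \<tau> y * ?c - ip \<delta> y \<le> ip \<theta> y" using R by (simp add: coroot_neg_root reflect_root rb)
    moreover have "ip \<delta> y \<le> ip \<theta> y" using mx d by blast
    moreover have p: "ip \<tau> y > 0" using y tau by blast
    moreover have "\<not> ?c \<ge> 3"
    proof
      assume "?c \<ge> 3"
      then have "ip \<tau> y * 3 \<le> ip \<tau> y * ?c" using p by (intro mult_left_mono) auto
      then show False using calculation tau(2) by linarith
    qed
    then have "?c = 2" using d by linarith
    ultimately show ?thesis using tau(2) by simp
  qed
  have gR: "\<gamma> \<in> R" using g pos_root by blast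
  have "ip \<gamma> \<theta> \<ge> 0"
  proof (rule ccontr)
    assume n: "\<not> ?thesis"
    have "ip (rf \<theta> \<gamma>) y \<le> ip \<theta> y" using mxR reflect_root tR gR by blast
    then have "ip \<gamma> y - ip \<theta> y * ip \<gamma> \<theta> \<le> ip \<theta> y" using rb tR gR by simp
    moreover have "ip \<theta> y * ip \<gamma> \<theta> \<le> ip \<theta> y * (- 1)" using n y[OF t] by (intro mult_left_mono) auto
    ultimately show False using y[OF g(1)] by simp
  qed
  moreover have "\<not> ip \<gamma> \<theta> \<ge> 2"
  proof
    assume c: "ip \<gamma> \<theta> \<ge> 2"
    have c2: "ip \<gamma> \<theta> = 2" and gy: "ip \<gamma> y = ip \<theta> y" using key[OF t refl g(1) c] by auto
    have "ip \<theta> \<gamma> > 0"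
      using B_root[OF tR, of \<gamma>] B_root[OF gR, of \<theta>] c B_root_pos[OF tR] B_root_pos[OF gR] B_sym[of \<gamma> \<theta>]
      by (smt (verit) mult_nonpos_nonneg zero_less_mult_iff)
    moreover have "ip \<theta> \<gamma> \<noteq> 1"
    proof
      assume "ip \<theta> \<gamma> = 1"
      then have "ip (rf \<gamma> \<theta>) y = 0" using rb[OF gR tR] gy by simp
      then show False using nzR reflect_root gR tR by blast
    qed
    ultimately have "ip \<theta> \<gamma> \<ge> 2" by simp
    then have c2': "ip \<theta> \<gamma> = 2" using key[OF g(1) gy t] by simp
    \<comment> \<open>The difference has norm 0, so every coroot vanishes on it. This makes \<theta>
      and \<gamma> have equal coroots, and coroots determine roots.\<close>
    have "B (\<theta> - \<gamma>) \<gamma> = 0" "B (\<theta> - \<gamma>) \<theta> = 0"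
      using B_root[OF gR, of "\<theta> - \<gamma>"] B_root[OF tR, of "\<theta> - \<gamma>"] gR tR c2 c2'
      by (simp_all add: coroot_diff coroot_self)
    then have "B (\<theta> - \<gamma>) (\<theta> - \<gamma>) = 0" by (simp add: B_diff_right)
    then have z: "ip \<alpha> (\<theta> - \<gamma>) = 0" if "\<alpha> \<in> R" for \<alpha>
      using that finite_R unfolding B_def by (subst (asm) sum_nonneg_eq_0_iff) auto
    have Beq: "B x \<theta> = B x \<gamma>" for x
    proof -
      have "B x (\<theta> - \<gamma>) = 0" unfolding B_def using z by simp
      then show ?thesis by (simp add: B_diff_right)
    qed
    have "ip \<theta> x = ip \<gamma> x" for x
    proof -
      have "ip \<theta> x * B \<theta> \<theta> = ip \<gamma> x * B \<gamma> \<gamma>" using B_root[OF tR, of x] B_root[OF gR, of x] Beq by simp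
      moreover have "B \<theta> \<theta> = B \<gamma> \<gamma>" using Beq B_sym by metis
      ultimately show ?thesis using B_root_pos[OF gR] by simp
    qed
    then have "\<theta> = \<gamma>" using inj_coroot tR gR by (auto simp: inj_on_def fun_eq_iff)
    then show False using g by simp
  qed
  ultimately show ?thesis by auto
qed

text \<open>If <\<theta>, \<gamma>^v> = 1, then s_\<theta> \<gamma> pairs with \<theta> to - 1,
  which no positive root does; so it is negative, as required of the affine reflection.\<close>

lemma affine_simple_maximal:
  assumes t: "\<theta> \<in> Rp" and q: "\<And>\<gamma>. \<gamma> \<in> Rp \<Longrightarrow> \<gamma> \<noteq> \<theta> \<Longrightarrow> ip \<gamma> \<theta> \<in> {0, 1}"
  shows "affine_simple (- \<theta>) 1"
proof -
  have tR: "\<theta> \<in> R" using t pos_root by blast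
  have P: "neg_ind (rf \<theta> \<gamma>) = neg_ind \<gamma> + ip \<gamma> \<theta>" if g: "\<gamma> \<in> Rp" "\<gamma> \<noteq> \<theta>" for \<gamma>
  proof (cases "ip \<gamma> \<theta> = 0")
    case True
    then have "ip \<theta> \<gamma> = 0" using reflect_sym_zero tR pos_root g by blast
    then show ?thesis using True by (simp add: reflect_def zmul_0_left)
  next
    case False
    then have 1: "ip \<gamma> \<theta> = 1" using q g by blast
    have "rf \<theta> \<gamma> \<notin> Rp"
    proof
      assume p: "rf \<theta> \<gamma> \<in> Rp"
      have "ip (rf \<theta> \<gamma>) \<theta> = - 1" using tR g pos_root 1 by (simp add: coroot_reflect reflect_self coroot_neg)
      moreover have "rf \<theta> \<gamma> \<noteq> \<theta>" using calculation tR coroot_self by force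
      ultimately show False using q[OF p] by simp
    qed
    then show ?thesis using g 1 by (simp add: neg_ind_def)
  qed
  have "neg_ind (rf (- \<theta>) \<gamma>) = neg_ind \<gamma> - 1 * ip \<gamma> (- \<theta>)" if g: "\<gamma> \<in> R" "\<gamma> \<noteq> - \<theta>" "\<gamma> \<noteq> - (- \<theta>)" for \<gamma>
  proof (cases "\<gamma> \<in> Rp")
    case True then show ?thesis using P[of \<gamma>] g tR by (simp add: reflect_neg_root coroot_neg)
  next
    case False
    then have n: "- \<gamma> \<in> Rp" "- \<gamma> \<noteq> \<theta>" using pos_or_neg g by auto
    then have "neg_ind (- rf \<theta> \<gamma>) = neg_ind (- \<gamma>) - ip \<gamma> \<theta>" using P[OF n] tR g by (simp add: reflect_neg coroot_neg_root)
    then show ?thesis using tR g by (simp add: neg_ind_neg reflect_root reflect_neg_root coroot_neg)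
  qed
  moreover have "neg_ind (- \<theta>) = 1" using t pos_not_neg by (simp add: neg_ind_def)
  ultimately show ?thesis using tR neg_root unfolding affine_simple_def by blast
qed

text \<open>A reducible system has several such \<theta>, so no single one is fixed; what matters is
  that one of them bounds all pairings with x.\<close>

lemma quasi_minuscule_exists:
  assumes x: "\<And>i. i \<in> I \<Longrightarrow> ip (al i) x \<ge> 0" and b: "\<beta> \<in> Rp"
  shows "\<exists>\<theta>\<in>Rp. affine_simple (- \<theta>) 1 \<and> ip \<beta> x \<le> ip \<theta> x"
proof -
  \<comment> \<open>\<open>n\<close> exceeds every <\<rho>, \<alpha>^v>: maximizing on n x + \<rho>
    then maximizes on x first, while \<rho> makes the weight regular.\<close>
  define n where "n = 1 + (\<Sum>\<alpha>\<in>Rp. ip \<alpha> (rho D))"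
  have rn: "ip \<alpha> (rho D) < n" if "\<alpha> \<in> Rp" for \<alpha>
  proof -
    have "ip \<alpha> (rho D) \<le> (\<Sum>\<alpha>\<in>Rp. ip \<alpha> (rho D))"
      by (rule member_le_sum) (use that rho_pos finite_Rp less_imp_le in auto)
    then show ?thesis by (simp add: n_def)
  qed
  have n0: "n > 0" using rn[OF b] rho_pos[OF b] by simp
  let ?y = "zmul n x + rho D"
  have yy: "ip \<alpha> ?y = n * ip \<alpha> x + ip \<alpha> (rho D)" if "\<alpha> \<in> Rp" for \<alpha>
    using that pos_root by (simp add: coroot_add coroot_zmul)
  have y: "ip \<alpha> ?y > 0" if "\<alpha> \<in> Rp" for \<alpha>
    using yy[OF that] dom_pos[OF x that] rho_pos[OF that] n0 by (simp add: add_nonneg_pos)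
  have fin: "finite ((\<lambda>\<alpha>. ip \<alpha> ?y) ` Rp)" and ne: "(\<lambda>\<alpha>. ip \<alpha> ?y) ` Rp \<noteq> {}" using finite_Rp b by auto
  obtain \<theta> where t: "\<theta> \<in> Rp" "ip \<theta> ?y = Max ((\<lambda>\<alpha>. ip \<alpha> ?y) ` Rp)" using Max_in[OF fin ne] by (metis (no_types, lifting) imageE)
  have mx: "ip \<alpha> ?y \<le> ip \<theta> ?y" if "\<alpha> \<in> Rp" for \<alpha> using t(2) fin that by simp
  have "affine_simple (- \<theta>) 1"
    using affine_simple_maximal[OF t(1)] maximal_root[OF y t(1) mx] by blast
  moreover have "ip \<beta> x \<le> ip \<theta> x"
  proof (rule ccontr)
    assume "\<not> ?thesis"
    then have "n * (ip \<theta> x + 1) \<le> n * ip \<beta> x" using n0 by simp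
    moreover have "n * ip \<beta> x + ip \<beta> (rho D) \<le> n * ip \<theta> x + ip \<theta> (rho D)" using mx[OF b] yy b t(1) by simp
    ultimately show False using rn[OF t(1)] rho_pos[OF b] by (simp add: algebra_simps)
  qed
  ultimately show ?thesis using t(1) by blast
qed

lemma reach_W: assumes v: "(m, v) \<in> reach" "v \<in> W" and w: "w \<in> W" shows "(m, w) \<in> reach"
proof -
  have "(m, v \<circ> word_prod D js) \<in> reach" if "set js \<subseteq> I" for js
    using that
  proof (induction js rule: rev_induct)
    case Nil show ?case using v by (simp only: word_prod_Nil comp_id)
  next
    case (snoc i js)
    have i: "i \<in> I" and js: "set js \<subseteq> I" using snoc.prems by auto
    have "(m - zmul 0 ((v \<circ> word_prod D js) (al i)), v \<circ> word_prod D js \<circ> rf (al i)) \<in> reach"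
      using snoc.IH[OF js] W_comp[OF v(2) W_word[OF js]] affine_simple_simple[OF i] by (rule reach.move)
    then show ?case
      by (simp only: zmul_0_left word_prod_append word_prod_Cons word_prod_Nil o_assoc diff_zero comp_id)
  qed
  moreover obtain js where "set js \<subseteq> I" "inv v \<circ> w = word_prod D js"
    using W_comp[OF W_inv[OF v(2)] w] by (auto simp: weyl_group_I)
  ultimately have "(m, v \<circ> (inv v \<circ> w)) \<in> reach" by metis
  moreover have "v \<circ> (inv v \<circ> w) = w" using v by (auto simp: fun_eq_iff W_inv_right)
  ultimately show ?thesis by simp
qed

text \<open>A translate of minimal norm lies in the closed fundamental alcove, up to the Weyl group.\<close>

lemma alcove_decomposition:
  fixes l :: nat
  assumes l: "l > 0"
  shows "\<exists>x0 w m. (m, w) \<in> reach \<and> w \<in> W \<and> z = w x0 + zmul (int l) m \<and> (\<forall>\<beta>\<in>Rp. 0 \<le> ip \<beta> x0 \<and> ip \<beta> x0 \<le> int l)"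
proof -
  let ?P = "\<lambda>m. (m, id) \<in> reach"
  obtain m where m: "?P m" and mn: "\<And>m'. ?P m' \<Longrightarrow> Q (z - zmul (int l) m) \<le> Q (z - zmul (int l) m')"
    using ex_has_least_nat[of ?P 0 "\<lambda>m. Q (z - zmul (int l) m)"] reach.start by blast
  obtain v where v: "v \<in> W" and d: "\<And>i. i \<in> I \<Longrightarrow> ip (al i) (v (z - zmul (int l) m)) \<ge> 0"
    using dominant_conj by blast
  let ?x = "v (z - zmul (int l) m)"
  have le: "ip \<beta> ?x \<le> int l" if b: "\<beta> \<in> Rp" for \<beta>
  proof (rule ccontr)
    assume n: "\<not> ?thesis"
    obtain \<theta> where t: "\<theta> \<in> Rp" "affine_simple (- \<theta>) 1" "ip \<beta> ?x \<le> ip \<theta> ?x"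
      using quasi_minuscule_exists[OF d b] by blast
    have u: "inv v \<in> W" using W_inv v by blast
    have "(m, inv v) \<in> reach" by (rule reach_W[OF m W_id u])
    \<comment> \<open>The affine reflection attached to - \<theta> translates by \<theta>, seen
      through the inverse of v. The new translate would be shorter.\<close>
    from reach.move[OF this u t(2)] have r: "(m + inv v \<theta>, inv v \<circ> rf (- \<theta>)) \<in> reach"
      using u by (simp add: zmul_1_left W_neg)
    have "inv v \<circ> rf (- \<theta>) \<in> W" using u W_comp reflect_in_W neg_root pos_root t(1) by blast
    then have "?P (m + inv v \<theta>)" using reach_W[OF r _ W_id] by blast
    from mn[OF this] have "Q ?x \<le> Q (v (z - zmul (int l) (m + inv v \<theta>)))" using Q_W v by metis
    also have "v (z - zmul (int l) (m + inv v \<theta>)) = ?x - zmul (int l) \<theta>"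
      using v by (simp add: W_diff W_zmul zmul_add_right W_add W_inv_right algebra_simps)
    also have "Q (?x - zmul (int l) \<theta>) < Q ?x"
      by (rule Q_string) (use pos_root t n l in auto)
    finally show False by simp
  qed
  have "(m, inv v) \<in> reach" by (rule reach_W[OF m W_id W_inv[OF v]])
  moreover have "z = inv v ?x + zmul (int l) m" using v by (simp add: W_inv_left)
  ultimately show ?thesis using le dom_pos[OF d] W_inv[OF v] by blast
qed

end

context fock
begin

subsection \<open>Hecke operators on the free module\<close>

definition shift_weight :: "nat \<Rightarrow> int \<Rightarrow> 'a \<Rightarrow> 'a" where "shift_weight i p y = y - zmul (p * int l) (al i)"

lemma shift_weight_shift_weight: "shift_weight i p (shift_weight i q y) = shift_weight i (q + p) y"
  by (simp add: shift_weight_def distrib_right zmul_add_left algebra_simps)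

definition wall_factor :: "nat \<Rightarrow> 'a \<Rightarrow> laurent" where
  "wall_factor i y = (if int l dvd pr i y then th (- 1) else 1)"

text \<open>The Demazure-Lusztig operator on kets, with steps of l \<alpha>_i. The factor t^(-1/2)
  on walls makes a ket fixed by s_i an eigenvector of eigenvalue t^(-1/2).\<close>

definition weight_op :: "nat \<Rightarrow> 'a \<Rightarrow> ('a \<Rightarrow>\<^sub>0 laurent)" where
  "weight_op i y = smul (wall_factor i y) (e (sd i y)) + smul hecke_par (string_sum (shift_weight i) (pr i y div int l) y)"

definition inversions :: "('a \<Rightarrow> 'a) \<Rightarrow> 'a set" where "inversions w = {\<alpha> \<in> Rp. - w \<alpha> \<in> Rp}"

lemma inversions_left:
  assumes w: "w \<in> W" and i: "i \<in> I" and g: "inv w (al i) \<in> Rp"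
  shows "inversions (rf (al i) \<circ> w) = insert (inv w (al i)) (inversions w)" and "inv w (al i) \<notin> inversions w"
proof -
  let ?g = "inv w (al i)"
  have wg: "w ?g = al i" using W_inv_right w by blast
  have r: "al i \<in> R" using i simple_root by blast
  show "?g \<notin> inversions w" using wg simple_pos[OF i] pos_not_neg by (auto simp: inversions_def)
  show "inversions (rf (al i) \<circ> w) = insert ?g (inversions w)"
  proof (intro set_eqI iffI)
    fix \<alpha> assume "\<alpha> \<in> inversions (rf (al i) \<circ> w)"
    then have a: "\<alpha> \<in> Rp" "- rf (al i) (w \<alpha>) \<in> Rp" by (auto simp: inversions_def)
    show "\<alpha> \<in> insert ?g (inversions w)"
    proof (cases "w \<alpha> \<in> Rp")
      case True
      then have "w \<alpha> = al i" using simple_perm[OF i True] a pos_not_neg by blast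
      then have "\<alpha> = ?g" using W_inv_left[OF w] by metis
      then show ?thesis by simp
    next
      case False
      then show ?thesis using a pos_W_cases w pos_root by (auto simp: inversions_def)
    qed
  next
    fix \<alpha> assume a: "\<alpha> \<in> insert ?g (inversions w)"
    show "\<alpha> \<in> inversions (rf (al i) \<circ> w)"
    proof (cases "\<alpha> = ?g")
      case True
      then show ?thesis using g wg r simple_pos[OF i] by (simp add: inversions_def reflect_self)
    next
      case False
      then have n: "\<alpha> \<in> Rp" "- w \<alpha> \<in> Rp" using a by (auto simp: inversions_def)
      have "- w \<alpha> \<noteq> al i"
      proof
        assume "- w \<alpha> = al i"
        then have "w (- \<alpha>) = w ?g" using w wg by (simp add: W_neg)
        then have "- \<alpha> = ?g" using W_eq_iff w by blast
        then show False using n g pos_not_neg by metis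
      qed
      then have "rf (al i) (- w \<alpha>) \<in> Rp" using simple_perm i n by blast
      then show ?thesis using n r by (simp add: inversions_def reflect_neg)
    qed
  qed
qed

text \<open>The case in which s_i shortens w is the lengthening case for s_i w, read
  backwards.\<close>

lemma inversions_sum_left:
  assumes w: "w \<in> W" and i: "i \<in> I"
  shows "(\<Sum>\<alpha>\<in>inversions (rf (al i) \<circ> w). f \<alpha>) =
    (if inv w (al i) \<in> Rp then (\<Sum>\<alpha>\<in>inversions w. f \<alpha>) + f (inv w (al i))
     else (\<Sum>\<alpha>\<in>inversions w. f \<alpha>) - (f (- inv w (al i)) :: int))"
proof -
  have fin: "finite (inversions v)" for v using finite_Rp by (simp add: inversions_def)
  have r: "al i \<in> R" using i simple_root by blast
  show ?thesis
  proof (cases "inv w (al i) \<in> Rp")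
    case True
    then show ?thesis using inversions_left[OF w i True] fin by simp
  next
    case False
    let ?v = "rf (al i) \<circ> w"
    have v: "?v \<in> W" using W_comp W_simple w i by blast
    have iv: "inv ?v (al i) = - inv w (al i)"
      using inv_comp_W[OF W_simple[OF i] w] r W_inv[OF w] by (simp add: inv_reflect reflect_self W_neg)
    have p: "inv ?v (al i) \<in> Rp" unfolding iv using False pos_or_neg W_root[OF W_inv[OF w] r] by blast
    have "rf (al i) \<circ> ?v = w" using r by (auto simp: fun_eq_iff reflect_reflect)
    then have "inversions w = insert (- inv w (al i)) (inversions ?v)" "- inv w (al i) \<notin> inversions ?v"
      using inversions_left[OF v i p] iv by simp_all
    then show ?thesis using False fin by simp
  qed
qed

text \<open>
  The regular module maps onto the span of the affine Weyl group orbit of any \<open>x\<close> in the closed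
  fundamental alcove. On the walls of level 0 and \<open>l\<close> through \<open>x\<close> the Hecke operators act by $t^{-1/2}$
  and $t^{1/2}$, which is the origin of the exponent.
\<close>

definition transport_exp :: "'a \<Rightarrow> ('a \<Rightarrow> 'a) \<Rightarrow> int" where
  "transport_exp x w = (\<Sum>\<alpha>\<in>inversions w. (if ip \<alpha> x = int l then 1 else 0) - (if ip \<alpha> x = 0 then 1 else 0))"

definition transport :: "'a \<Rightarrow> 'a \<times> ('a \<Rightarrow> 'a) \<Rightarrow> ('a \<Rightarrow>\<^sub>0 laurent)" where
  "transport x y = smul (th (transport_exp x (snd y))) (e (snd y x + zmul (int l) (fst y) - rho D))"

lemma hecke_par_th: "th (- 1) + hecke_par = th 1" by (simp add: hecke_par_def)

lemma div_add_mult: "0 \<le> r \<Longrightarrow> r < int l \<Longrightarrow> (int l * k + r) div int l = k"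
  using l_pos by (simp add: div_mult_self4 add.commute)

text \<open>The string lengths on both sides agree except when the root is positive and x lies on
  its wall of level l, or negative and x lies on its wall of level 0. The exponent in
  \<open>transport_exp\<close> balances the wall factors in every case.\<close>

lemma transport_left_op:
  assumes x: "\<And>\<beta>. \<beta> \<in> Rp \<Longrightarrow> 0 \<le> ip \<beta> x \<and> ip \<beta> x \<le> int l" and i: "i \<in> I" and w: "w \<in> W"
  shows "lin (transport x) (left_op i (m, w)) = lin (weight_op i) (transport x (m, w))"
proof -
  let ?g = "inv w (al i)" and ?y = "w x + zmul (int l) m - rho D"
  have r: "al i \<in> R" using i simple_root by blast
  have gR: "?g \<in> R" using W_inv W_root w r by blast
  let ?k = "ip (al i) m - neg_ind ?g" and ?v = "ip ?g x" and ?w2 = "rf (al i) \<circ> w"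
  have pry: "pr i ?y = int l * ip (al i) m + ?v"
    using r w by (simp add: pr_def coroot_add coroot_zmul coroot_W_inv)
  have sdy: "sd i ?y = ?w2 x + zmul (int l) (rf (al i) m) - rho D"
    using r by (simp flip: sd_dot add: dot_def reflect_add reflect_zmul)
  have A: "lin (transport x) (left_op i (m, w)) = smul (th (transport_exp x ?w2)) (e (sd i ?y)) + smul (th (transport_exp x w) * hecke_par) (string_sum (shift_weight i) ?k ?y)"
  proof -
    have "lin (transport x) (string_sum (shift_pair i) ?k (m, w)) = smul (th (transport_exp x w)) (string_sum (shift_weight i) ?k ?y)"
      by (rule lin_string_sum) (simp add: transport_def shift_pair_def shift_weight_def Z.scale_right_diff_distrib zmul_mult algebra_simps)
    moreover have "transport x (rf (al i) m, ?w2) = smul (th (transport_exp x ?w2)) (e (sd i ?y))"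
      unfolding sdy by (simp add: transport_def)
    ultimately show ?thesis using w by (simp add: left_op_def lin_add lin_smul lin_ket0 mult.commute)
  qed
  have Bq: "lin (weight_op i) (transport x (m, w)) = smul (th (transport_exp x w) * wall_factor i ?y) (e (sd i ?y))
      + smul (th (transport_exp x w) * hecke_par) (string_sum (shift_weight i) (pr i ?y div int l) ?y)"
    by (simp add: transport_def lin_smul lin_ket0 weight_op_def K.scale_right_distrib)
  have lower: ?thesis if "pr i ?y div int l = ?k" "th (transport_exp x ?w2) = th (transport_exp x w) * wall_factor i ?y"
    unfolding A Bq that ..
  \<comment> \<open>The string of kets has one term more, and it is the reflected ket: its
    coefficient rises from t^(-1/2) to t^(-1/2) + \<open>hecke_par\<close> = t^(1/2).\<close>
  have high: ?thesis if kk: "pr i ?y div int l = ?k + 1" and p: "pr i ?y = (?k + 1) * int l"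
    and t: "th (transport_exp x ?w2) = th (transport_exp x w) * th 1"
  proof -
    have "shift_weight i (?k + 1) ?y = sd i ?y" by (simp add: shift_weight_def sd_def p)
    then have "string_sum (shift_weight i) (?k + 1) ?y = string_sum (shift_weight i) ?k ?y + e (sd i ?y)" using string_sum_step[of "shift_weight i" ?k ?y] by simp
    moreover have "wall_factor i ?y = th (- 1)" by (simp add: wall_factor_def p)
    moreover have "smul (th (transport_exp x w) * th 1) (e (sd i ?y)) = smul (th (transport_exp x w) * th (- 1)) (e (sd i ?y)) + smul (th (transport_exp x w) * hecke_par) (e (sd i ?y))"
      by (simp flip: hecke_par_th add: distrib_left K.scale_left_distrib)
    ultimately show ?thesis unfolding A Bq kk t by (simp add: K.scale_right_distrib)
  qed
  let ?f = "\<lambda>v. (if v = int l then 1 else 0) - (if v = 0 then 1 else 0) :: int"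
  have t2: "transport_exp x ?w2 = (if ?g \<in> Rp then transport_exp x w + ?f ?v else transport_exp x w - ?f (- ?v))"
    unfolding transport_exp_def inversions_sum_left[OF w i] using gR by (simp add: coroot_neg_root)
  show ?thesis
  proof (cases "?g \<in> Rp")
    case True
    have n: "neg_ind ?g = 0" using True by (simp add: neg_ind_def)
    have v: "0 \<le> ?v" "?v \<le> int l" using x[OF True] by auto
    consider "?v = 0" | "0 < ?v" "?v < int l" | "?v = int l" using v by linarith
    then show ?thesis
    proof cases
      case 1
      show ?thesis
      proof (rule lower)
        show "pr i ?y div int l = ?k" using l_pos by (simp add: pry 1 n)
        show "th (transport_exp x ?w2) = th (transport_exp x w) * wall_factor i ?y" unfolding t2 using True 1 l_pos
          by (simp add: wall_factor_def pry flip: th_add)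
      qed
    next
      case 2
      show ?thesis
      proof (rule lower)
        show "pr i ?y div int l = ?k" using 2 div_add_mult[of ?v] by (simp add: pry n)
        have "\<not> int l dvd ?v" using 2 zdvd_not_zless by blast
        then have "\<not> int l dvd pr i ?y" unfolding pry by (simp add: dvd_add_right_iff)
        then show "th (transport_exp x ?w2) = th (transport_exp x w) * wall_factor i ?y" unfolding t2 using True 2
          by (simp add: wall_factor_def)
      qed
    next
      case 3
      show ?thesis
      proof (rule high)
        show "pr i ?y = (?k + 1) * int l" by (simp add: pry n 3 algebra_simps)
        then show "pr i ?y div int l = ?k + 1" using l_pos by simp
        show "th (transport_exp x ?w2) = th (transport_exp x w) * th 1" unfolding t2 using True 3 l_pos by (simp flip: th_add)
      qed
    qed
  next
    case False
    have n: "neg_ind ?g = 1" using False by (simp add: neg_ind_def)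
    have "- ?g \<in> Rp" using pos_or_neg gR False by blast
    then have v: "0 \<le> - ?v" "- ?v \<le> int l" using x[of "- ?g"] gR by (auto simp: coroot_neg_root)
    consider "?v = 0" | "- int l < ?v" "?v < 0" | "?v = - int l" using v by linarith
    then show ?thesis
    proof cases
      case 1
      show ?thesis
      proof (rule high)
        show "pr i ?y = (?k + 1) * int l" by (simp add: pry n 1)
        then show "pr i ?y div int l = ?k + 1" using l_pos by simp
        show "th (transport_exp x ?w2) = th (transport_exp x w) * th 1" unfolding t2 using False 1 l_pos by (simp flip: th_add)
      qed
    next
      case 2
      show ?thesis
      proof (rule lower)
        have "pr i ?y = int l * ?k + (?v + int l)" by (simp add: pry n algebra_simps)
        then show "pr i ?y div int l = ?k" using 2 div_add_mult[of "?v + int l" ?k] by simp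
        have "\<not> int l dvd - ?v" using 2 zdvd_not_zless[of "- ?v" "int l"] by simp
        then have "\<not> int l dvd pr i ?y" unfolding pry by (simp add: dvd_add_right_iff)
        then show "th (transport_exp x ?w2) = th (transport_exp x w) * wall_factor i ?y" unfolding t2 using False 2
          by (simp add: wall_factor_def)
      qed
    next
      case 3
      show ?thesis
      proof (rule lower)
        have p: "pr i ?y = ?k * int l" by (simp add: pry n 3 algebra_simps)
        then show "pr i ?y div int l = ?k" using l_pos by simp
        show "th (transport_exp x ?w2) = th (transport_exp x w) * wall_factor i ?y" unfolding t2 using False 3 l_pos
          by (simp add: wall_factor_def p flip: th_add)
      qed
    qed
  qed
qed

abbreviation weight_word where "weight_word \<equiv> word_op (\<lambda>i. lin (weight_op i))"

lemma weight_word_add: "weight_word js (x + y) = weight_word js x + weight_word js y"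
  and weight_word_smul: "weight_word js (smul c x) = smul c (weight_word js x)"
  by (simp_all add: word_op_add word_op_smul lin_add lin_smul)

text \<open>\<open>left_op\<close> is 0 on pairs outside W but \<open>transport\<close> is not, so
  the intertwining property is limited to this support.\<close>

definition Wsupp :: "('a \<times> ('a \<Rightarrow> 'a) \<Rightarrow>\<^sub>0 laurent) \<Rightarrow> bool" where
  "Wsupp z \<longleftrightarrow> (\<forall>k. snd k \<notin> W \<longrightarrow> lk z k = 0)"

lemma Wsupp_add: "Wsupp y \<Longrightarrow> Wsupp z \<Longrightarrow> Wsupp (y + z)"
  and Wsupp_smul: "Wsupp z \<Longrightarrow> Wsupp (smul c z)"
  by (simp_all add: Wsupp_def lookup_add lookup_smul)

lemma Wsupp_sum: "(\<And>a. a \<in> A \<Longrightarrow> Wsupp (f a)) \<Longrightarrow> Wsupp (sum f A)"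
  by (simp add: Wsupp_def lookup_sum)

lemma Wsupp_ket: "w \<in> W \<Longrightarrow> Wsupp (ket0 (m, w))"
  by (auto simp: Wsupp_def lk_ket0)

lemma Wsupp_left_op: assumes i: "i \<in> I" shows "Wsupp (left_op i y)"
proof (cases "snd y \<in> W")
  case True
  have "Wsupp (string_sum (shift_pair i) k y)" for k
  proof -
    have s: "Wsupp (ket0 (shift_pair i p y))" for p using True Wsupp_ket by (simp add: shift_pair_def)
    have n: "Wsupp (- z) = Wsupp z" for z :: "'a \<times> ('a \<Rightarrow> 'a) \<Rightarrow>\<^sub>0 laurent" by (simp add: Wsupp_def)
    show ?thesis by (simp add: string_sum_def n Wsupp_sum s)
  qed
  moreover have "Wsupp (ket0 (rf (al i) (fst y), rf (al i) \<circ> snd y))"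
    by (intro Wsupp_ket W_comp W_simple i True)
  ultimately show ?thesis using True by (simp add: left_op_def Wsupp_add Wsupp_smul del: comp_apply)
qed (simp add: left_op_def Wsupp_def)

lemma Wsupp_lin_left_op: "i \<in> I \<Longrightarrow> Wsupp (lin (left_op i) z)"
  unfolding lin_def by (intro Wsupp_sum Wsupp_smul Wsupp_left_op)

lemma Wsupp_left_word: "set js \<subseteq> I \<Longrightarrow> Wsupp z \<Longrightarrow> Wsupp (left_word js z)"
  by (induction js) (auto intro!: Wsupp_add Wsupp_smul Wsupp_lin_left_op)

lemma transport_lin_left_op:
  assumes x: "\<And>\<beta>. \<beta> \<in> Rp \<Longrightarrow> 0 \<le> ip \<beta> x \<and> ip \<beta> x \<le> int l" and i: "i \<in> I" and z: "Wsupp z"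
  shows "lin (transport x) (lin (left_op i) z) = lin (weight_op i) (lin (transport x) z)"
proof -
  have k: "lin (transport x) (left_op i k) = lin (weight_op i) (transport x k)" if "k \<in> ks z" for k
  proof -
    have "snd k \<in> W" using z that unfolding Wsupp_def in_keys_iff by blast
    then show ?thesis using transport_left_op[OF x i, of "snd k" "fst k"] by simp
  qed
  have "lin (transport x) (lin (left_op i) (\<Sum>k\<in>ks z. smul (lk z k) (ket0 k)))
    = lin (weight_op i) (lin (transport x) (\<Sum>k\<in>ks z. smul (lk z k) (ket0 k)))"
    using k by (simp add: lin_sum lin_smul lin_ket0)
  then show ?thesis by (simp only: ket_expand)
qed

lemma transport_left_word:
  assumes x: "\<And>\<beta>. \<beta> \<in> Rp \<Longrightarrow> 0 \<le> ip \<beta> x \<and> ip \<beta> x \<le> int l" and js: "set js \<subseteq> I" and z: "Wsupp z"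
  shows "lin (transport x) (left_word js z) = weight_word js (lin (transport x) z)"
  using js
proof (induction js)
  case (Cons i js)
  then show ?case using transport_lin_left_op[OF x, of i "left_word js z"] Wsupp_left_word[OF _ z] by (simp add: lin_add lin_smul)
qed simp

text \<open>Up to a unit, each ket is the transport of a reachable pair, for some x in the closed
  alcove; the identity is pushed forward from the regular module and the unit divided out.\<close>

lemma weight_word_shift_ket:
  assumes js: "set js \<subseteq> I" and ms: "set ms \<subseteq> I" and i: "i \<in> I"
    and eq: "word_prod D ms = word_prod D js \<circ> rf (al i)"
  shows "weight_word js (weight_op i y) = weight_word ms (e y) - smul (hecke_par * of_int (neg_ind (word_prod D js (al i)))) (weight_word js (e y))"
proof -
  obtain x w m where r: "(m, w) \<in> reach" "w \<in> W" "y + rho D = w x + zmul (int l) m"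
    and x: "\<And>\<beta>. \<beta> \<in> Rp \<Longrightarrow> 0 \<le> ip \<beta> x \<and> ip \<beta> x \<le> int l"
    using alcove_decomposition[OF l_pos, of "y + rho D"] by blast
  let ?c = "th (transport_exp x w)" and ?h = "hecke_par * of_int (neg_ind (word_prod D js (al i)))"
  have yy: "w x + zmul (int l) m - rho D = y" using r(3) by (simp flip: r(3))
  have t: "lin (transport x) (ket0 (m, w)) = smul ?c (e y)" by (simp add: lin_ket0 transport_def yy)
  have s: "Wsupp (ket0 (m, w))" using r Wsupp_ket by blast
  have "smul ?c (weight_word js (weight_op i y)) = weight_word js (lin (weight_op i) (smul ?c (e y)))" by (simp add: lin_smul lin_ket0 weight_word_smul)
  also have "\<dots> = lin (transport x) (left_word js (lin (left_op i) (ket0 (m, w))))"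
    by (simp add: transport_left_word[OF x js Wsupp_lin_left_op[OF i]] transport_lin_left_op[OF x i s] t)
  also have "\<dots> = lin (transport x) (left_word ms (ket0 (m, w)) - smul ?h (left_word js (ket0 (m, w))))"
    by (simp only: lin_ket0 left_word_shift[OF js ms i eq r(1)])
  also have "\<dots> = smul ?c (weight_word ms (e y) - smul ?h (weight_word js (e y)))"
    by (simp add: lin_diff lin_smul transport_left_word[OF x js s] transport_left_word[OF x ms s] t weight_word_smul K.scale_right_diff_distrib mult.commute)
  finally have "smul (th (- transport_exp x w) * ?c) (weight_word js (weight_op i y)) =
      smul (th (- transport_exp x w) * ?c) (weight_word ms (e y) - smul ?h (weight_word js (e y)))" by (metis K.scale_scale)
  then show ?thesis using th_inverse[of "transport_exp x w"] by (simp add: mult.commute)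
qed

lemma weight_word_shift:
  assumes js: "set js \<subseteq> I" and ms: "set ms \<subseteq> I" and i: "i \<in> I"
    and eq: "word_prod D ms = word_prod D js \<circ> rf (al i)"
  shows "weight_word js (lin (weight_op i) z) = weight_word ms z - smul (hecke_par * of_int (neg_ind (word_prod D js (al i)))) (weight_word js z)"
proof -
  have s: "weight_word js (sum f A) = (\<Sum>a\<in>A. weight_word js (f a))" for js f and A :: "'a set"
  proof (induction A rule: infinite_finite_induct)
    case (infinite A) then show ?case using weight_word_smul[of js 0 0] by simp
  next
    case empty show ?case using weight_word_smul[of js 0 0] by simp
  next
    case (insert a A) then show ?case by (simp add: weight_word_add)
  qed
  have "weight_word js (lin (weight_op i) (\<Sum>k\<in>ks z. smul (lk z k) (e k))) = weight_word ms (\<Sum>k\<in>ks z. smul (lk z k) (e k))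
    - smul (hecke_par * of_int (neg_ind (word_prod D js (al i)))) (weight_word js (\<Sum>k\<in>ks z. smul (lk z k) (e k)))"
    by (simp add: lin_sum lin_smul lin_ket0 s weight_word_smul weight_word_shift_ket[OF js ms i eq] K.scale_right_diff_distrib
        sum_subtractf K.scale_sum_right mult.commute)
  then show ?thesis by (simp only: ket_expand)
qed

subsection \<open>The sign projector and linear independence\<close>

text \<open>The identity gets the empty word, so that its summand in the projector is literally the
  identity map.\<close>

definition word_of :: "('a \<Rightarrow> 'a) \<Rightarrow> nat list" where
  "word_of w = (if w = id then [] else SOME js. set js \<subseteq> I \<and> w = word_prod D js)"

lemma word_of: assumes "w \<in> W" shows "set (word_of w) \<subseteq> I" "word_prod D (word_of w) = w"
proof -
  have "\<exists>js. set js \<subseteq> I \<and> w = word_prod D js" using assms by (auto simp: weyl_group_I)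
  then have "set (SOME js. set js \<subseteq> I \<and> w = word_prod D js) \<subseteq> I \<and> w = word_prod D (SOME js. set js \<subseteq> I \<and> w = word_prod D js)"
    by (rule someI_ex)
  then have "set (word_of w) \<subseteq> I \<and> word_prod D (word_of w) = w"
    by (cases "w = id") (simp_all add: word_of_def word_prod_Nil del: id_apply)
  then show "set (word_of w) \<subseteq> I" "word_prod D (word_of w) = w" by auto
qed

definition sign_coeff :: "('a \<Rightarrow> 'a) \<Rightarrow> laurent" where "sign_coeff w = (- th 1) ^ inv_num w"

text \<open>The antisymmetrizer of the Hecke algebra, left unnormalized since its square is the
  Poincare polynomial times itself and that is not invertible.\<close>

definition sign_proj :: "('a \<Rightarrow>\<^sub>0 laurent) \<Rightarrow> ('a \<Rightarrow>\<^sub>0 laurent)" where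
  "sign_proj z = (\<Sum>w\<in>W. smul (sign_coeff w) (weight_word (word_of w) z))"

lemma sign_proj_add: "sign_proj (x + y) = sign_proj x + sign_proj y"
  by (simp add: sign_proj_def weight_word_add K.scale_right_distrib sum.distrib)

lemma sign_proj_smul: "sign_proj (smul c x) = smul c (sign_proj x)"
  by (simp add: sign_proj_def weight_word_smul K.scale_sum_right mult.commute)

text \<open>The left side is the coefficient of T_w after right multiplication of the
  antisymmetrizer by T_i.\<close>

lemma sign_coeff_step: assumes w: "w \<in> W" and i: "i \<in> I"
  shows "sign_coeff (w \<circ> rf (al i)) - sign_coeff w * (hecke_par * of_int (neg_ind (w (al i)))) = - th 1 * sign_coeff w"
proof (cases "w (al i) \<in> Rp")
  case True
  let ?v = "w \<circ> rf (al i)"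
  have v: "?v \<in> W" using W_comp W_simple w i by blast
  have "- ?v (al i) \<in> Rp" using True w i by (simp add: reflect_self simple_root W_neg)
  then have "inv_num ?v = Suc (inv_num w)" using inv_num_step[OF v i] by (simp only: comp_reflect_twice[OF i])
  then show ?thesis using True by (simp add: sign_coeff_def neg_ind_def)
next
  case False
  let ?v = "w \<circ> rf (al i)"
  have "- w (al i) \<in> Rp" using False pos_W_cases w i simple_root by blast
  then have n: "inv_num w = Suc (inv_num ?v)" using inv_num_step[OF w i] by simp
  show ?thesis using False by (simp add: sign_coeff_def neg_ind_def n hecke_par_def algebra_simps)
     (use th_inverse[of 1] in \<open>simp flip: mult.assoc\<close>)
qed

lemma sum_W_right: assumes "v \<in> W" shows "(\<Sum>w\<in>W. f (w \<circ> v)) = (\<Sum>w\<in>W. f w)"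
proof (rule sum.reindex_bij_witness[of _ "\<lambda>w. w \<circ> inv v" "\<lambda>w. w \<circ> v"])
  fix w assume w: "w \<in> W"
  show "w \<circ> v \<circ> inv v = w" "w \<circ> inv v \<circ> v = w"
    using assms by (auto simp: fun_eq_iff W_inv_left W_inv_right)
  show "w \<circ> v \<in> W" "w \<circ> inv v \<in> W" using assms w W_comp W_inv by blast+
qed simp

lemma sign_proj_weight_op: assumes i: "i \<in> I" shows "sign_proj (lin (weight_op i) z) = - smul (th 1) (sign_proj z)"
proof -
  have Wi: "rf (al i) \<in> W" using W_simple i by blast
  have "sign_proj (lin (weight_op i) z) = (\<Sum>w\<in>W. smul (sign_coeff w) (weight_word (word_of (w \<circ> rf (al i))) z))
      - (\<Sum>w\<in>W. smul (sign_coeff w * (hecke_par * of_int (neg_ind (w (al i))))) (weight_word (word_of w) z))"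
  proof -
    have "weight_word (word_of w) (lin (weight_op i) z) = weight_word (word_of (w \<circ> rf (al i))) z - smul (hecke_par * of_int (neg_ind (w (al i)))) (weight_word (word_of w) z)"
      if w: "w \<in> W" for w
      using weight_word_shift[of "word_of w" "word_of (w \<circ> rf (al i))" i z] word_of[OF w] word_of[OF W_comp[OF w Wi]] i by (simp del: comp_apply)
    then show ?thesis by (simp add: sign_proj_def K.scale_right_diff_distrib sum_subtractf)
  qed
  also have "(\<Sum>w\<in>W. smul (sign_coeff w) (weight_word (word_of (w \<circ> rf (al i))) z)) = (\<Sum>w\<in>W. smul (sign_coeff (w \<circ> rf (al i))) (weight_word (word_of w) z))"
    using sum_W_right[OF Wi, of "\<lambda>w. smul (sign_coeff (w \<circ> rf (al i))) (weight_word (word_of w) z)"]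
    by (simp add: comp_reflect_twice[OF i] del: comp_apply)
  also have "\<dots> - (\<Sum>w\<in>W. smul (sign_coeff w * (hecke_par * of_int (neg_ind (w (al i))))) (weight_word (word_of w) z))
      = (\<Sum>w\<in>W. smul (- th 1 * sign_coeff w) (weight_word (word_of w) z))"
    unfolding sum_subtractf[symmetric]
    by (intro sum.cong refl) (simp only: K.scale_left_diff_distrib[symmetric] sign_coeff_step[OF _ i])
  also have "\<dots> = - smul (th 1) (sign_proj z)" by (simp add: sign_proj_def K.scale_sum_right sum_negf)
  finally show ?thesis .
qed

lemma laurent_th_cancel:
  assumes "smul (th (- 1) + th 1) (z :: 'a \<Rightarrow>\<^sub>0 laurent) = 0" shows "z = 0"
proof -
  have n: "th (- 1) + th 1 \<noteq> 0"
  proof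
    assume "th (- 1) + th 1 = 0"
    then have "lk (th (- 1) + th 1) 1 = 0" by simp
    then show False by (simp add: th_def lookup_add lookup_single)
  qed
  show ?thesis
  proof (rule poly_mapping_eqI)
    fix k
    have "(th (- 1) + th 1) * lk z k = lk (smul (th (- 1) + th 1) z) k" by (simp only: lookup_smul)
    then show "lk z k = lk 0 k" using n assms by simp
  qed
qed

text \<open>On walls the image of T_i + t^(1/2) only contains multiples of the relator by t^(1/2) +
  t^(-1/2); the factor is removed because the coefficients form a domain.\<close>

lemma sign_proj_kill: assumes "i \<in> I" and "lin (weight_op i) z + smul (th 1) z = smul (th (- 1) + th 1) y"
  shows "sign_proj y = 0"
proof -
  have "smul (th (- 1) + th 1) (sign_proj y) = sign_proj (lin (weight_op i) z) + smul (th 1) (sign_proj z)"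
    by (simp only: assms(2) sign_proj_add[symmetric] sign_proj_smul[symmetric])
  then show ?thesis using sign_proj_weight_op[OF assms(1)] laurent_th_cancel by simp
qed

text \<open>
  The strings in $T_i|y\rangle$ and in $T_i|y - k\ell\alpha_i\rangle$ cancel, so that $T_i + t^{1/2}$ maps the sum
  of the two kets to a relator, or on a wall to $t^{1/2} + t^{-1/2}$ times a relator.
\<close>

lemma sign_proj_N: assumes x: "x \<in> N" shows "sign_proj x = 0"
proof -
  have "sign_proj x \<in> {0}"
  proof (rule span_relators_map[where g = sign_proj and h = "\<lambda>c. c", OF K.subspace_single_0 sign_proj_add sign_proj_smul _ _ _ _ x])
    fix i y assume i: "i \<in> I"
    \<comment> \<open>The strings of lengths k and - k add up to the empty string by the cocycle
      rule.\<close>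
    have pair: "lin (weight_op i) (e y + e (shift_weight i k y)) = smul (wall_factor i y) (e (sd i y)) + smul (wall_factor i (shift_weight i k y)) (e (sd i (shift_weight i k y)))"
      if k: "pr i y div int l = k" "pr i (shift_weight i k y) div int l = - k" for k y
      using string_sum_add[of "shift_weight i" k "- k" y] shift_weight_shift_weight
      by (simp add: lin_add lin_ket0 weight_op_def k string_sum_0 flip: K.scale_right_distrib)
    have prs: "pr i (shift_weight i k y) = pr i y - 2 * (k * int l)" for k y using i by (simp add: shift_weight_def pr_shift)
    { assume p: "pr i y = 0"
      then have "weight_op i y = smul (th (- 1)) (e y)" by (simp add: weight_op_def wall_factor_def sd_def string_sum_0 zmul_0_left)
      then show "sign_proj (e y) \<in> {0}"
        using sign_proj_kill[OF i, of "e y" "e y"] by (simp add: lin_ket0 K.scale_left_distrib) }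
    { assume "int l dvd pr i y"
      then obtain k where p: "pr i y = int l * k" by (auto elim: dvdE)
      have s: "shift_weight i k y = sd i y" by (simp add: shift_weight_def sd_def p mult.commute)
      have "pr i y div int l = k" "pr i (shift_weight i k y) div int l = - k" using l_pos nonzero_mult_div_cancel_right[of "int l" "- k"] by (simp_all add: prs p mult.commute)
      from pair[OF this] have "lin (weight_op i) (e y + e (sd i y)) = smul (th (- 1)) (e (sd i y) + e y)"
        using i p by (simp add: s wall_factor_def pr_sd sd_sd K.scale_right_distrib)
      then have "sign_proj (e (sd i y) + e y) = 0"
        by (intro sign_proj_kill[OF i, of "e y + e (sd i y)"]) (simp add: K.scale_left_distrib K.scale_right_distrib algebra_simps)
      then show "sign_proj (e (sd i y)) + sign_proj (e y) \<in> {0}" by (simp add: sign_proj_add) }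
    have hi: "sign_proj (rr i y + rr i (shift_weight i k y)) = 0" if p: "pr i y = k * int l + j" "0 < j" "j < int l" for k j y
    proof -
      have "pr i y div int l = k" using div_add_mult[of j k] p by (simp add: mult.commute)
      moreover have p2: "pr i (shift_weight i k y) = int l * (- k) + j" by (simp add: prs p algebra_simps)
      then have "pr i (shift_weight i k y) div int l = - k" using div_add_mult[of j "- k"] p by simp
      moreover have "\<not> int l dvd j" using p zdvd_not_zless by blast
      then have "\<not> int l dvd pr i y" "\<not> int l dvd pr i (shift_weight i k y)"
        unfolding p2 p(1) by (metis dvd_add_right_iff dvd_triv_right, metis dvd_add_right_iff dvd_triv_left)
      ultimately have "lin (weight_op i) (e y + e (shift_weight i k y)) + smul (th 1) (e y + e (shift_weight i k y)) = rr i y + rr i (shift_weight i k y)"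
        using pair[of y k] by (simp add: wall_factor_def rr_def K.scale_right_distrib algebra_simps)
      then show ?thesis using sign_proj_weight_op[OF i] by (metis add.left_inverse sign_proj_add sign_proj_smul)
    qed
    { assume p: "0 < pr i y" "pr i y < int l"
      then have "sign_proj (rr i y + rr i (shift_weight i 0 y)) = 0" by (intro hi[of _ _ "pr i y"]) auto
      \<comment> \<open>With k = 0 the pair degenerates to twice the relator, and 2 is cancelled
        since Laurent polynomials have no torsion.\<close>
      then have d: "sign_proj (rr i y) + sign_proj (rr i y) = 0" unfolding sign_proj_add by (simp add: shift_weight_def zmul_0_left)
      have "sign_proj (rr i y) = 0"
      proof (rule poly_mapping_eqI)
        fix k
        have "lk (sign_proj (rr i y)) k = - lk (sign_proj (rr i y)) k"
          using d by (metis eq_neg_iff_add_eq_0 lookup_add lookup_zero)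
        then show "lk (sign_proj (rr i y)) k = lk 0 k" using laurent_double by simp
      qed
      then show "sign_proj (rr i y) \<in> {0}" by simp }
    { fix k j assume "pr i y = k * int l + j" "0 < j" "j < int l"
      then show "sign_proj (rr i y) + sign_proj (rr i (y - zmul (k * int l) (al i))) \<in> {0}"
        using hi by (simp add: sign_proj_add shift_weight_def) }
  qed
  then show ?thesis by simp
qed

section \<open>Leading terms with respect to the norm\<close>

abbreviation Qr where "Qr x \<equiv> Q (x + rho D)"

definition lower :: "nat \<Rightarrow> ('a \<Rightarrow>\<^sub>0 laurent) set" where "lower n = {z. \<forall>k. lk z k \<noteq> 0 \<longrightarrow> Qr k < n}"

lemma lower_add: "y \<in> lower n \<Longrightarrow> z \<in> lower n \<Longrightarrow> y + z \<in> lower n"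
  by (simp add: lower_def lookup_add) (metis add_0)

lemma lower_smul: "z \<in> lower n \<Longrightarrow> smul c z \<in> lower n" by (auto simp: lower_def lookup_smul)

lemma lower_neg: "z \<in> lower n \<Longrightarrow> - z \<in> lower n" by (auto simp: lower_def)

lemma lower_0: "0 \<in> lower n" by (simp add: lower_def)

lemma lower_sum: "(\<And>a. a \<in> A \<Longrightarrow> f a \<in> lower n) \<Longrightarrow> sum f A \<in> lower n"
  by (induction A rule: infinite_finite_induct) (auto simp: lower_0 lower_add)

lemma lower_ket: "e x \<in> lower n \<longleftrightarrow> Qr x < n" by (auto simp: lower_def lk_ket0)

lemma Qr_sd: "i \<in> I \<Longrightarrow> Qr (sd i x) = Qr x"
  by (simp flip: sd_dot add: dot_def Q_reflect simple_root)

lemma Qr_string: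
  assumes i: "i \<in> I" and k: "0 < k \<and> k < pr i x \<or> pr i x < k \<and> k < 0"
  shows "Qr (x - zmul k (al i)) < Qr x"
proof -
  have eq: "x - zmul k (al i) + rho D = (x + rho D) - zmul k (al i)" by simp
  show ?thesis unfolding eq using Q_string[OF simple_root[OF i]] k unfolding pr_def by blast
qed

text \<open>All kets of the string other than its possible endpoints y and s_i y lie strictly
  between them, hence are shorter. The added term compensates y itself, which occurs only for a
  negative pairing.\<close>

lemma weight_op_lead:
  assumes i: "i \<in> I"
  shows "\<exists>c. weight_op i y + smul (hecke_par * of_int (if pr i y < 0 then 1 else 0)) (e y) - smul c (e (sd i y)) \<in> lower (Qr y)"
proof (cases "pr i y \<ge> 0")
  case True
  let ?k = "pr i y div int l"
  have k0: "?k \<ge> 0" using True l_pos by (simp add: pos_imp_zdiv_nonneg_iff)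
  have kl: "?k * int l \<le> pr i y" by (metis l_pos mult.commute mult_div_mod_eq of_nat_0_less_iff pos_mod_sign le_add_same_cancel1)
  have trm: "e (shift_weight i p y) \<in> lower (Qr y)" if p: "p \<in> {1..?k}" "p * int l \<noteq> pr i y" for p
  proof -
    have "p * int l \<le> ?k * int l" using p by (intro mult_right_mono) auto
    moreover have "p * int l > 0" using p l_pos by simp
    ultimately show ?thesis using Qr_string[OF i, of "p * int l" y] p(2) kl by (simp add: lower_ket shift_weight_def)
  qed
  show ?thesis
  proof (cases "?k * int l = pr i y \<and> ?k > 0")
    case False
    have "e (shift_weight i p y) \<in> lower (Qr y)" if p: "p \<in> {1..?k}" for p
    proof (rule trm[OF p], rule notI)
      assume a: "p * int l = pr i y"
      then have "?k = p" using l_pos by (simp flip: a)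
      then show False using False p a by simp
    qed
    then have "(\<Sum>p\<in>{1..?k}. e (shift_weight i p y)) \<in> lower (Qr y)" by (rule lower_sum)
    then have "string_sum (shift_weight i) ?k y \<in> lower (Qr y)" using k0 by (simp add: string_sum_def)
    then have "weight_op i y + smul (hecke_par * of_int (if pr i y < 0 then 1 else 0)) (e y) - smul (wall_factor i y) (e (sd i y)) \<in> lower (Qr y)"
      using True by (simp add: weight_op_def lower_smul)
    then show ?thesis by blast
  next
    case k: True
    \<comment> \<open>On a positive wall the last ket of the string is the reflected ket, so it is
      split off and joins the leading coefficient.\<close>
    have "string_sum (shift_weight i) (?k - 1) y \<in> lower (Qr y)"
    proof -
      have "e (shift_weight i p y) \<in> lower (Qr y)" if p: "p \<in> {1..?k - 1}" for p
      proof (rule trm)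
        show "p \<in> {1..?k}" using p by auto
        have "p * int l < ?k * int l" using p l_pos by (intro mult_strict_right_mono) auto
        then show "p * int l \<noteq> pr i y" using k by simp
      qed
      then have "(\<Sum>p\<in>{1..?k - 1}. e (shift_weight i p y)) \<in> lower (Qr y)" by (rule lower_sum)
      then show ?thesis using k by (simp add: string_sum_def)
    qed
    moreover have "shift_weight i ?k y = sd i y" using k by (simp add: shift_weight_def sd_def)
    then have "string_sum (shift_weight i) ?k y = string_sum (shift_weight i) (?k - 1) y + e (sd i y)" using string_sum_step[of "shift_weight i" "?k - 1" y] by simp
    ultimately have "weight_op i y + smul (hecke_par * of_int (if pr i y < 0 then 1 else 0)) (e y) - smul (wall_factor i y + hecke_par) (e (sd i y)) \<in> lower (Qr y)"
      using True by (simp add: weight_op_def lower_smul K.scale_right_distrib K.scale_left_distrib)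
    then show ?thesis by blast
  qed
next
  case False
  let ?k = "pr i y div int l"
  have k0: "?k < 0" using False l_pos by (intro div_neg_pos_less0) auto
  have "?k * int l + pr i y mod int l = pr i y" by simp
  moreover have "pr i y mod int l < int l" using l_pos by simp
  ultimately have kl: "pr i y < (?k + 1) * int l" unfolding distrib_right by linarith
  have "e (shift_weight i p y) \<in> lower (Qr y)" if p: "p \<in> {?k + 1..- 1}" for p
  proof -
    have "(?k + 1) * int l \<le> p * int l" using p by (intro mult_right_mono) auto
    moreover have "p * int l < 0" using p l_pos by (simp add: mult_neg_pos)
    ultimately show ?thesis using Qr_string[OF i, of "p * int l" y] kl by (simp add: lower_ket shift_weight_def)
  qed
  then have l1: "(\<Sum>p\<in>{?k + 1..- 1}. e (shift_weight i p y)) \<in> lower (Qr y)" by (rule lower_sum)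
  \<comment> \<open>The index 0 is y itself: the off-by-one in negative strings produces the term to
    be compensated.\<close>
  have "{?k + 1..0} = insert 0 {?k + 1..- 1}" using k0 by auto
  then have "string_sum (shift_weight i) ?k y = - e y - (\<Sum>p\<in>{?k + 1..- 1}. e (shift_weight i p y))"
    using k0 by (simp add: string_sum_def shift_weight_def zmul_0_left)
  then have "weight_op i y + smul (hecke_par * of_int (if pr i y < 0 then 1 else 0)) (e y) - smul (wall_factor i y) (e (sd i y))
      = - smul hecke_par (\<Sum>p\<in>{?k + 1..- 1}. e (shift_weight i p y))"
    using False by (simp add: weight_op_def K.scale_right_diff_distrib)
  then show ?thesis using lower_neg[OF lower_smul[OF l1]] by metis
qed

lemma weight_op_lower: assumes i: "i \<in> I" and y: "Qr y < n" shows "weight_op i y \<in> lower n"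
proof -
  obtain c where c: "weight_op i y + smul (hecke_par * of_int (if pr i y < 0 then 1 else 0)) (e y) - smul c (e (sd i y)) \<in> lower (Qr y)"
    using weight_op_lead[OF i] by blast
  let ?a = "smul (hecke_par * of_int (if pr i y < 0 then 1 else 0)) (e y)" and ?b = "smul c (e (sd i y))"
  have "weight_op i y + ?a - ?b \<in> lower n" using c y by (force simp: lower_def)
  moreover have "?a \<in> lower n" "?b \<in> lower n" using y i by (simp_all add: lower_smul lower_ket Qr_sd)
  ultimately have "(weight_op i y + ?a - ?b) + ?b + - ?a \<in> lower n" by (intro lower_add lower_neg)
  then show ?thesis by simp
qed

lemma lin_weight_op_lower: assumes i: "i \<in> I" and z: "z \<in> lower n" shows "lin (weight_op i) z \<in> lower n"
  unfolding lin_def using z by (intro lower_sum lower_smul weight_op_lower[OF i]) (auto simp: lower_def in_keys_iff)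

text \<open>For dominant x, the pairing at w . x is negative exactly when the inverse of w makes
  \<alpha>_i negative. So the correction in \<open>word_op\<close> is the one demanded by
  \<open>weight_op_lead\<close>.\<close>

lemma weight_word_lead:
  assumes x: "x \<in> dominant D" and js: "set js \<subseteq> I"
  shows "\<exists>c. weight_word js (e x) - smul c (e (dot D (word_prod D js) x)) \<in> lower (Qr x)"
  using js
proof (induction js)
  case Nil
  have "weight_word [] (e x) - smul 1 (e (dot D (word_prod D []) x)) = 0"
    unfolding word_prod_Nil dot_id by simp
  then show ?case using lower_0 by metis
next
  case (Cons i js)
  let ?w = "word_prod D js"
  let ?y = "dot D ?w x" and ?h = "hecke_par * of_int (neg_ind (inv ?w (al i)))"
  have i: "i \<in> I" and w: "?w \<in> W" using Cons.prems W_word by auto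
  have r: "al i \<in> R" using i simple_root by blast
  obtain c where c: "weight_word js (e x) - smul c (e ?y) \<in> lower (Qr x)" using Cons by auto
  let ?d = "weight_word js (e x) - smul c (e ?y)"
  have Qy: "Qr ?y = Qr x" using w by (simp add: dot_def Q_W)
  have py: "pr i ?y = ip (inv ?w (al i)) (x + rho D)" using w r by (simp add: pr_def dot_def coroot_W_inv)
  have gR: "inv ?w (al i) \<in> R" using W_inv W_root w r by blast
  have pos: "ip \<beta> (x + rho D) > 0" if "\<beta> \<in> Rp" for \<beta> by (rule reg_pos[OF _ that]) (use x in \<open>auto simp: dominant_iff\<close>)
  have "(if pr i ?y < 0 then 1 else 0) = neg_ind (inv ?w (al i))"
  proof (cases "inv ?w (al i) \<in> Rp")
    case True then show ?thesis using pos[OF True] by (simp add: py neg_ind_def)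
  next
    case False
    then have "- inv ?w (al i) \<in> Rp" using pos_or_neg gR by blast
    then show ?thesis using pos[of "- inv ?w (al i)"] gR False by (simp add: py neg_ind_def coroot_neg_root)
  qed
  then obtain c' where c': "weight_op i ?y + smul ?h (e ?y) - smul c' (e (sd i ?y)) \<in> lower (Qr ?y)"
    using weight_op_lead[OF i, of ?y] by auto
  let ?d' = "weight_op i ?y + smul ?h (e ?y) - smul c' (e (sd i ?y))"
  have M: "weight_word js (e x) = ?d + smul c (e ?y)" by simp
  have "dot D (word_prod D (i # js)) x = sd i ?y" by (simp only: word_prod_Cons dot_comp sd_dot)
  moreover have "weight_word (i # js) (e x) - smul (c * c') (e (sd i ?y)) = lin (weight_op i) ?d + smul ?h ?d + smul c ?d'"
    unfolding word_op.simps by (subst (1 2) M)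
      (simp only: lin_add lin_smul lin_ket0 K.scale_right_distrib K.scale_right_diff_distrib K.scale_scale mult.commute[of ?h c],
       simp add: algebra_simps)
  moreover have "lin (weight_op i) ?d + smul ?h ?d + smul c ?d' \<in> lower (Qr x)"
    using c c' Qy by (intro lower_add lower_smul lin_weight_op_lower[OF i]) auto
  ultimately show ?case by metis
qed

text \<open>Apart from shorter kets, T_w y contributes only w . y, which is dominant for w =
  \<open>id\<close> alone.\<close>

lemma lk_sign_proj:
  assumes x: "x \<in> dominant D" and y: "y \<in> dominant D" and q: "Qr y \<le> Qr x"
  shows "lk (sign_proj (e y)) x = (if x = y then 1 else 0)"
proof -
  have "lk (smul (sign_coeff w) (weight_word (word_of w) (e y))) x = (if w = id then if x = y then 1 else 0 else 0)" if w: "w \<in> W" for w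
  proof (cases "w = id")
    case True
    have n: "inv_num id = 0" unfolding inv_num_def using pos_not_neg by (auto simp: card_eq_0_iff)
    show ?thesis using True by (simp add: word_of_def sign_coeff_def n lk_ket0 lookup_smul del: id_apply)
  next
    case False
    obtain c where c: "weight_word (word_of w) (e y) - smul c (e (dot D w y)) \<in> lower (Qr y)"
      using weight_word_lead[OF y, of "word_of w"] word_of[OF w] by auto
    have "dot D w y \<noteq> x"
    proof
      assume "dot D w y = x"
      then have "w (y + rho D) = x + rho D" by (auto simp: dot_def)
      then have "w = id" using regular_stab[OF w, of "y + rho D"] x y by (simp add: dominant_iff)
      then show False using False by simp
    qed
    then have "lk (weight_word (word_of w) (e y) - smul c (e (dot D w y))) x = lk (weight_word (word_of w) (e y)) x"
      by (simp add: lookup_minus lookup_smul lk_ket0)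
    then have "lk (weight_word (word_of w) (e y)) x = 0" using c q unfolding lower_def mem_Collect_eq not_le[symmetric] by metis
    then show ?thesis using False by (simp add: lookup_smul)
  qed
  then have "lk (sign_proj (e y)) x = (\<Sum>w\<in>W. if w = id then if x = y then 1 else 0 else 0)"
    unfolding sign_proj_def lookup_sum by (intro sum.cong) auto
  then show ?thesis using finite_W W_id by (simp add: sum.delta)
qed

text \<open>A ket of maximal norm in z keeps its coefficient under the sign projector, which
  annihilates \<open>N\<close>.\<close>

lemma independent_dominant:
  assumes z: "z \<in> N" and k: "ks z \<subseteq> dominant D" shows "z = 0"
proof (rule ccontr)
  assume "z \<noteq> 0"
  then have ne: "Qr ` ks z \<noteq> {}" and fin: "finite (Qr ` ks z)" by (auto simp: finite_keys)
  obtain x where x: "x \<in> ks z" "Qr x = Max (Qr ` ks z)" using Max_in[OF fin ne] by (metis (no_types, lifting) imageE)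
  have mx: "Qr y \<le> Qr x" if "y \<in> ks z" for y using that fin x(2) by simp
  have ps: "sign_proj (sum f A) = (\<Sum>a\<in>A. sign_proj (f a))" for f and A :: "'a set"
    by (induction A rule: infinite_finite_induct) (use sign_proj_smul[of 0 0] in \<open>auto simp: sign_proj_add\<close>)
  have "sign_proj z = sign_proj (\<Sum>y\<in>ks z. smul (lk z y) (e y))" by (simp only: ket_expand)
  then have "lk (sign_proj z) x = (\<Sum>y\<in>ks z. lk z y * lk (sign_proj (e y)) x)"
    by (simp add: ps sign_proj_smul lookup_sum lookup_smul)
  also have "\<dots> = (\<Sum>y\<in>ks z. if x = y then lk z x else 0)"
  proof (rule sum.cong[OF refl])
    fix y assume y: "y \<in> ks z"
    have "lk (sign_proj (e y)) x = (if x = y then 1 else 0)" by (rule lk_sign_proj) (use k x(1) y mx in auto)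
    then show "lk z y * lk (sign_proj (e y)) x = (if x = y then lk z x else 0)" by simp
  qed
  also have "\<dots> = lk z x" using x(1) by (simp add: finite_keys)
  finally show False using sign_proj_N[OF z] x(1) by (simp add: in_keys_iff)
qed

end

section \<open>Polynomials in t^(1/2), the ideal of t^(1/2), and the bar involution\<close>

definition th_nonneg :: "laurent set" where "th_nonneg = {c. \<forall>k\<in>ks c. k \<ge> 0}"

lemma th_positive_iff: "c \<in> th_positive \<longleftrightarrow> (\<forall>k. k \<le> 0 \<longrightarrow> lk c k = 0)"
  unfolding th_positive_def mem_Collect_eq Ball_def in_keys_iff not_le[symmetric] by blast

lemma th_nonneg_iff: "c \<in> th_nonneg \<longleftrightarrow> (\<forall>k. k < 0 \<longrightarrow> lk c k = 0)"
  unfolding th_nonneg_def mem_Collect_eq Ball_def in_keys_iff not_le[symmetric] by blast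

lemma th_positive_0: "0 \<in> th_positive" and th_positive_add: "c \<in> th_positive \<Longrightarrow> d \<in> th_positive \<Longrightarrow> c + d \<in> th_positive"
  and th_positive_diff: "c \<in> th_positive \<Longrightarrow> d \<in> th_positive \<Longrightarrow> c - d \<in> th_positive"
  by (auto simp: th_positive_iff lookup_add lookup_minus)

lemma th_nonneg_0: "0 \<in> th_nonneg" and th_nonneg_add: "c \<in> th_nonneg \<Longrightarrow> d \<in> th_nonneg \<Longrightarrow> c + d \<in> th_nonneg"
  by (auto simp: th_nonneg_iff lookup_add)

lemma th_positive_mult: assumes "c \<in> th_positive" "d \<in> th_nonneg" shows "c * d \<in> th_positive"
proof -
  have "k > 0" if "k \<in> ks (c * d)" for k
  proof -
    obtain a b where "k = a + b" "a \<in> ks c" "b \<in> ks d" using keys_mult[of c d] \<open>k \<in> _\<close> by blast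
    then show ?thesis using assms by (auto simp: th_positive_def th_nonneg_def add_pos_nonneg)
  qed
  then show ?thesis by (simp add: th_positive_def)
qed

lemma th_nonneg_mult: assumes "c \<in> th_nonneg" "d \<in> th_nonneg" shows "c * d \<in> th_nonneg"
proof -
  have "k \<ge> 0" if "k \<in> ks (c * d)" for k
  proof -
    obtain a b where "k = a + b" "a \<in> ks c" "b \<in> ks d" using keys_mult[of c d] \<open>k \<in> _\<close> by blast
    then show ?thesis using assms by (auto simp: th_nonneg_def)
  qed
  then show ?thesis by (simp add: th_nonneg_def)
qed

lemma th_nonneg_of_int: "of_int n \<in> th_nonneg"
  by (simp add: of_int_laurent th_nonneg_iff lookup_single)

lemma th_nonneg_minus_1: "- 1 \<in> th_nonneg" "1 \<in> th_nonneg"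
  using th_nonneg_of_int[of "- 1"] th_nonneg_of_int[of 1] by simp_all

lemma th_positive_th: "th 1 \<in> th_positive" and th_nonneg_th: "th 1 \<in> th_nonneg"
  by (auto simp: th_def th_positive_iff th_nonneg_iff lookup_single)

lemma th_positive_bar: assumes "c \<in> th_positive" "laurent_bar c = c" shows "c = 0"
proof (rule poly_mapping_eqI)
  fix k
  have "lk c (- k) = lk c k" using assms(2) by (metis lookup_laurent_bar)
  then show "lk c k = lk 0 k" using assms(1) by (cases "k \<le> 0") (force simp: th_positive_iff)+
qed

lemma of_int_mult_lookup: "lk (of_int m * (c :: laurent)) k = m * lk c k"
proof -
  have "of_int m * c = sg 0 m * (\<Sum>k\<in>ks c. sg k (lk c k))" by (simp add: pm_expand of_int_laurent)
  also have "lk \<dots> k = m * lk c k"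
    by (simp add: sum_distrib_left mult_single lookup_sum lookup_single when_def finite_keys in_keys_iff if_distrib cong: if_cong)
  finally show ?thesis .
qed

definition pos_part :: "laurent \<Rightarrow> laurent" where
  "pos_part c = (\<Sum>k\<in>{k \<in> ks c. k > 0}. sg k (lk c k))"

lemma lookup_pos_part: "lk (pos_part c) k = (if k > 0 then lk c k else 0)"
  by (simp add: pos_part_def lookup_sum lookup_single when_def finite_keys in_keys_iff)

lemma pos_part_positive: "pos_part c \<in> th_positive"
  by (simp add: th_positive_iff lookup_pos_part)

text \<open>The constant term equals its own negative and vanishes, so the positive exponents
  determine everything.\<close>

lemma pos_part_antisym: assumes "laurent_bar c = - c" shows "c = pos_part c - laurent_bar (pos_part c)"
proof (rule poly_mapping_eqI)
  fix k
  have "lk c (- k) = - lk c k" for k using assms by (metis lookup_laurent_bar lookup_uminus)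
  then show "lk c k = lk (pos_part c - laurent_bar (pos_part c)) k"
    using \<open>\<And>k. lk c (- k) = - lk c k\<close>[of 0]
    by (cases k "0 :: int" rule: linorder_cases) (auto simp: lookup_minus lookup_laurent_bar lookup_pos_part)
qed

context fock
begin

subsection \<open>Straightening\<close>

definition domcomb :: "nat \<Rightarrow> laurent set \<Rightarrow> ('a \<Rightarrow>\<^sub>0 laurent) set" where
  "domcomb n A = {y. ks y \<subseteq> dominant D \<and> (\<forall>k\<in>ks y. Qr k < n) \<and> (\<forall>k. lk y k \<in> A)}"

text \<open>The norm bound and the coefficient set are tracked together, since straightening
  respects both: \<open>A\<close> is later all coefficients, the polynomials in t^(1/2), or the
  ideal of t^(1/2).\<close>

definition straight :: "nat \<Rightarrow> laurent set \<Rightarrow> ('a \<Rightarrow>\<^sub>0 laurent) set" where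
  "straight n A = {x. \<exists>y\<in>domcomb n A. x - y \<in> N}"

lemma domcomb_add:
  assumes "y \<in> domcomb n A" "z \<in> domcomb n A" "\<And>c d. c \<in> A \<Longrightarrow> d \<in> A \<Longrightarrow> c + d \<in> A"
  shows "y + z \<in> domcomb n A"
proof -
  have "ks (y + z) \<subseteq> ks y \<union> ks z" by (rule Poly_Mapping.keys_add)
  then show ?thesis using assms by (auto simp: domcomb_def lookup_add)
qed

lemma domcomb_smul:
  assumes "y \<in> domcomb n A" "\<And>d. d \<in> A \<Longrightarrow> c * d \<in> A'" shows "smul c y \<in> domcomb n A'"
proof -
  have "ks (smul c y) \<subseteq> ks y" by (auto simp: in_keys_iff lookup_smul)
  then show ?thesis using assms by (auto simp: domcomb_def lookup_smul)
qed

lemma domcomb_mono: "y \<in> domcomb n A \<Longrightarrow> n \<le> m \<Longrightarrow> A \<subseteq> A' \<Longrightarrow> y \<in> domcomb m A'"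
  by (fastforce simp: domcomb_def)

lemma straight_add:
  assumes "x \<in> straight n A" "y \<in> straight n A" "\<And>c d. c \<in> A \<Longrightarrow> d \<in> A \<Longrightarrow> c + d \<in> A"
  shows "x + y \<in> straight n A"
proof -
  obtain x' y' where *: "x' \<in> domcomb n A" "x - x' \<in> N" "y' \<in> domcomb n A" "y - y' \<in> N"
    using assms by (auto simp: straight_def)
  then have "(x - x') + (y - y') \<in> N" by (intro K.span_add)
  then have "x + y - (x' + y') \<in> N" by (simp add: algebra_simps)
  then show ?thesis using domcomb_add[OF *(1,3) assms(3)] by (auto simp: straight_def)
qed

lemma straight_smul: assumes "x \<in> straight n A" "\<And>d. d \<in> A \<Longrightarrow> c * d \<in> A'" shows "smul c x \<in> straight n A'"
proof -
  obtain y where y: "y \<in> domcomb n A" "x - y \<in> N" using assms by (auto simp: straight_def)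
  then have "smul c x - smul c y \<in> N" by (metis K.scale_right_diff_distrib K.span_scale)
  then show ?thesis using domcomb_smul[OF y(1) assms(2)] by (auto simp: straight_def)
qed

lemma straight_mono: "x \<in> straight n A \<Longrightarrow> n \<le> m \<Longrightarrow> A \<subseteq> A' \<Longrightarrow> x \<in> straight m A'"
  using domcomb_mono unfolding straight_def by blast

lemma domcomb_0: "0 \<in> A \<Longrightarrow> 0 \<in> domcomb n A" by (simp add: domcomb_def)

lemma straight_N: "x \<in> N \<Longrightarrow> 0 \<in> A \<Longrightarrow> x \<in> straight n A"
  unfolding straight_def using domcomb_0 by (auto intro!: bexI[of _ 0])

lemma straight_domcomb: "x \<in> domcomb n A \<Longrightarrow> x \<in> straight n A"
  by (auto simp: straight_def K.span_zero intro!: bexI[of _ x])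

lemma straight_cong: assumes "x \<in> straight n A" "y - x \<in> N" shows "y \<in> straight n A"
proof -
  obtain z where z: "z \<in> domcomb n A" "x - z \<in> N" using assms by (auto simp: straight_def)
  have "(y - x) + (x - z) \<in> N" using z assms by (intro K.span_add)
  then show ?thesis using z by (auto simp: straight_def)
qed

lemma straight_sum:
  assumes "\<And>a. a \<in> S \<Longrightarrow> f a \<in> straight n A" "0 \<in> A" "\<And>c d. c \<in> A \<Longrightarrow> d \<in> A \<Longrightarrow> c + d \<in> A"
  shows "sum f S \<in> straight n A"
  using assms(1)
proof (induction S rule: infinite_finite_induct)
  case (insert a S) then show ?case using straight_add[OF _ _ assms(3)] by simp
qed (use straight_N[OF K.span_zero assms(2)] in auto)

text \<open>The relation is taken at s_i x, where the pairing is positive. Its remaining two kets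
  lie strictly inside the string from x to s_i x and are therefore shorter.\<close>

lemma straighten_step:
  assumes i: "i \<in> I" and p: "pr i x < 0"
  shows "\<exists>r. e x + smul (if int l dvd pr i x then 1 else th 1) (e (sd i x)) + r \<in> N \<and>
    (r = 0 \<or> (\<exists>y z. Qr y < Qr x \<and> Qr z < Qr x \<and> r = e y + smul (th 1) (e z)))"
proof (cases "int l dvd pr i x")
  case True
  then show ?thesis using rel_wall[OF i True] by (intro exI[of _ 0]) (simp add: add.commute)
next
  case False
  let ?x = "sd i x" and ?m = "pr i (sd i x)"
  let ?k = "?m div int l" and ?j = "?m mod int l"
  have m: "?m = ?k * int l + ?j" "0 < ?m" using i p by (simp_all add: pr_sd)
  have "?j \<noteq> 0" using False i by (auto simp: pr_sd)
  then have j: "0 < ?j" "?j < int l" using l_pos pos_mod_bound[of "int l" ?m] pos_mod_sign[of "int l" ?m]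
    by linarith+
  have k: "?k \<ge> 0" using m l_pos by (simp add: pos_imp_zdiv_nonneg_iff)
  show ?thesis
  proof (cases "?k = 0")
    case True
    then have "rr i ?x \<in> N" using rel_first[OF i m(2)] m(1) j by simp
    then show ?thesis using False i by (intro exI[of _ 0]) (simp add: rr_def sd_sd)
  next
    case kn: False
    let ?z = "?x - zmul (?k * int l) (al i)"
    have kl: "0 < ?k * int l" using kn k l_pos by simp
    have sz: "sd i ?z = ?x - zmul ?j (al i)"
    proof -
      have "sd i ?z = ?z - zmul (?m - 2 * (?k * int l)) (al i)" using i by (simp add: sd_def[of i ?z] pr_shift)
      also have "\<dots> = ?x - zmul (?k * int l + (?m - 2 * (?k * int l))) (al i)"
        by (simp only: zmul_add_left diff_diff_eq)
      also have "?k * int l + (?m - 2 * (?k * int l)) = ?j" using m(1) by linarith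
      finally show ?thesis .
    qed
    have f1: "Qr ?z < Qr x" using Qr_string[OF i, of "?k * int l" ?x] kl m(1) j i by (simp add: Qr_sd)
    have f2: "Qr (sd i ?z) < Qr x" unfolding sz using Qr_string[OF i, of ?j ?x] kl m(1) j i by (simp add: Qr_sd)
    have "\<exists>y z. Qr y < Qr x \<and> Qr z < Qr x \<and> rr i ?z = e y + smul (th 1) (e z)"
      by (intro exI conjI) (rule f2, rule f1, rule rr_def)
    moreover have "rr i ?x + rr i ?z \<in> N" by (rule rel_higher[OF i m(1) j])
    then have "e x + smul (th 1) (e ?x) + rr i ?z \<in> N" unfolding rr_def[of i ?x] sd_sd[OF i] .
    ultimately show ?thesis using False by auto
  qed
qed

text \<open>The predicate allows one count to serve for both the sign and the power of t^(1/2): all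
  negative pairings, or only those off the walls.\<close>

definition neg_count :: "(int \<Rightarrow> bool) \<Rightarrow> 'a \<Rightarrow> nat" where
  "neg_count P x = card {\<beta> \<in> Rp. ip \<beta> (x + rho D) < 0 \<and> P (ip \<beta> (x + rho D))}"

lemma neg_count_step:
  assumes i: "i \<in> I" and p: "pr i x < 0"
  shows "neg_count P x = neg_count P (sd i x) + (if P (pr i x) then 1 else 0)"
proof -
  let ?S = "\<lambda>x. {\<beta> \<in> Rp. ip \<beta> (x + rho D) < 0 \<and> P (ip \<beta> (x + rho D))}"
  have r: "al i \<in> R" using i simple_root by blast
  have sx: "sd i x + rho D = rf (al i) (x + rho D)" by (simp flip: sd_dot add: dot_def)
  have c: "ip (rf (al i) \<beta>) (x + rho D) = ip \<beta> (sd i x + rho D)" if "\<beta> \<in> Rp" for \<beta>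
    unfolding sx using that r pos_root by (simp add: coroot_reflect)
  have c': "ip (rf (al i) \<beta>) (sd i x + rho D) = ip \<beta> (x + rho D)" if "\<beta> \<in> Rp" for \<beta>
    unfolding sx using that r pos_root by (simp add: coroot_reflect reflect_reflect)
  have np: "al i \<notin> ?S (sd i x)" using p i pr_sd[OF i, of x] by (simp add: pr_def)
  have "?S (sd i x) = rf (al i) ` (?S x - {al i})"
  proof (intro set_eqI iffI)
    fix \<beta> assume b: "\<beta> \<in> ?S (sd i x)"
    then have ne: "\<beta> \<noteq> al i" using np by blast
    have rp: "rf (al i) \<beta> \<in> Rp" using b simple_perm[OF i _ ne] by blast
    have "rf (al i) \<beta> \<noteq> al i"
    proof
      assume "rf (al i) \<beta> = al i"
      then have "\<beta> = - al i" using reflect_reflect[OF r] reflect_self[OF r] by metis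
      then show False using b pos_not_neg simple_pos[OF i] by blast
    qed
    then have "rf (al i) \<beta> \<in> ?S x - {al i}" using rp b c by auto
    moreover have "\<beta> = rf (al i) (rf (al i) \<beta>)" using reflect_reflect[OF r] by simp
    ultimately show "\<beta> \<in> rf (al i) ` (?S x - {al i})" by (rule rev_image_eqI)
  next
    fix \<beta> assume "\<beta> \<in> rf (al i) ` (?S x - {al i})"
    then obtain \<gamma> where g: "\<gamma> \<in> ?S x" "\<gamma> \<noteq> al i" "\<beta> = rf (al i) \<gamma>" by blast
    then show "\<beta> \<in> ?S (sd i x)" using simple_perm[OF i] c' by auto
  qed
  then have e: "neg_count P (sd i x) = card (?S x - {al i})"
    unfolding neg_count_def by (simp add: card_image reflect_inj r)
  have fin: "finite (?S x)" using finite_Rp by simp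
  have mem: "al i \<in> ?S x \<longleftrightarrow> P (pr i x)" using simple_pos[OF i] p by (simp add: pr_def)
  show ?thesis
  proof (cases "P (pr i x)")
    case True
    then show ?thesis using card_Suc_Diff1[OF fin, of "al i"] mem unfolding e by (simp add: neg_count_def)
  next
    case False
    then have "?S x - {al i} = ?S x" using mem by blast
    then show ?thesis unfolding e using False by (simp add: neg_count_def)
  qed
qed

text \<open>Termination is lexicographic: a straightening step either shortens a ket or keeps the
  norm and lowers the number of negative pairings.\<close>

lemma ket_straighten: "e x \<in> straight (Suc (Qr x)) th_nonneg"
proof (induction x rule: wf_induct_rule[OF wf_measures[of "[\<lambda>x. Qr x, \<lambda>x. neg_count (\<lambda>_. True) x]"]])
  case (1 x)
  have IH: "e y \<in> straight (Suc (Qr y)) th_nonneg" if "Qr y < Qr x \<or> Qr y = Qr x \<and> neg_count (\<lambda>_. True) y < neg_count (\<lambda>_. True) x" for y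
    using 1 that by auto
  note add = straight_add[OF _ _ th_nonneg_add]
  note sm = straight_smul[where A = th_nonneg and A' = th_nonneg, OF _ th_nonneg_mult]
  show ?case
  proof (cases "x \<in> dominant D")
    case True
    then have "e x \<in> domcomb (Suc (Qr x)) th_nonneg"
      using th_nonneg_minus_1 th_nonneg_0 by (auto simp: domcomb_def lk_ket0 in_keys_iff split: if_splits)
    then show ?thesis by (rule straight_domcomb)
  next
    case False
    then obtain i where i: "i \<in> I" "pr i x \<le> 0" unfolding dominant_iff pr_def by force
    show ?thesis
    proof (cases "pr i x = 0")
      case True
      then show ?thesis using rel_zero i th_nonneg_0 straight_N by blast
    next
      case False
      then have p: "pr i x < 0" using i by simp
      let ?c = "if int l dvd pr i x then 1 else th 1 :: laurent"
      obtain r where r: "e x + smul ?c (e (sd i x)) + r \<in> N"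
        and r2: "r = 0 \<or> (\<exists>y z. Qr y < Qr x \<and> Qr z < Qr x \<and> r = e y + smul (th 1) (e z))"
        using straighten_step[OF i(1) p] by blast
      have c: "?c \<in> th_nonneg" using th_nonneg_minus_1 th_nonneg_th by simp
      have "e (sd i x) \<in> straight (Suc (Qr x)) th_nonneg"
        using IH[of "sd i x"] neg_count_step[OF i(1) p, of "\<lambda>_. True"] i by (simp add: Qr_sd)
      then have 1: "smul ?c (e (sd i x)) \<in> straight (Suc (Qr x)) th_nonneg" using c by (rule sm)
      have lowk: "e y \<in> straight (Suc (Qr x)) th_nonneg" if "Qr y < Qr x" for y
        using IH[of y] that by (auto elim!: straight_mono)
      have 2: "r \<in> straight (Suc (Qr x)) th_nonneg" using r2
      proof
        assume "\<exists>y z. Qr y < Qr x \<and> Qr z < Qr x \<and> r = e y + smul (th 1) (e z)"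
        then show ?thesis using add sm[OF _ th_nonneg_th] lowk by blast
      qed (use straight_N[OF K.span_zero th_nonneg_0] in simp)
      have 3: "smul (- 1) (smul ?c (e (sd i x)) + r) \<in> straight (Suc (Qr x)) th_nonneg"
        using sm[OF add[OF 1 2] th_nonneg_minus_1(1)] .
      show ?thesis by (rule straight_cong[OF 3]) (use r in \<open>simp add: algebra_simps\<close>)
    qed
  qed
qed

lemma ket_straighten_less: "Qr x < n \<Longrightarrow> e x \<in> straight n th_nonneg"
  using ket_straighten[of x] by (rule straight_mono) auto

lemma straight_UNIV_add: "x \<in> straight n UNIV \<Longrightarrow> y \<in> straight n UNIV \<Longrightarrow> x + y \<in> straight n UNIV"
  by (rule straight_add) auto

lemma straight_UNIV_smul: "x \<in> straight n UNIV \<Longrightarrow> smul c x \<in> straight n UNIV"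
  by (rule straight_smul[of x n UNIV]) auto

lemma straight_UNIV_neg: "x \<in> straight n UNIV \<Longrightarrow> - x \<in> straight n UNIV"
  using straight_UNIV_smul[of x n "- 1"] by simp

lemma straight_UNIV_diff: "x \<in> straight n UNIV \<Longrightarrow> y \<in> straight n UNIV \<Longrightarrow> x - y \<in> straight n UNIV"
  using straight_UNIV_add[of x n "- y"] straight_UNIV_neg by simp

text \<open>Each reflection towards the dominant chamber contributes - 1 on a wall and - t^(1/2) off
  it, and the number of reflections of each kind is read off from x.\<close>

lemma leading_term:
  assumes y: "y \<in> dominant D" and w: "w \<in> W" and x: "x = dot D w y"
  shows "e x - smul ((- 1) ^ neg_count (\<lambda>_. True) x * th (int (neg_count (\<lambda>k. \<not> int l dvd k) x))) (e y) \<in> straight (Qr x) UNIV"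
  using w x
proof (induction "neg_count (\<lambda>_. True) x" arbitrary: x w)
  case 0
  have xr: "x + rho D = w (y + rho D)" using 0 by (simp add: dot_def)
  have y0: "ip \<beta> (y + rho D) > 0" if "\<beta> \<in> Rp" for \<beta>
    by (rule reg_pos[OF _ that]) (use y in \<open>auto simp: dominant_iff\<close>)
  have nz: "ip \<beta> (x + rho D) \<noteq> 0" if b: "\<beta> \<in> R" for \<beta>
  proof -
    have "ip \<beta> (x + rho D) = ip (inv w \<beta>) (y + rho D)" unfolding xr using coroot_W_inv 0 b by blast
    moreover have "inv w \<beta> \<in> R" using W_root W_inv 0 b by blast
    ultimately show ?thesis using y0[of "inv w \<beta>"] y0[of "- inv w \<beta>"] pos_or_neg[of "inv w \<beta>"]
      by (force simp: coroot_neg_root)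
  qed
  have em: "{\<beta> \<in> Rp. ip \<beta> (x + rho D) < 0} = {}" using 0(1) finite_Rp by (simp add: neg_count_def)
  have "ip (al i) (w (y + rho D)) > 0" if i: "i \<in> I" for i
    using em nz[OF simple_root[OF i]] simple_pos[OF i] unfolding xr by force
  then have "w = id" using regular_stab[OF 0(2), of "y + rho D"] y by (simp add: dominant_iff)
  then have "x = dot D id y" using 0(3) by (simp only:)
  then have xy: "x = y" by (simp only: dot_id)
  have "{\<beta> \<in> Rp. ip \<beta> (x + rho D) < 0 \<and> \<not> int l dvd ip \<beta> (x + rho D)} = {}" using em by blast
  then have "neg_count (\<lambda>k. \<not> int l dvd k) x = 0" unfolding neg_count_def by (simp only: card.empty)
  then show ?case using straight_N[OF K.span_zero] 0(1) by (simp add: th_0 xy)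
next
  case (Suc n)
  have xr: "x + rho D = w (y + rho D)" using Suc by (simp add: dot_def)
  have "\<exists>i\<in>I. pr i x < 0"
  proof (rule ccontr)
    assume "\<not> ?thesis"
    then have "\<And>i. i \<in> I \<Longrightarrow> ip (al i) (x + rho D) \<ge> 0" unfolding pr_def by force
    then have "{\<beta> \<in> Rp. ip \<beta> (x + rho D) < 0 \<and> True} = {}" using dom_pos by force
    then have "neg_count (\<lambda>_. True) x = 0" unfolding neg_count_def by (simp only: card.empty)
    then show False using Suc by simp
  qed
  then obtain i where i: "i \<in> I" "pr i x < 0" by blast
  let ?x = "sd i x" and ?c = "if int l dvd pr i x then 1 else th 1 :: laurent"
  let ?s = "\<lambda>x. (- 1) ^ neg_count (\<lambda>_. True) x * th (int (neg_count (\<lambda>k. \<not> int l dvd k) x))"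
  have n1: "neg_count (\<lambda>_. True) x = Suc (neg_count (\<lambda>_. True) ?x)" using neg_count_step[OF i, of "\<lambda>_. True"] by simp
  have "?x = dot D (rf (al i) \<circ> w) y" unfolding Suc.prems(2) dot_comp sd_dot ..
  moreover have "n = neg_count (\<lambda>_. True) ?x" using Suc.hyps(2) n1 by simp
  ultimately have "e ?x - smul (?s ?x) (e y) \<in> straight (Qr ?x) UNIV"
    using Suc.hyps(1) W_comp[OF W_simple[OF i(1)] Suc.prems(1)] by blast
  then have IH: "e ?x - smul (?s ?x) (e y) \<in> straight (Qr x) UNIV" unfolding Qr_sd[OF i(1)] .
  have s: "?s x = - ?c * ?s ?x"
    using neg_count_step[OF i, of "\<lambda>k. \<not> int l dvd k"] th_add[of "int (neg_count (\<lambda>k. \<not> int l dvd k) ?x)" 1]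
    by (simp add: n1 algebra_simps)
  obtain r where r: "e x + smul ?c (e ?x) + r \<in> N"
    and r2: "r = 0 \<or> (\<exists>y z. Qr y < Qr x \<and> Qr z < Qr x \<and> r = e y + smul (th 1) (e z))"
    using straighten_step[OF i] by blast
  have k: "e z \<in> straight (Qr x) UNIV" if "Qr z < Qr x" for z using ket_straighten_less[OF that] by (rule straight_mono) auto
  have rS: "r \<in> straight (Qr x) UNIV" using r2
  proof
    assume "\<exists>y z. Qr y < Qr x \<and> Qr z < Qr x \<and> r = e y + smul (th 1) (e z)"
    then show ?thesis using straight_UNIV_add straight_UNIV_smul k by blast
  qed (use straight_N[OF K.span_zero] in simp)
  have 1: "- smul ?c (e ?x - smul (?s ?x) (e y)) - r \<in> straight (Qr x) UNIV"
    by (intro straight_UNIV_diff straight_UNIV_neg straight_UNIV_smul IH rS)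
  show ?case
  proof (rule straight_cong[OF 1])
    have "smul (?s x) (e y) = - smul ?c (smul (?s ?x) (e y))" unfolding s by simp
    then have eq: "e x - smul (?s x) (e y) - (- smul ?c (e ?x - smul (?s ?x) (e y)) - r) = e x + smul ?c (e ?x) + r"
      unfolding K.scale_right_diff_distrib by (simp only:) (simp add: algebra_simps)
    show "e x - smul (?s x) (e y) - (- smul ?c (e ?x - smul (?s ?x) (e y)) - r) \<in> N" unfolding eq by (rule r)
  qed
qed

text \<open>At w0 . y every positive coroot is negative, so the leading coefficient is the inverse
  of \<open>bar_coeff y\<close>. This is what the normalization of the bar involution is designed
  for.\<close>

lemma bar_ket_dominant: assumes y: "y \<in> dominant D" shows "bar (e y) - e y \<in> straight (Qr y) UNIV"
proof -
  let ?x = "dot D wo y"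
  have y0: "ip \<beta> (y + rho D) > 0" if "\<beta> \<in> Rp" for \<beta>
    by (rule reg_pos[OF _ that]) (use y in \<open>auto simp: dominant_iff\<close>)
  have neg: "ip \<beta> (?x + rho D) < 0" if b: "\<beta> \<in> Rp" for \<beta>
  proof -
    have "ip \<beta> (?x + rho D) = - ip (- wo \<beta>) (y + rho D)"
      using coroot_W[OF wo_W pos_root[OF b], of "wo (y + rho D)"] b
      by (simp add: dot_def wo_wo coroot_neg_root W_root wo_W pos_root)
    then show ?thesis using y0[OF wo_neg[OF b]] by simp
  qed
  have n1: "neg_count (\<lambda>_. True) ?x = card Rp" unfolding neg_count_def using neg by (intro arg_cong[where f = card]) auto
  have "{\<beta> \<in> Rp. ip \<beta> (?x + rho D) < 0 \<and> \<not> int l dvd ip \<beta> (?x + rho D)}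
      = Rp - {\<beta> \<in> Rp. int l dvd ip \<beta> (?x + rho D)}" using neg by auto
  then have "neg_count (\<lambda>k. \<not> int l dvd k) ?x = card Rp - wc ?x"
    unfolding neg_count_def wall_count_def using finite_Rp by (simp add: card_Diff_subset)
  moreover have "wc y \<le> card Rp" unfolding wall_count_def by (rule card_mono[OF finite_Rp]) auto
  ultimately have n2: "int (neg_count (\<lambda>k. \<not> int l dvd k) ?x) = int (card Rp) - int (wc y)"
    by (simp add: wc_W wo_W)
  have lt: "e ?x - smul ((- 1) ^ card Rp * th (int (card Rp) - int (wc y))) (e y) \<in> straight (Qr ?x) UNIV"
    using leading_term[OF y wo_W refl] unfolding n1 n2 .
  have bar_coeff: "(- 1) ^ card Rp * th (int (card Rp) - int (wc y)) = laurent_bar (bar_coeff y)"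
    by (simp add: bar_coeff_def laurent_bar_mult laurent_bar_th laurent_bar_minus_one_power)
  have Qx: "Qr ?x = Qr y" using wo_W by (simp add: dot_def Q_W)
  have "smul (bar_coeff y) (e ?x - smul (laurent_bar (bar_coeff y)) (e y)) \<in> straight (Qr y) UNIV"
    using straight_UNIV_smul[OF lt] unfolding Qx bar_coeff .
  moreover have "smul (bar_coeff y) (e ?x - smul (laurent_bar (bar_coeff y)) (e y)) = bar (e y) - e y"
    using bar_coeff_bar_coeff[of y] by (simp add: bar_ket K.scale_right_diff_distrib mult.commute)
  ultimately show ?thesis by simp
qed

section \<open>Triangularity of the bar involution and existence of the canonical basis\<close>

definition cbar :: "('a \<Rightarrow>\<^sub>0 laurent) \<Rightarrow> ('a \<Rightarrow>\<^sub>0 laurent)" where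
  "cbar y = (\<Sum>k\<in>ks y. smul (laurent_bar (lk y k)) (e k))"

lemma lk_cbar: "lk (cbar y) k = laurent_bar (lk y k)"
  by (simp add: cbar_def lookup_sum lookup_smul lk_ket0 finite_keys in_keys_iff laurent_bar_0 if_distrib cong: if_cong)

lemma keys_cbar: "ks (cbar y) \<subseteq> ks y"
  by (auto simp: in_keys_iff lk_cbar laurent_bar_0)

lemma bar_triangular: assumes y: "y \<in> domcomb (Suc n) UNIV" shows "bar y - cbar y \<in> straight n UNIV"
proof -
  have "bar y = bar (\<Sum>k\<in>ks y. smul (lk y k) (e k))" by (simp only: ket_expand)
  then have "bar y - cbar y = (\<Sum>k\<in>ks y. smul (laurent_bar (lk y k)) (bar (e k) - e k))"
    by (simp add: bar_sum bar_smul cbar_def sum_subtractf K.scale_right_diff_distrib)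
  also have "\<dots> \<in> straight n UNIV"
  proof (intro straight_sum straight_UNIV_smul)
    fix k assume "k \<in> ks y"
    then have "k \<in> dominant D" "Qr k \<le> n" using y by (auto simp: domcomb_def)
    then show "bar (e k) - e k \<in> straight n UNIV" using straight_mono[OF bar_ket_dominant, of k n UNIV] by simp
  qed auto
  finally show ?thesis .
qed

lemma straight_dominant:
  assumes "x \<in> straight n A" "ks x \<subseteq> dominant D" shows "x \<in> domcomb n A"
proof -
  obtain y where y: "y \<in> domcomb n A" "x - y \<in> N" using assms by (auto simp: straight_def)
  have "ks (x - y) \<subseteq> ks x \<union> ks y" by (rule Poly_Mapping.keys_diff)
  then have "ks (x - y) \<subseteq> dominant D" using assms(2) y(1) by (auto simp: domcomb_def)
  then show ?thesis using independent_dominant[OF y(2)] y(1) by simp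
qed

lemma domcomb_top: "y \<in> domcomb n A \<Longrightarrow> Qr k \<ge> n \<Longrightarrow> lk y k = 0"
  by (force simp: domcomb_def in_keys_iff)

lemma domcomb_bound: "ks y \<subseteq> dominant D \<Longrightarrow> \<exists>n. y \<in> domcomb n UNIV"
proof
  assume k: "ks y \<subseteq> dominant D"
  have "Qr k < Suc (Max (Qr ` ks y))" if "k \<in> ks y" for k using that by (simp add: finite_keys less_Suc_eq_le)
  then show "y \<in> domcomb (Suc (Max (Qr ` ks y))) UNIV" using k by (simp add: domcomb_def)
qed

text \<open>In the top layer the bar involution acts on coefficients alone, and an element of the
  ideal of t^(1/2) that equals its own bar is 0. So the layers vanish one after another.\<close>

lemma bar_invariant_zero:
  assumes k: "ks d \<subseteq> dominant D" and p: "\<And>x. lk d x \<in> th_positive" and b: "bar d - d \<in> N"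
  shows "d = 0"
proof -
  have "d \<in> domcomb n UNIV \<Longrightarrow> d = 0" for n
  proof (induction n)
    case 0
    then have "ks d = {}" by (auto simp: domcomb_def)
    then show ?case by simp
  next
    case (Suc n)
    have "bar d - cbar d \<in> straight n UNIV" by (rule bar_triangular[OF Suc.prems])
    then have "d - cbar d \<in> straight n UNIV"
      by (rule straight_cong) (use b in \<open>metis (no_types, lifting) K.span_neg minus_diff_eq diff_diff_eq2 diff_add_cancel\<close>)
    moreover have "ks (d - cbar d) \<subseteq> dominant D" using Poly_Mapping.keys_diff[of d "cbar d"] keys_cbar[of d] k by blast
    ultimately have "d - cbar d \<in> domcomb n UNIV" by (rule straight_dominant)
    then have "lk (d - cbar d) x = 0" if "Qr x \<ge> n" for x using domcomb_top that by blast
    then have "lk d x = 0" if "Qr x \<ge> n" for x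
      using that th_positive_bar[OF p[of x]] by (simp add: lookup_minus lk_cbar)
    then have "d \<in> domcomb n UNIV" using k by (force simp: domcomb_def in_keys_iff)
    then show ?case by (rule Suc.IH)
  qed
  then show ?thesis using domcomb_bound[OF k] by blast
qed

text \<open>Solved from the top layer downwards; in the top layer the bar involution acts on coefficients only.\<close>

lemma bar_split:
  "x \<in> domcomb n UNIV \<Longrightarrow> bar x + x \<in> N \<Longrightarrow> \<exists>y\<in>domcomb n th_positive. x - (y - bar y) \<in> N"
proof (induction n arbitrary: x)
  case 0
  then have "x = 0" by (auto simp: domcomb_def)
  then show ?case using domcomb_0[OF th_positive_0] by (intro bexI[of _ 0]) (auto simp: bar_0 K.span_zero)
next
  case (Suc n)
  have kx: "ks x \<subseteq> dominant D" using Suc.prems by (simp add: domcomb_def)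
  have "- (bar x - cbar x) \<in> straight n UNIV" by (intro straight_UNIV_neg bar_triangular Suc.prems)
  then have "x + cbar x \<in> straight n UNIV" by (rule straight_cong) (use Suc.prems in \<open>simp add: algebra_simps\<close>)
  moreover have "ks (x + cbar x) \<subseteq> dominant D" using Poly_Mapping.keys_add[of x "cbar x"] keys_cbar[of x] kx by blast
  ultimately have "x + cbar x \<in> domcomb n UNIV" by (rule straight_dominant)
  then have "lk (x + cbar x) k = 0" if "Qr k \<ge> n" for k using domcomb_top that by blast
  then have anti: "laurent_bar (lk x k) = - lk x k" if "Qr k \<ge> n" for k
    using that by (simp add: lookup_add lk_cbar eq_neg_iff_add_eq_0 add.commute)
  let ?T = "{k \<in> ks x. Qr k = n}"
  \<comment> \<open>The positive parts of the top coefficients: since these are antisymmetric, y -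
    \<open>cbar y\<close> reproduces the whole top layer of x.\<close>
  define y where "y = (\<Sum>k\<in>?T. smul (pos_part (lk x k)) (e k))"
  have lky: "lk y k = (if k \<in> ?T then pos_part (lk x k) else 0)" for k
    by (simp add: y_def lookup_sum lookup_smul lk_ket0 finite_keys if_distrib cong: if_cong)
  have ky: "ks y \<subseteq> ?T" by (auto simp: in_keys_iff lky split: if_splits)
  have y: "y \<in> domcomb (Suc n) th_positive"
    using ky kx by (auto simp: domcomb_def lky pos_part_positive th_positive_0)
  have "bar y - cbar y \<in> straight n UNIV" by (rule bar_triangular[OF domcomb_mono[OF y]]) auto
  moreover have "x - (y - cbar y) \<in> straight n UNIV"
  proof (rule straight_domcomb)
    have "lk (x - (y - cbar y)) k = 0" if "Qr k \<ge> n" for k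
    proof (cases "k \<in> ?T")
      case True
      then show ?thesis using pos_part_antisym[OF anti[OF that]] by (simp add: lookup_minus lk_cbar lky)
    next
      case False
      then have "lk x k = 0" using Suc.prems(1) that by (force simp: domcomb_def in_keys_iff)
      moreover have "lk y k = 0" unfolding lky using False by (rule if_not_P)
      ultimately show ?thesis by (simp add: lookup_minus lk_cbar laurent_bar_0)
    qed
    moreover have "ks (x - (y - cbar y)) \<subseteq> dominant D"
      using Poly_Mapping.keys_diff[of x "y - cbar y"] Poly_Mapping.keys_diff[of y "cbar y"] keys_cbar[of y] ky kx by blast
    ultimately show "x - (y - cbar y) \<in> domcomb n UNIV" by (force simp: domcomb_def in_keys_iff)
  qed
  ultimately have "x - (y - cbar y) + (bar y - cbar y) \<in> straight n UNIV" by (intro straight_UNIV_add)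
  then have "x - (y - bar y) \<in> straight n UNIV" by (simp add: algebra_simps)
  then obtain x2 where x2: "x2 \<in> domcomb n UNIV" "x - (y - bar y) - x2 \<in> N" by (auto simp: straight_def)
  \<comment> \<open>Antisymmetry passes from x to the shorter remainder \<open>x2\<close>, because y
    - \<open>bar y\<close> is antisymmetric and \<open>?u\<close> lies in \<open>N\<close>.\<close>
  let ?u = "x - (y - bar y) - x2"
  have "bar x + x - (bar ?u + ?u) \<in> N"
    by (rule K.span_diff[OF Suc.prems(2) K.span_add[OF bar_N[OF x2(2)] x2(2)]])
  moreover have "bar x + x - (bar ?u + ?u) = bar x2 + x2" unfolding bar_diff bar_bar by (simp add: algebra_simps)
  ultimately have "bar x2 + x2 \<in> N" by simp
  then obtain y2 where y2: "y2 \<in> domcomb n th_positive" "x2 - (y2 - bar y2) \<in> N" using Suc.IH x2(1) by blast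
  have "y + y2 \<in> domcomb (Suc n) th_positive"
    by (rule domcomb_add[OF y domcomb_mono[OF y2(1)] th_positive_add]) auto
  moreover have "?u + (x2 - (y2 - bar y2)) \<in> N" using x2(2) y2(2) by (rule K.span_add)
  then have "x - ((y + y2) - bar (y + y2)) \<in> N" by (simp add: bar_add algebra_simps)
  ultimately show ?case by blast
qed

text \<open>The failure of the ket to be bar invariant is antisymmetric, the bar being an
  involution. Writing it as p - \<open>bar p\<close> by \<open>bar_split\<close> gives the
  correction p.\<close>

lemma canonical_ex:
  assumes y: "y \<in> dominant D"
  shows "\<exists>p\<in>domcomb (Qr y) th_positive. bar (e y + p) - (e y + p) \<in> N"
proof -
  obtain x where x: "x \<in> domcomb (Qr y) UNIV" "bar (e y) - e y - x \<in> N" using bar_ket_dominant[OF y] by (auto simp: straight_def)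
  let ?u = "bar (e y) - e y - x"
  have "- (bar ?u + ?u) \<in> N" using x(2) bar_N by (intro K.span_neg K.span_add) auto
  moreover have "- (bar ?u + ?u) = bar x + x" unfolding bar_diff bar_bar by (simp add: algebra_simps)
  ultimately obtain p where p: "p \<in> domcomb (Qr y) th_positive" "x - (p - bar p) \<in> N" using bar_split[OF x(1)] by metis
  have "?u + (x - (p - bar p)) \<in> N" using x(2) p(2) by (rule K.span_add)
  moreover have "?u + (x - (p - bar p)) = bar (e y + p) - (e y + p)" by (simp add: bar_add algebra_simps)
  ultimately show ?thesis using p(1) by auto
qed

subsection \<open>The lattice modulo $t^{1/2}$\<close>

text \<open>The multiples of t^(1/2) in the lattice spanned by all kets, together with the
  relations. Nondominant kets are allowed since straightening preserves the lattice.\<close>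

definition J :: "('a \<Rightarrow>\<^sub>0 laurent) set" where
  "J = {x. \<exists>y. x - y \<in> N \<and> (\<forall>k. lk y k \<in> th_positive)}"

lemma J_add: assumes "x \<in> J" "y \<in> J" shows "x + y \<in> J"
proof -
  obtain x' y' where *: "x - x' \<in> N" "y - y' \<in> N" "\<forall>k. lk x' k \<in> th_positive" "\<forall>k. lk y' k \<in> th_positive"
    using assms by (auto simp: J_def)
  then have "(x - x') + (y - y') \<in> N" by (intro K.span_add)
  then have "x + y - (x' + y') \<in> N" by (simp add: algebra_simps)
  moreover have "\<forall>k. lk (x' + y') k \<in> th_positive" using * by (simp add: lookup_add th_positive_add)
  ultimately show ?thesis by (auto simp: J_def)
qed

lemma J_smul: assumes "x \<in> J" "c \<in> th_nonneg" shows "smul c x \<in> J"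
proof -
  obtain y where y: "x - y \<in> N" "\<forall>k. lk y k \<in> th_positive" using assms by (auto simp: J_def)
  then have "smul c x - smul c y \<in> N" by (metis K.scale_right_diff_distrib K.span_scale)
  moreover have "\<forall>k. lk (smul c y) k \<in> th_positive"
    using y th_positive_mult[OF _ assms(2)] by (simp add: lookup_smul mult.commute[of c])
  ultimately show ?thesis by (auto simp: J_def)
qed

lemma J_neg: "x \<in> J \<Longrightarrow> - x \<in> J" using J_smul[OF _ th_nonneg_minus_1(1)] by simp

lemma J_diff: "x \<in> J \<Longrightarrow> y \<in> J \<Longrightarrow> x - y \<in> J" using J_add[of x "- y"] J_neg by simp

lemma J_N: "x \<in> N \<Longrightarrow> x \<in> J" by (auto simp: J_def th_positive_0 intro!: exI[of _ 0])

lemma J_positive: "(\<And>k. lk x k \<in> th_positive) \<Longrightarrow> x \<in> J"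
  by (auto simp: J_def K.span_zero intro!: exI[of _ x])

lemma J_sum: "(\<And>a. a \<in> A \<Longrightarrow> f a \<in> J) \<Longrightarrow> sum f A \<in> J"
  by (induction A rule: infinite_finite_induct) (auto simp: J_add J_N K.span_zero)

lemma J_straighten: assumes "x \<in> J" shows "\<exists>y. x - y \<in> N \<and> ks y \<subseteq> dominant D \<and> (\<forall>k. lk y k \<in> th_positive)"
proof -
  obtain z where z: "x - z \<in> N" "\<forall>k. lk z k \<in> th_positive" using assms by (auto simp: J_def)
  define n where "n = Suc (Max (Qr ` ks z))"
  have "(\<Sum>k\<in>ks z. smul (lk z k) (e k)) \<in> straight n th_positive"
  proof (rule straight_sum[OF _ th_positive_0 th_positive_add])
    fix k assume k: "k \<in> ks z"
    then have "Qr k < n" by (simp add: n_def finite_keys less_Suc_eq_le)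
    then have "e k \<in> straight n th_nonneg" by (rule ket_straighten_less)
    then show "smul (lk z k) (e k) \<in> straight n th_positive" using z(2) th_positive_mult by (intro straight_smul) auto
  qed
  then obtain y where y: "y \<in> domcomb n th_positive" "z - y \<in> N" by (auto simp: ket_expand straight_def)
  have "(x - z) + (z - y) \<in> N" using z(1) y(2) by (rule K.span_add)
  then show ?thesis using y(1) by (auto simp: domcomb_def)
qed

text \<open>By linear independence the quotient of the lattice is free over the integers.\<close>

lemma J_torsion:
  assumes m: "m \<noteq> 0" and j: "smul (of_int m) x \<in> J" shows "x \<in> J"
proof -
  define n where "n = Suc (Max (Qr ` ks x))"
  have "(\<Sum>k\<in>ks x. smul (lk x k) (e k)) \<in> straight n UNIV"
  proof (rule straight_sum)
    fix k assume k: "k \<in> ks x"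
    then have "Qr k < n" by (simp add: n_def finite_keys less_Suc_eq_le)
    then have "e k \<in> straight n th_nonneg" by (rule ket_straighten_less)
    then show "smul (lk x k) (e k) \<in> straight n UNIV" by (intro straight_UNIV_smul) (auto elim: straight_mono)
  qed auto
  then obtain v where v: "v \<in> domcomb n UNIV" "x - v \<in> N" by (auto simp: ket_expand straight_def)
  obtain y where y: "smul (of_int m) x - y \<in> N" "ks y \<subseteq> dominant D" "\<And>k. lk y k \<in> th_positive"
    using J_straighten[OF j] by blast
  have "smul (of_int m) x - y - smul (of_int m) (x - v) \<in> N" by (rule K.span_diff[OF y(1) K.span_scale[OF v(2)]])
  then have "smul (of_int m) v - y \<in> N" by (simp add: K.scale_right_diff_distrib)
  moreover have "ks (smul (of_int m) v) \<subseteq> ks v" by (auto simp: in_keys_iff lookup_smul)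
  then have "ks (smul (of_int m) v - y) \<subseteq> dominant D"
    using Poly_Mapping.keys_diff[of "smul (of_int m) v" y] y(2) v(1) by (force simp: domcomb_def)
  ultimately have e: "smul (of_int m) v = y" using independent_dominant by force
  have "lk v k \<in> th_positive" for k
  proof -
    have "of_int m * lk v k \<in> th_positive" using y(3)[of k] by (simp flip: e add: lookup_smul)
    then show ?thesis using m by (simp add: th_positive_iff of_int_mult_lookup)
  qed
  then show ?thesis using v(2) by (auto simp: J_def)
qed

text \<open>For restricted z the residue l - 1 - <z, \<alpha>_i^v> lies between 0 and l - 1. Hence
  reflecting m by the dot action gives exactly the partner ket of a wall or third type relation,
  whose other kets carry a factor t^(1/2).\<close>

lemma J_reflect:
  assumes i: "i \<in> I" and a: "0 \<le> ip (al i) z" "ip (al i) z < int l"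
  shows "e (zmul (int l) (sd i m) + z) + e (zmul (int l) m + z) \<in> J"
proof -
  let ?k = "pr i m" and ?a = "ip (al i) z" and ?x = "zmul (int l) m + z"
  have r: "al i \<in> R" using i simple_root by blast
  have px: "pr i ?x = int l * ?k - int l + ?a + 1"
    using i r by (simp add: pr_def coroot_add coroot_zmul coroot_rho algebra_simps)
  have x2: "zmul (int l) (sd i m) + z = ?x - zmul (?k * int l) (al i)"
    by (simp add: sd_def Z.scale_right_diff_distrib zmul_mult mult.commute algebra_simps)
  show ?thesis
  proof (cases "?a + 1 = int l")
    case True
    then have p: "pr i ?x = ?k * int l" using px by (simp add: mult.commute)
    then have "zmul (int l) (sd i m) + z = sd i ?x" unfolding x2 by (simp add: sd_def)
    moreover have "int l dvd pr i ?x" using p by simp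
    ultimately show ?thesis using rel_wall[OF i, of ?x] by (simp add: J_N)
  next
    case False
    \<comment> \<open>The relation is applied at the reflected weight, so that the two kets of
      interest appear without the factor t^(1/2).\<close>
    let ?z = "sd i ?x"
    have "pr i ?z = - ?k * int l + (int l - ?a - 1)" using px i by (simp add: pr_sd mult.commute)
    moreover have "0 < int l - ?a - 1" "int l - ?a - 1 < int l" using a False by auto
    ultimately have n: "rr i ?z + rr i (?z - zmul (- ?k * int l) (al i)) \<in> N" by (rule rel_higher[OF i])
    have s2: "sd i (?z - zmul (- ?k * int l) (al i)) = zmul (int l) (sd i m) + z"
      unfolding x2 sd_shift[OF i] sd_sd[OF i] by simp
    let ?t = "e ?z + e (?z - zmul (- ?k * int l) (al i))"
    have "smul (th 1) ?t \<in> J"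
      using th_positive_th th_positive_0 th_positive_add
      by (intro J_positive) (auto simp: lookup_smul lookup_add lk_ket0 distrib_left)
    then have "rr i ?z + rr i (?z - zmul (- ?k * int l) (al i)) - smul (th 1) ?t \<in> J" using n J_N J_diff by blast
    then show ?thesis unfolding rr_def s2 sd_sd[OF i] by (simp add: K.scale_right_distrib algebra_simps)
  qed
qed

text \<open>Minus the longest element permutes the simple roots and fixes \<rho>, so it commutes
  with the dot action up to this permutation.\<close>

lemma dual_sd:
  assumes i: "i \<in> I" shows "\<exists>j\<in>I. \<forall>m. dual (sd i m) = sd j (dual m)"
proof -
  obtain j where j: "j \<in> I" "wo (al i) = - al j" using wo_simple[OF i] by blast
  have ri: "al i \<in> R" and rj: "al j \<in> R" using i j simple_root by auto
  have "dual (sd i m) = sd j (dual m)" for m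
  proof -
    have "wo (rf (al i) (m + rho D)) = rf (al j) (wo (m + rho D))"
      using reflect_W[OF wo_W ri] rj by (simp add: j reflect_neg_root)
    then have "dual (sd i m) = rf (al j) (- wo (m + rho D)) - rho D"
      using wo_W rj by (simp flip: sd_dot add: dual_weight_def dot_def W_diff wo_rho reflect_neg)
    then show ?thesis using wo_W by (simp flip: sd_dot add: dual_weight_def dot_def W_add wo_rho)
  qed
  then show ?thesis using j by blast
qed

lemma invariant_nonneg: "invariant f \<Longrightarrow> lk f k \<in> th_nonneg"
  by (metis invariant_def rangeE th_nonneg_of_int)

text \<open>
  The map $\mu \mapsto |\ell\mu^* + z\rangle$ is antisymmetric for the dot action modulo \<open>J\<close>, so it sends both sides of
  $s_\nu a_0 = a_\nu$ to the order of the Weyl group times the two vectors to be compared.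
\<close>

lemma weyl_char_lattice:
  assumes z: "\<And>i. i \<in> I \<Longrightarrow> 0 \<le> ip (al i) z \<and> ip (al i) z < int l" and nu: "\<nu> \<in> dominant D"
  shows "act0 D l (weyl_char D \<nu>) (e z) - e (zmul (int l) (dual \<nu>) + z) \<in> J"
proof -
  let ?f = "weyl_char D \<nu>" and ?p = "\<lambda>m. e (zmul (int l) (dual m) + z)"
  have inv: "invariant ?f" and q: "?f * wa 0 = wa \<nu>" using weyl_char[OF nu] by auto
  have refl: "?p (sd i m) + ?p m \<in> J" if i: "i \<in> I" for i m
  proof -
    obtain j where j: "j \<in> I" "dual (sd i m) = sd j (dual m)" using dual_sd[OF i] by blast
    show ?thesis unfolding j(2) using J_reflect[OF j(1)] z[OF j(1)] by blast
  qed
  have alt: "?p (dot D w m) - smul (of_int (eps w)) (?p m) \<in> J" if "w \<in> W" for w m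
    using that
  proof (induction rule: W_induct)
    case id show ?case unfolding lattice_det_id dot_id using J_N[OF K.span_zero] by simp
  next
    case (step i w)
    let ?y = "dot D w m"
    have "?p (sd i ?y) + ?p ?y - (?p ?y - smul (of_int (eps w)) (?p m)) \<in> J"
      by (intro J_diff refl step)
    then show ?case unfolding dot_comp sd_dot eps_simple[OF step(2,1)] by (simp add: algebra_simps)
  qed
  have alt2: "smul (of_int (eps w)) (?p (dot D w m)) - ?p m \<in> J" if w: "w \<in> W" for w m
  proof -
    have "smul (of_int (eps w)) (?p (dot D w m) - smul (of_int (eps w)) (?p m)) \<in> J"
      using J_smul[OF alt[OF w] th_nonneg_of_int] .
    moreover have "smul (of_int (eps w)) (smul (of_int (eps w)) (?p m)) = ?p m"
      using eps_sq[OF w] by (simp flip: of_int_mult)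
    ultimately show ?thesis by (simp add: K.scale_right_diff_distrib)
  qed
  have card: "(\<Sum>w\<in>W. x) = smul (of_int (int (card W))) x" for x :: "'a \<Rightarrow>\<^sub>0 laurent"
    using K.sum_constant_scale[of x W] by (simp only: of_int_of_nat_eq)
  have A: "lin ?p (wa \<nu>) - smul (of_int (int (card W))) (?p \<nu>) \<in> J"
  proof -
    have "lin ?p (wa \<nu>) = (\<Sum>w\<in>W. smul (of_int (eps w)) (?p (dot D w \<nu>)))"
      by (simp add: weyl_alternating_def lin_sum lin_single)
    then have "lin ?p (wa \<nu>) - (\<Sum>w\<in>W. ?p \<nu>) = (\<Sum>w\<in>W. smul (of_int (eps w)) (?p (dot D w \<nu>)) - ?p \<nu>)"
      by (simp add: sum_subtractf)
    also have "\<dots> \<in> J" using alt2 by (intro J_sum)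
    finally show ?thesis unfolding card .
  qed
  have fint: "lk ?f k \<in> th_nonneg" for k using invariant_nonneg[OF inv] .
  have A2: "lin ?p (?f * wa 0) - smul (of_int (int (card W))) (lin ?p ?f) \<in> J"
  proof -
    \<comment> \<open>By invariance the exponents may be moved by the inverse of w; then every w
      contributes the same vector modulo \<open>J\<close>.\<close>
    have re: "(\<Sum>k\<in>ks ?f. smul (lk ?f k) (?p (inv w k))) = lin ?p ?f" if w: "w \<in> W" for w
      unfolding lin_def
    proof (rule sum.reindex_bij_witness[of _ w "inv w"])
      fix k assume k: "k \<in> ks ?f"
      have iv: "lk ?f (v x) = lk ?f x" if "v \<in> W" for v x using inv that by (simp add: invariant_def)
      show "w (inv w k) = k" "inv w (w k) = k" using w by (auto simp: W_inv_left W_inv_right)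
      show "inv w k \<in> ks ?f" "w k \<in> ks ?f" using k iv W_inv w by (auto simp: in_keys_iff)
      show "smul (lk ?f (inv w k)) (?p (inv w k)) = smul (lk ?f k) (?p (inv w k))" using iv W_inv w by simp
    qed
    have "lin ?p (?f * wa 0) = (\<Sum>w\<in>W. \<Sum>k\<in>ks ?f. smul (lk ?f k) (smul (of_int (eps w)) (?p (k + dot D w 0))))"
      unfolding mult_wa0 by (simp add: lin_sum lin_single)
    moreover have "smul (of_int (int (card W))) (lin ?p ?f) = (\<Sum>w\<in>W. \<Sum>k\<in>ks ?f. smul (lk ?f k) (?p (inv w k)))"
      unfolding card[symmetric] using re by (intro sum.cong) auto
    ultimately have "lin ?p (?f * wa 0) - smul (of_int (int (card W))) (lin ?p ?f)
      = (\<Sum>w\<in>W. \<Sum>k\<in>ks ?f. smul (lk ?f k) (smul (of_int (eps w)) (?p (k + dot D w 0)) - ?p (inv w k)))"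
      by (simp only: sum_subtractf[symmetric] K.scale_right_diff_distrib)
    also have "\<dots> \<in> J"
    proof (intro J_sum J_smul fint)
      fix w k assume w: "w \<in> W"
      have "k + dot D w 0 = dot D w (inv w k)" using w by (simp add: dot_def W_add W_inv_right W_0 algebra_simps)
      then show "smul (of_int (eps w)) (?p (k + dot D w 0)) - ?p (inv w k) \<in> J" using alt2[OF w, of "inv w k"] by simp
    qed
    finally show ?thesis .
  qed
  have "smul (of_int (int (card W))) (lin ?p ?f - ?p \<nu>)
      = lin ?p (wa \<nu>) - smul (of_int (int (card W))) (?p \<nu>) - (lin ?p (?f * wa 0) - smul (of_int (int (card W))) (lin ?p ?f))"
    by (simp add: q K.scale_right_diff_distrib)
  also have "\<dots> \<in> J" by (intro J_diff A A2)
  \<comment> \<open>The order of W is cancelled by \<open>J_torsion\<close>, which is where linear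
    independence of the dominant kets enters.\<close>
  finally have "lin ?p ?f - ?p \<nu> \<in> J" using J_torsion[of "int (card W)"] finite_W W_id by (auto simp: card_eq_0_iff)
  moreover have "act0 D l ?f (e z) = lin ?p ?f" unfolding act0_lin lin_ket0 by (simp only: lin_def)
  ultimately show ?thesis by simp
qed

subsection \<open>The quotient\<close>

lemma fock_class_eq: "fock_class D l x = fock_class D l y \<longleftrightarrow> x - y \<in> N"
proof -
  have "fock_class D l x = fock_class D l y \<longleftrightarrow> (x, y) \<in> fock_eq D l"
    unfolding fock_class_def by (rule eq_equiv_class_iff[OF equiv_fock_eq]) auto
  then show ?thesis by (simp add: fock_eq_def)
qed

lemma fock_lift:
  assumes "\<And>y. x - y \<in> N \<Longrightarrow> g x - g y \<in> N"
  shows "(\<Union>y\<in>fock_class D l x. fock_class D l (g y)) = fock_class D l (g x)"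
proof -
  have m: "y \<in> fock_class D l x \<longleftrightarrow> x - y \<in> N" for y by (simp add: fock_class_def fock_eq_def)
  have "fock_class D l (g y) = fock_class D l (g x)" if "y \<in> fock_class D l x" for y
    using assms that by (metis m fock_class_eq)
  moreover have "x \<in> fock_class D l x" by (simp add: m K.span_zero)
  ultimately show ?thesis by blast
qed

lemma fock_bar_class: "fock_bar D l (fock_class D l x) = fock_class D l (bar x)"
  unfolding fock_bar_def by (rule fock_lift) (metis bar_N bar_diff)

lemma fock_act_class: "invariant f \<Longrightarrow> fock_act D l f (fock_class D l x) = fock_class D l (act0 D l f x)"
  unfolding fock_act_def
proof (rule fock_lift)
  fix y assume "invariant f" "x - y \<in> N"
  then have "act0 D l f (x - y) \<in> N" by (rule act0_N)
  then show "act0 D l f x - act0 D l f y \<in> N" by (simp add: act0_lin lin_diff)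
qed

text \<open>Allowing y itself among the keys of p is convenient in applications, where straightening
  does not visibly avoid it.\<close>

lemma canonical_eq:
  assumes y: "y \<in> dominant D" and p: "ks p \<subseteq> dominant D" "\<And>k. lk p k \<in> th_positive"
    and b: "bar (e y + p) - (e y + p) \<in> N"
  shows "canonical D l y = fock_class D l (e y + p)"
proof -
  have uniq: "p = p'" if p': "ks p' \<subseteq> dominant D" "\<And>k. lk p' k \<in> th_positive" "bar (e y + p') - (e y + p') \<in> N" for p'
  proof -
    have "p - p' = 0"
    proof (rule bar_invariant_zero)
      show "ks (p - p') \<subseteq> dominant D" using Poly_Mapping.keys_diff[of p p'] p(1) p'(1) by blast
      show "lk (p - p') x \<in> th_positive" for x using p p' by (simp add: lookup_minus th_positive_diff)
      have "(bar (e y + p) - (e y + p)) - (bar (e y + p') - (e y + p')) \<in> N" using b p'(3) by (rule K.span_diff)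
      then show "bar (p - p') - (p - p') \<in> N" by (simp add: bar_add bar_diff algebra_simps)
    qed
    then show ?thesis by simp
  qed
  \<comment> \<open>Uniqueness against the constructed element, all of whose lower kets are strictly
    shorter than y, shows that y is not a key of p.\<close>
  obtain p1 where p1: "p1 \<in> domcomb (Qr y) th_positive" "bar (e y + p1) - (e y + p1) \<in> N" using canonical_ex[OF y] by blast
  then have "p = p1" by (intro uniq) (auto simp: domcomb_def)
  then have py: "y \<notin> ks p" using p1 by (auto simp: domcomb_def)
  have "is_canonical D l y (fock_class D l (e y + p))"
    unfolding is_canonical_def
  proof (intro conjI exI[of _ p] allI)
    show "fock_class D l (e y + p) \<in> fock_space D l" by (simp add: fock_space_def fock_class_def quotientI)
    show "fock_bar D l (fock_class D l (e y + p)) = fock_class D l (e y + p)"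
      by (simp add: fock_bar_class fock_class_eq b)
    show "ks p \<subseteq> dominant D - {y}" using p(1) py by blast
  qed (use p in auto)
  moreover have "c = fock_class D l (e y + p)" if c: "is_canonical D l y c" for c
  proof -
    obtain p' where p': "ks p' \<subseteq> dominant D - {y}" "\<And>k. lk p' k \<in> th_positive" "c = fock_class D l (e y + p')"
      and fb: "fock_bar D l c = c" using c by (auto simp: is_canonical_def)
    have "bar (e y + p') - (e y + p') \<in> N" using fb unfolding p'(3) fock_bar_class fock_class_eq .
    then have "p = p'" using p' by (intro uniq) auto
    then show ?thesis using p'(3) by simp
  qed
  ultimately show ?thesis unfolding canonical_def by (rule the_equality)
qed

end

theorem theorem1p3:
  fixes D :: "'a::ab_group_add root_datum" and l :: nat and lam lam0 lam1 :: 'a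
  assumes "based_root_datum D"
    and "l > 0"
    and "lam \<in> dominant D"
    and "lam = zmul (int l) lam1 + lam0"
    and "lam0 \<in> restricted D l"
    and "lam1 \<in> dominant D"
  shows "canonical D l lam = fock_act D l (weyl_char D (dual_weight D lam1)) (canonical D l lam0)"
proof -
  interpret fock D l by standard (use assms in auto)
  have r: "0 \<le> ip (al i) lam0 \<and> ip (al i) lam0 < int l" if i: "i \<in> I" for i
  proof -
    obtain a where a: "lam0 = (\<Sum>j\<in>I. zmul (int (a j)) (fund_weight D j))" "\<And>j. j \<in> I \<Longrightarrow> a j < l"
      using assms(5) by (auto simp: restricted_def I_def)
    have "ip (al i) (fund_weight D j) = (if j = i then 1 else 0)" if "j \<in> I" for j
      using assms(1) i that by (simp add: based_root_datum_def I_def)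
    then have "(\<Sum>j\<in>I. int (a j) * ip (al i) (fund_weight D j)) = (\<Sum>j\<in>I. if j = i then int (a i) else 0)"
      by (intro sum.cong) auto
    then have "ip (al i) lam0 = (\<Sum>j\<in>I. if j = i then int (a i) else 0)"
      unfolding a(1) using i by (simp add: coroot_sum coroot_zmul simple_root)
    then show ?thesis using i a(2) finite_I by simp
  qed
  have d0: "lam0 \<in> dominant D" using r by (simp add: dominant_iff')
  \<comment> \<open>Dominance transfers because minus the longest element permutes the simple
    roots.\<close>
  have nu: "dual lam1 \<in> dominant D" unfolding dominant_iff'
  proof
    fix i assume i: "i \<in> I"
    obtain j where j: "j \<in> I" "wo (al i) = - al j" using wo_simple[OF i] by blast
    have "ip (al i) (dual lam1) = - ip (wo (al i)) (wo (wo lam1))"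
      using i wo_W by (simp add: dual_weight_def coroot_neg coroot_W simple_root)
    then have "ip (al i) (dual lam1) = ip (al j) lam1" using j by (simp add: wo_wo coroot_neg_root simple_root)
    then show "0 \<le> ip (al i) (dual lam1)" using assms(6) j by (simp add: dominant_iff')
  qed
  let ?f = "weyl_char D (dual lam1)"
  have inv: "invariant ?f" using weyl_char(1)[OF nu] .
  obtain p where p: "p \<in> domcomb (Qr lam0) th_positive" "bar (e lam0 + p) - (e lam0 + p) \<in> N"
    using canonical_ex[OF d0] by blast
  have kp: "ks p \<subseteq> dominant D" "\<And>k. lk p k \<in> th_positive" using p(1) by (auto simp: domcomb_def)
  have c0: "canonical D l lam0 = fock_class D l (e lam0 + p)" by (rule canonical_eq[OF d0 kp p(2)])
  let ?z = "act0 D l ?f (e lam0 + p)"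
  have ad: "act0 D l ?f (x - y) = act0 D l ?f x - act0 D l ?f y" for x y by (simp add: act0_lin lin_diff)
  have zb: "bar ?z - ?z \<in> N" unfolding bar_act[OF inv] ad[symmetric] using act0_N[OF inv p(2)] .
  \<comment> \<open>The character has integer coefficients, so the lower terms stay in t^(1/2) times
    the lattice and only the leading ket matters modulo \<open>J\<close>.\<close>
  have "act0 D l ?f p \<in> J"
  proof -
    have "lk ?f m \<in> th_nonneg" for m using invariant_nonneg[OF inv] .
    then have "smul (lk p g * lk ?f m) (e x) \<in> J" for g m x
      using kp(2) th_positive_mult th_positive_0 by (intro J_positive) (auto simp: lookup_smul lk_ket0)
    then show ?thesis unfolding act0_def by (intro J_sum)
  qed
  moreover have "act0 D l ?f (e lam0) - e lam \<in> J"
    using weyl_char_lattice[OF r nu] unfolding dual_dual assms(4) .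
  ultimately have "act0 D l ?f p + (act0 D l ?f (e lam0) - e lam) \<in> J" by (rule J_add)
  then have "?z - e lam \<in> J" by (simp add: act0_add algebra_simps)
  then obtain y where y: "?z - e lam - y \<in> N" "ks y \<subseteq> dominant D" "\<And>k. lk y k \<in> th_positive"
    using J_straighten by blast
  \<comment> \<open>\<open>?u\<close> and its bar lie in \<open>N\<close>, so bar invariance passes
    from \<open>?z\<close> to the straightened representative, and uniqueness applies to it.\<close>
  let ?u = "?z - e lam - y"
  have "(bar ?z - ?z) - (bar ?u - ?u) \<in> N" by (rule K.span_diff[OF zb K.span_diff[OF bar_N[OF y(1)] y(1)]])
  then have "bar (e lam + y) - (e lam + y) \<in> N" by (simp add: bar_diff bar_add algebra_simps)
  then have "canonical D l lam = fock_class D l (e lam + y)" by (rule canonical_eq[OF assms(3) y(2,3)])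
  also have "\<dots> = fock_class D l ?z" unfolding fock_class_eq using K.span_neg[OF y(1)] by (simp add: algebra_simps)
  also have "\<dots> = fock_act D l ?f (canonical D l lam0)" by (simp only: c0 fock_act_class[OF inv])
  finally show ?thesis .
qed

end
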